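(* Let $\mathbf M$ be a self-dual complex 4-manifold. Then the projective structure of every $\beta$-surface $\beta\subset\mathbf M$ is flat.
   Context: Everything is holomorphic. A conformal structure $c$ on a complex 4-manifold $\mathbf M$ is a nondegenerate holomorphic section of $S^2T^*\mathbf M\otimes L^2$, $L$ a holomorphic line bundle with $L^4\simeq\kappa^{-1}$ ($\kappa$ the canonical bundle); it is locally represented by holomorphic metrics (nondegenerate symmetric $\mathbb C$-bilinear forms). An orientation is a choice of holomorphic Hodge operator $*$ on $\Lambda^2\mathbf M$ compatible with $c$, with $\pm1$-eigenbundles $\Lambda^\pm\mathbf M$. The Weyl tensor splits as $W=W^++W^-$, with $W^\pm$ acting on $\Lambda^\pm$; $\mathbf M$ is self-dual if $W^-=0$. An isotropic 2-plane $F\subset T_x\mathbf M$ is a $\beta$-plane if $\Lambda^2F\subset\Lambda^-$. A $\beta$-surface is a maximal totally geodesic surface tangent everywhere to $\beta$-planes. A projective structure is an equivalence class of (locally defined, torsion-free holomorphic) linear connections having the same unparametrized geodesics. The projective structure of a $\beta$-surface is the one whose geodesics are the null-geodesics of $\mathbf M$ contained in $\beta$; equivalently, it is the class of the connections induced on the totally geodesic surface $\beta$ by the Levi-Civita connections of local metrics in $c$. It is flat if it is locally equivalent to $\mathbb{CP}^2$ with its standard projective structure (geodesics = projective lines). *)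

theory Defs
  imports "HOL-Analysis.Analysis"
begin

section \<open>Holomorphic functions of several complex variables\<close>

text \<open>The derivative is taken over the reals by \<open>has_derivative\<close>; holomorphy says that it is
  given by complex coefficients. All domains \<open>S\<close> used below are open.\<close>

definition holo_fun :: "(complex^'n \<Rightarrow> complex) \<Rightarrow> (complex^'n) set \<Rightarrow> bool" where
  "holo_fun f S \<longleftrightarrow>
     (\<forall>z\<in>S. \<exists>a::complex^'n. (f has_derivative (\<lambda>v. \<Sum>i\<in>UNIV. a $ i * v $ i)) (at z))"

definition holo_map :: "(complex^'n \<Rightarrow> complex^'k) \<Rightarrow> (complex^'n) set \<Rightarrow> bool" where
  "holo_map f S \<longleftrightarrow> (\<forall>k. holo_fun (\<lambda>z. f z $ k) S)"

definition cpartial :: "'n \<Rightarrow> (complex^'n \<Rightarrow> complex) \<Rightarrow> complex^'n \<Rightarrow> complex" where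
  "cpartial i f z = deriv (\<lambda>t. f (z + t *s axis i 1)) 0"

definition jac :: "(complex^'n \<Rightarrow> complex^'k) \<Rightarrow> complex^'n \<Rightarrow> complex^'n^'k" where
  "jac f z = (\<chi> k i. cpartial i (\<lambda>w. f w $ k) z)"

section \<open>Complex manifolds, holomorphic maps\<close>

text \<open>A chart is a domain together with a coordinate map, relevant only on that domain.\<close>

type_synonym ('a, 'n) chart = "'a set \<times> ('a \<Rightarrow> complex^'n)"

abbreviation cdom :: "('a, 'n::finite) chart \<Rightarrow> 'a set" where
  "cdom a \<equiv> fst a"

abbreviation coord :: "('a, 'n::finite) chart \<Rightarrow> 'a \<Rightarrow> complex^'n" where
  "coord a \<equiv> snd a"

abbreviation cimg :: "('a, 'n::finite) chart \<Rightarrow> (complex^'n) set" where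
  "cimg a \<equiv> coord a ` cdom a"

definition cinv :: "('a, 'n::finite) chart \<Rightarrow> complex^'n \<Rightarrow> 'a" where
  "cinv a = inv_into (cdom a) (coord a)"

definition complex_manifold :: "'a topology \<Rightarrow> ('a, 'n::finite) chart set \<Rightarrow> bool" where
  "complex_manifold X A \<longleftrightarrow>
     Hausdorff_space X \<and> second_countable X \<and>
     (\<Union>a\<in>A. cdom a) = topspace X \<and>
     (\<forall>a\<in>A. openin X (cdom a) \<and> open (cimg a) \<and>
        homeomorphic_map (subtopology X (cdom a)) (top_of_set (cimg a)) (coord a)) \<and>
     (\<forall>a\<in>A. \<forall>b\<in>A. holo_map (coord b \<circ> cinv a) (coord a ` (cdom a \<inter> cdom b)))"

definition holo_between ::
  "'a topology \<Rightarrow> ('a, 'n::finite) chart set \<Rightarrow> 'a set \<Rightarrow> 'b topology \<Rightarrow> ('b, 'k::finite) chart set \<Rightarrow> ('a \<Rightarrow> 'b) \<Rightarrow> bool"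
where
  "holo_between X A N Y B f \<longleftrightarrow>
     openin X N \<and> continuous_map (subtopology X N) Y f \<and>
     (\<forall>a\<in>A. \<forall>b\<in>B. holo_map (coord b \<circ> f \<circ> cinv a) (coord a ` (cdom a \<inter> N \<inter> f -` cdom b)))"

definition biholo_between ::
  "'a topology \<Rightarrow> ('a, 'n::finite) chart set \<Rightarrow> 'a set \<Rightarrow> 'b topology \<Rightarrow> ('b, 'k::finite) chart set \<Rightarrow> 'b set \<Rightarrow> ('a \<Rightarrow> 'b) \<Rightarrow> bool"
where
  "biholo_between X A N Y B M f \<longleftrightarrow>
     holo_between X A N Y B f \<and> bij_betw f N M \<and> holo_between Y B M X A (inv_into N f)"

section \<open>Local Riemannian geometry of a holomorphic metric\<close>

text \<open>A metric on an open subset of \<open>\<complex>\<^sup>n\<close> is a matrix-valued function. \<open>christoffel G z $ k $ i $ j\<close>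
  is \<open>\<Gamma>\<^sup>k\<^sub>i\<^sub>j\<close>, the Levi-Civita connection of \<open>G\<close>.\<close>

definition holo_metric :: "(complex^'n \<Rightarrow> complex^'n^'n) \<Rightarrow> (complex^'n) set \<Rightarrow> bool" where
  "holo_metric G S \<longleftrightarrow>
     (\<forall>i j. holo_fun (\<lambda>z. G z $ i $ j) S) \<and> (\<forall>z\<in>S. transpose (G z) = G z \<and> det (G z) \<noteq> 0)"

definition christoffel :: "(complex^'n \<Rightarrow> complex^'n^'n) \<Rightarrow> complex^'n \<Rightarrow> complex^'n^'n^'n" where
  "christoffel G z = (\<chi> k i j. (\<Sum>l\<in>UNIV. matrix_inv (G z) $ k $ l *
      (cpartial i (\<lambda>w. G w $ j $ l) z + cpartial j (\<lambda>w. G w $ i $ l) z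
        - cpartial l (\<lambda>w. G w $ i $ j) z)) / 2)"

text \<open>\<open>R\<^sup>i\<^sub>j\<^sub>k\<^sub>l dx\<^sup>j \<partial>\<^sub>i = [\<nabla>\<^sub>k, \<nabla>\<^sub>l]\<close>, so that the Ricci tensor below is positive on spheres.\<close>

definition riemann :: "(complex^'n \<Rightarrow> complex^'n^'n) \<Rightarrow> complex^'n \<Rightarrow> 'n \<Rightarrow> 'n \<Rightarrow> 'n \<Rightarrow> 'n \<Rightarrow> complex" where
  "riemann G z i j k l =
     cpartial k (\<lambda>w. christoffel G w $ i $ l $ j) z - cpartial l (\<lambda>w. christoffel G w $ i $ k $ j) z
     + (\<Sum>m\<in>UNIV. christoffel G z $ i $ k $ m * christoffel G z $ m $ l $ j
                 - christoffel G z $ i $ l $ m * christoffel G z $ m $ k $ j)"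

definition riemann_low :: "(complex^'n \<Rightarrow> complex^'n^'n) \<Rightarrow> complex^'n \<Rightarrow> 'n \<Rightarrow> 'n \<Rightarrow> 'n \<Rightarrow> 'n \<Rightarrow> complex" where
  "riemann_low G z i j k l = (\<Sum>m\<in>UNIV. G z $ i $ m * riemann G z m j k l)"

definition ricci :: "(complex^'n \<Rightarrow> complex^'n^'n) \<Rightarrow> complex^'n \<Rightarrow> 'n \<Rightarrow> 'n \<Rightarrow> complex" where
  "ricci G z j l = (\<Sum>k\<in>UNIV. riemann G z k j k l)"

definition scalar_curv :: "(complex^'n \<Rightarrow> complex^'n^'n) \<Rightarrow> complex^'n \<Rightarrow> complex" where
  "scalar_curv G z = (\<Sum>j\<in>UNIV. \<Sum>l\<in>UNIV. matrix_inv (G z) $ j $ l * ricci G z j l)"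

definition weyl_low :: "(complex^4 \<Rightarrow> complex^4^4) \<Rightarrow> complex^4 \<Rightarrow> 4 \<Rightarrow> 4 \<Rightarrow> 4 \<Rightarrow> 4 \<Rightarrow> complex" where
  "weyl_low G z i j k l =
     riemann_low G z i j k l
     - (G z $ i $ k * ricci G z j l - G z $ i $ l * ricci G z j k
        - G z $ j $ k * ricci G z i l + G z $ j $ l * ricci G z i k) / 2
     + scalar_curv G z / 6 * (G z $ i $ k * G z $ j $ l - G z $ i $ l * G z $ j $ k)"

section \<open>Bivectors in dimension four\<close>

text \<open>Bivectors are skew matrices, both indices being contravariant.\<close>

definition bivector :: "complex^4^4 \<Rightarrow> bool" where
  "bivector F \<longleftrightarrow> transpose F = - F"

definition wedge :: "complex^4 \<Rightarrow> complex^4 \<Rightarrow> complex^4^4" where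
  "wedge u v = (\<chi> i j. u $ i * v $ j - u $ j * v $ i)"

text \<open>\<open>(W F)\<^sup>i\<^sup>j = 1/2 \<Sum> W\<^sup>i\<^sup>j\<^sub>k\<^sub>l F\<^sup>k\<^sup>l\<close>; it depends on the metric only up to a conformal factor.\<close>

definition weyl_op :: "(complex^4 \<Rightarrow> complex^4^4) \<Rightarrow> complex^4 \<Rightarrow> complex^4^4 \<Rightarrow> complex^4^4" where
  "weyl_op G z F =
     matrix_inv (G z) ** (\<chi> i j. (\<Sum>k\<in>UNIV. \<Sum>l\<in>UNIV. weyl_low G z i j k l * F $ k $ l) / 2)
       ** matrix_inv (G z)"

definition levi_civita :: "4 \<Rightarrow> 4 \<Rightarrow> 4 \<Rightarrow> 4 \<Rightarrow> complex" where
  "levi_civita i j k l = det (vector [axis i 1, axis j 1, axis k 1, axis l 1] :: complex^4^4)"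

text \<open>The Hodge operator on bivectors of the symmetric matrix \<open>g\<close> and the volume form
  \<open>s dx\<^sup>1 \<and> dx\<^sup>2 \<and> dx\<^sup>3 \<and> dx\<^sup>4\<close>, which has unit length if \<open>s\<^sup>2 = det g\<close>.\<close>

definition hodge :: "complex^4^4 \<Rightarrow> complex \<Rightarrow> complex^4^4 \<Rightarrow> complex^4^4" where
  "hodge g s F =
     (\<chi> i j. (\<Sum>k\<in>UNIV. \<Sum>l\<in>UNIV. levi_civita i j k l * (g ** F ** g) $ k $ l) / (2 * s))"

section \<open>Conformal structures, orientations, self-duality\<close>

type_synonym 'm conf = "('m, 4) chart \<Rightarrow> complex^4 \<Rightarrow> complex^4^4"
type_synonym 'm star = "('m, 4) chart \<Rightarrow> complex^4 \<Rightarrow> complex^4^4 \<Rightarrow> complex^4^4"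

text \<open>The atlas is taken fine enough for the line bundle \<open>L\<close> to be trivial on each chart domain.
  Let \<open>l\<^sub>a\<close> be nowhere vanishing local sections of \<open>L\<close> with \<open>l\<^sub>a = h a b l\<^sub>b\<close>. The conformal structure
  is \<open>g a \<otimes> l\<^sub>a\<^sup>2\<close>, which glues iff \<open>g b = (h a b)\<^sup>2 g a\<close>. An isomorphism of \<open>L\<^sup>4\<close> with the dual of the
  canonical bundle amounts to local 4-forms \<open>v a dz\<^sup>1 \<and> dz\<^sup>2 \<and> dz\<^sup>3 \<and> dz\<^sup>4\<close>, the images of \<open>l\<^sub>a\<^sup>-\<^sup>4\<close>,
  which glue iff they are related by \<open>(h a b)\<^sup>4\<close>.\<close>

definition conformal_structure :: "('m, 4) chart set \<Rightarrow> 'm conf \<Rightarrow> bool" where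
  "conformal_structure A g \<longleftrightarrow>
     (\<forall>a\<in>A. holo_metric (g a) (cimg a)) \<and>
     (\<exists>(h :: ('m, 4) chart \<Rightarrow> ('m, 4) chart \<Rightarrow> 'm \<Rightarrow> complex)
       (v :: ('m, 4) chart \<Rightarrow> complex^4 \<Rightarrow> complex).
        (\<forall>a\<in>A. \<forall>b\<in>A. holo_fun (h a b \<circ> cinv a) (coord a ` (cdom a \<inter> cdom b))) \<and>
        (\<forall>a\<in>A. \<forall>b\<in>A. \<forall>x\<in>cdom a \<inter> cdom b. h a b x \<noteq> 0) \<and>
        (\<forall>a\<in>A. \<forall>b\<in>A. \<forall>c\<in>A. \<forall>x\<in>cdom a \<inter> cdom b \<inter> cdom c. h a b x * h b c x = h a c x) \<and>
        (\<forall>a\<in>A. holo_fun (v a) (cimg a) \<and> (\<forall>z\<in>cimg a. v a z \<noteq> 0)) \<and>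
        (\<forall>a\<in>A. \<forall>b\<in>A. \<forall>x\<in>cdom a \<inter> cdom b.
           let J = jac (coord b \<circ> cinv a) (coord a x) in
             transpose J ** g b (coord b x) ** J = (\<chi> i j. (h a b x)\<^sup>2 * g a (coord a x) $ i $ j) \<and>
             v b (coord b x) * det J = h a b x ^ 4 * v a (coord a x)))"

definition orientation :: "('m, 4) chart set \<Rightarrow> 'm conf \<Rightarrow> 'm star \<Rightarrow> bool" where
  "orientation A g st \<longleftrightarrow>
     (\<forall>a\<in>A. \<exists>s. holo_fun s (cimg a) \<and>
        (\<forall>z\<in>cimg a. (s z)\<^sup>2 = det (g a z) \<and>
           (\<forall>F. bivector F \<longrightarrow> st a z F = hodge (g a z) (s z) F))) \<and>
     (\<forall>a\<in>A. \<forall>b\<in>A. \<forall>x\<in>cdom a \<inter> cdom b.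
        let J = jac (coord b \<circ> cinv a) (coord a x) in
          \<forall>F. bivector F \<longrightarrow>
            st b (coord b x) (J ** F ** transpose J) = J ** st a (coord a x) F ** transpose J)"

text \<open>\<open>W\<^sup>-\<close> is \<open>W\<close> composed with the projection \<open>(1 - *)/2\<close> onto the \<open>-1\<close>-eigenspace of \<open>*\<close>.\<close>

definition weyl_minus :: "'m conf \<Rightarrow> 'm star \<Rightarrow> ('m, 4) chart \<Rightarrow> complex^4 \<Rightarrow> complex^4^4 \<Rightarrow> complex^4^4" where
  "weyl_minus g st a z F = weyl_op (g a) z (\<chi> i j. (F $ i $ j - st a z F $ i $ j) / 2)"

definition self_dual :: "('m, 4) chart set \<Rightarrow> 'm conf \<Rightarrow> 'm star \<Rightarrow> bool" where
  "self_dual A g st \<longleftrightarrow> (\<forall>a\<in>A. \<forall>z\<in>cimg a. \<forall>F. bivector F \<longrightarrow> weyl_minus g st a z F = 0)"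

definition local_metric ::
  "('m, 4) chart set \<Rightarrow> 'm conf \<Rightarrow> ('m, 4) chart \<Rightarrow> (complex^4) set \<Rightarrow> (complex^4 \<Rightarrow> complex^4^4) \<Rightarrow> bool"
where
  "local_metric A g a W G \<longleftrightarrow>
     a \<in> A \<and> open W \<and> W \<subseteq> cimg a \<and>
     (\<exists>u. holo_fun u W \<and> (\<forall>z\<in>W. u z \<noteq> 0 \<and> G z = (\<chi> i j. u z * g a z $ i $ j)))"

section \<open>Projective structures on surfaces\<close>

text \<open>A local connection consists of a chart, an open set in its image, and Christoffel symbols
  (indexed as above) on that set.\<close>

type_synonym 'b lconn = "('b, 2) chart \<times> (complex^2) set \<times> (complex^2 \<Rightarrow> complex^2^2^2)"

definition local_connection :: "('b, 2) chart set \<Rightarrow> 'b lconn \<Rightarrow> bool" where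
  "local_connection B \<kappa> \<longleftrightarrow> (case \<kappa> of (b, D, \<Gamma>) \<Rightarrow>
     b \<in> B \<and> open D \<and> D \<subseteq> cimg b \<and>
     (\<forall>k i j. holo_fun (\<lambda>z. \<Gamma> z $ k $ i $ j) D) \<and>
     (\<forall>z\<in>D. \<forall>k i j. \<Gamma> z $ k $ i $ j = \<Gamma> z $ k $ j $ i))"

definition lconn_dom :: "'b lconn \<Rightarrow> 'b set" where
  "lconn_dom \<kappa> = (case \<kappa> of (b, D, \<Gamma>) \<Rightarrow> {p \<in> cdom b. coord b p \<in> D})"

definition cderiv :: "(complex \<Rightarrow> complex^'n) \<Rightarrow> complex \<Rightarrow> complex^'n" where
  "cderiv \<gamma> t = (\<chi> i. deriv (\<lambda>s. \<gamma> s $ i) t)"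

text \<open>The acceleration is proportional to the velocity.\<close>

definition geodesic_at :: "'b lconn \<Rightarrow> (complex \<Rightarrow> 'b) \<Rightarrow> complex \<Rightarrow> bool" where
  "geodesic_at \<kappa> \<gamma> t \<longleftrightarrow> (case \<kappa> of (b, D, \<Gamma>) \<Rightarrow>
     let c = coord b \<circ> \<gamma>; c' = cderiv c t; c'' = cderiv (cderiv c) t in
       \<exists>q::complex. \<forall>k. c'' $ k + (\<Sum>i\<in>UNIV. \<Sum>j\<in>UNIV. \<Gamma> (c t) $ k $ i $ j * c' $ i * c' $ j) = q * c' $ k)"

definition immersed_curve ::
  "'b topology \<Rightarrow> ('b, 2) chart set \<Rightarrow> complex set \<Rightarrow> (complex \<Rightarrow> 'b) \<Rightarrow> bool" where
  "immersed_curve S B T \<gamma> \<longleftrightarrow>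
     open T \<and> connected T \<and> continuous_map (top_of_set T) S \<gamma> \<and>
     (\<forall>b\<in>B.
        (\<forall>i. (\<lambda>s. coord b (\<gamma> s) $ i) holomorphic_on (T \<inter> \<gamma> -` cdom b)) \<and>
        (\<forall>t\<in>T \<inter> \<gamma> -` cdom b. cderiv (coord b \<circ> \<gamma>) t \<noteq> 0))"

definition proj_equivalent :: "'b topology \<Rightarrow> ('b, 2) chart set \<Rightarrow> 'b lconn \<Rightarrow> 'b lconn \<Rightarrow> bool" where
  "proj_equivalent S B \<kappa> \<kappa>' \<longleftrightarrow>
     (\<forall>T \<gamma>. immersed_curve S B T \<gamma> \<and> \<gamma> ` T \<subseteq> lconn_dom \<kappa> \<inter> lconn_dom \<kappa>' \<longrightarrow>
        ((\<forall>t\<in>T. geodesic_at \<kappa> \<gamma> t) \<longleftrightarrow> (\<forall>t\<in>T. geodesic_at \<kappa>' \<gamma> t)))"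

text \<open>A projective structure is represented by a set \<open>\<P>\<close> of local connections.\<close>

definition proj_geodesic :: "'b lconn set \<Rightarrow> complex set \<Rightarrow> (complex \<Rightarrow> 'b) \<Rightarrow> bool" where
  "proj_geodesic \<P> T \<gamma> \<longleftrightarrow> 
     (\<forall>t\<in>T. \<exists>\<kappa>\<in>\<P>. \<exists>T'. open T' \<and> t \<in> T' \<and> T' \<subseteq> T \<and> \<gamma> ` T' \<subseteq> lconn_dom \<kappa> \<and>
        (\<forall>t'\<in>T'. geodesic_at \<kappa> \<gamma> t'))"

section \<open>The complex projective plane\<close>

text \<open>Points are the one-dimensional subspaces of \<open>\<complex>\<^sup>3\<close>; the topology is the quotient topology
  from \<open>\<complex>\<^sup>3 - {0}\<close>.\<close>

definition CP2 :: "(complex^3) set set" where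
  "CP2 = {l. vec.subspace l \<and> vec.dim l = 1}"

definition CP2_top :: "(complex^3) set topology" where
  "CP2_top = topology (\<lambda>Q. Q \<subseteq> CP2 \<and> open {v. v \<noteq> 0 \<and> vec.span {v} \<in> Q})"

lemma istopology_CP2: "istopology (\<lambda>Q. Q \<subseteq> CP2 \<and> open {v::complex^3. v \<noteq> 0 \<and> vec.span {v} \<in> Q})"
  (is "istopology ?P")
  unfolding istopology_def
proof (intro conjI allI impI)
  fix P Q assume "?P P" "?P Q"
  moreover have "{v::complex^3. v \<noteq> 0 \<and> vec.span {v} \<in> P \<inter> Q} =
      {v. v \<noteq> 0 \<and> vec.span {v} \<in> P} \<inter> {v. v \<noteq> 0 \<and> vec.span {v} \<in> Q}"
    by blast
  ultimately show "P \<inter> Q \<subseteq> CP2" "open {v::complex^3. v \<noteq> 0 \<and> vec.span {v} \<in> P \<inter> Q}"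
    by auto
next
  fix K assume K: "\<forall>Q\<in>K. ?P Q"
  have "{v::complex^3. v \<noteq> 0 \<and> vec.span {v} \<in> \<Union>K} = (\<Union>Q\<in>K. {v. v \<noteq> 0 \<and> vec.span {v} \<in> Q})"
    by blast
  with K show "\<Union>K \<subseteq> CP2" "open {v::complex^3. v \<noteq> 0 \<and> vec.span {v} \<in> \<Union>K}"
    by auto
qed

text \<open>The affine charts: scale \<open>v \<in> l\<close> so that \<open>v $ i = 1\<close>, and take the other two entries
  (index arithmetic modulo 3).\<close>

definition CP2_chart :: "3 \<Rightarrow> ((complex^3) set, 2) chart" where
  "CP2_chart i =
     ({l \<in> CP2. \<exists>v\<in>l. v $ i \<noteq> 0},
      \<lambda>l. let v = (THE v. v \<in> l \<and> v $ i = 1) in vector [v $ (i + 1), v $ (i + 2)])"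

definition CP2_atlas :: "((complex^3) set, 2) chart set" where
  "CP2_atlas = range CP2_chart"

definition in_proj_line :: "(complex^3) set set \<Rightarrow> bool" where
  "in_proj_line Q \<longleftrightarrow> (\<exists>K. vec.subspace K \<and> vec.dim K = 2 \<and> (\<forall>l\<in>Q. l \<subseteq> K))"

definition flat_proj_structure ::
  "'b topology \<Rightarrow> ('b, 2) chart set \<Rightarrow> 'b lconn set \<Rightarrow> bool" where
  "flat_proj_structure S B \<P> \<longleftrightarrow>
     (\<forall>p\<in>topspace S. \<exists>N M \<Phi>. p \<in> N \<and> biholo_between S B N CP2_top CP2_atlas M \<Phi> \<and>
        (\<forall>T \<gamma>. immersed_curve S B T \<gamma> \<and> \<gamma> ` T \<subseteq> N \<longrightarrow>
           (proj_geodesic \<P> T \<gamma> \<longleftrightarrow> in_proj_line (\<Phi> ` \<gamma> ` T))))"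

section \<open>Beta-surfaces\<close>

definition beta_plane :: "complex^4^4 \<Rightarrow> (complex^4^4 \<Rightarrow> complex^4^4) \<Rightarrow> (complex^4) set \<Rightarrow> bool" where
  "beta_plane g st P \<longleftrightarrow>
     vec.subspace P \<and> vec.dim P = 2 \<and>
     (\<forall>u\<in>P. \<forall>v\<in>P. (\<Sum>i\<in>UNIV. \<Sum>j\<in>UNIV. g $ i $ j * u $ i * v $ j) = 0) \<and>
     (\<forall>u\<in>P. \<forall>v\<in>P. st (wedge u v) = - wedge u v)"

text \<open>The local expression of a map \<open>f\<close> in charts \<open>b\<close>, \<open>a\<close>, and its (open) domain.\<close>

definition lrep :: "('b, 'n::finite) chart \<Rightarrow> ('m, 'k::finite) chart \<Rightarrow> ('b \<Rightarrow> 'm) \<Rightarrow> complex^'n \<Rightarrow> complex^'k" where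
  "lrep b a f = coord a \<circ> f \<circ> cinv b"

definition lrep_dom :: "('b, 'n::finite) chart \<Rightarrow> ('m, 'k::finite) chart \<Rightarrow> ('b \<Rightarrow> 'm) \<Rightarrow> (complex^'n) set" where
  "lrep_dom b a f = coord b ` (cdom b \<inter> f -` cdom a)"

text \<open>\<open>\<nabla>\<^sub>i \<partial>\<^sub>j F\<close>, the covariant derivative of the coordinate vector fields along \<open>F\<close> with respect
  to the Levi-Civita connection of \<open>G\<close>.\<close>

definition cov_coord ::
  "(complex^4 \<Rightarrow> complex^4^4) \<Rightarrow> (complex^2 \<Rightarrow> complex^4) \<Rightarrow> complex^2 \<Rightarrow> 2 \<Rightarrow> 2 \<Rightarrow> complex^4" where
  "cov_coord G F z i j = (\<chi> k. cpartial i (cpartial j (\<lambda>w. F w $ k)) z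
     + (\<Sum>l\<in>UNIV. \<Sum>m\<in>UNIV. christoffel G (F z) $ k $ l $ m * jac F z $ l $ i * jac F z $ m $ j))"

definition totally_geodesic ::
  "('m, 4) chart set \<Rightarrow> 'm conf \<Rightarrow> ('b, 2) chart set \<Rightarrow> ('b \<Rightarrow> 'm) \<Rightarrow> bool" where
  "totally_geodesic A g B f \<longleftrightarrow>
     (\<forall>a W G. local_metric A g a W G \<longrightarrow>
        (\<forall>b\<in>B. \<forall>z\<in>lrep_dom b a f \<inter> lrep b a f -` W. \<forall>i j.
           cov_coord G (lrep b a f) z i j \<in> range ((*v) (jac (lrep b a f) z))))"

text \<open>Surfaces in \<open>M\<close> are immersed: leaves need be neither embedded nor free of self-intersections,
  so the surface is a manifold \<open>S\<close> with a holomorphic immersion \<open>f\<close>.\<close>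

definition totally_geodesic_beta ::
  "'m topology \<Rightarrow> ('m, 4) chart set \<Rightarrow> 'm conf \<Rightarrow> 'm star \<Rightarrow>
   'b topology \<Rightarrow> ('b, 2) chart set \<Rightarrow> ('b \<Rightarrow> 'm) \<Rightarrow> bool"
where
  "totally_geodesic_beta X A g st S B f \<longleftrightarrow>
     complex_manifold S B \<and> connected_space S \<and> topspace S \<noteq> {} \<and>
     holo_between S B (topspace S) X A f \<and>
     (\<forall>b\<in>B. \<forall>a\<in>A. \<forall>z\<in>lrep_dom b a f.
        inj ((*v) (jac (lrep b a f) z)) \<and>
        beta_plane (g a (lrep b a f z)) (st a (lrep b a f z)) (range ((*v) (jac (lrep b a f) z)))) \<and>
     totally_geodesic A g B f"

text \<open>Maximality: not a proper open part of another such surface. Every such surface has the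
  cardinality of the continuum, so it suffices to test against surfaces whose points are reals.\<close>

definition beta_surface ::
  "'m topology \<Rightarrow> ('m, 4) chart set \<Rightarrow> 'm conf \<Rightarrow> 'm star \<Rightarrow>
   'b topology \<Rightarrow> ('b, 2) chart set \<Rightarrow> ('b \<Rightarrow> 'm) \<Rightarrow> bool"
where
  "beta_surface X A g st S B f \<longleftrightarrow>
     totally_geodesic_beta X A g st S B f \<and>
     (\<forall>(S' :: real topology) B' f' e.
        totally_geodesic_beta X A g st S' B' f' \<and>
        biholo_between S B (topspace S) S' B' (e ` topspace S) e \<and>
        (\<forall>p\<in>topspace S. f' (e p) = f p) \<longrightarrow> e ` topspace S = topspace S')"

text \<open>\<open>\<nabla>\<^sub>i \<partial>\<^sub>j F = \<Sum>\<^sub>k \<Gamma>\<^sup>k\<^sub>i\<^sub>j \<partial>\<^sub>k F\<close> for the Levi-Civita connection of some local metric of the conformal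
  structure.\<close>

definition induced_connection ::
  "('m, 4) chart set \<Rightarrow> 'm conf \<Rightarrow> ('b, 2) chart set \<Rightarrow> ('b \<Rightarrow> 'm) \<Rightarrow> 'b lconn \<Rightarrow> bool" where
  "induced_connection A g B f \<kappa> \<longleftrightarrow> local_connection B \<kappa> \<and> (case \<kappa> of (b, D, \<Gamma>) \<Rightarrow>
     \<exists>a W G. local_metric A g a W G \<and> D \<subseteq> lrep_dom b a f \<inter> lrep b a f -` W \<and>
       (\<forall>z\<in>D. \<forall>i j. cov_coord G (lrep b a f) z i j =
          (\<Sum>k\<in>UNIV. \<Gamma> z $ k $ i $ j *s column k (jac (lrep b a f) z))))"

definition beta_proj_structure ::
  "('m, 4) chart set \<Rightarrow> 'm conf \<Rightarrow> 'b topology \<Rightarrow> ('b, 2) chart set \<Rightarrow> ('b \<Rightarrow> 'm) \<Rightarrow> 'b lconn set" where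
  "beta_proj_structure A g S B f =
     {\<kappa>. local_connection B \<kappa> \<and> (\<forall>\<kappa>'. induced_connection A g B f \<kappa>' \<longrightarrow> proj_equivalent S B \<kappa> \<kappa>')}"

end

theory Submission
  imports Defs "HOL-Complex_Analysis.Cauchy_Integral_Formula"
begin

text \<open>Let \<open>X\<^sub>1, X\<^sub>2\<close> be the coordinate fields of a beta-surface, \<open>W\<close> and \<open>P\<close> the Weyl and Schouten
  tensors of a local metric, and \<open>p\<close> the restriction of \<open>P\<close> to the surface. Self-duality means that
  \<open>W\<close> vanishes on anti-self-dual bivectors, in particular on \<open>X\<^sub>1 \<and> X\<^sub>2\<close>, so the Gauss equation gives
  \<open>R(X\<^sub>1,X\<^sub>2)X\<^sub>k = p\<^sub>2\<^sub>k X\<^sub>1 - p\<^sub>1\<^sub>k X\<^sub>2\<close> for the induced connection. In the second Bianchi identity for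
  \<open>X\<^sub>1, X\<^sub>2\<close> and an arbitrary \<open>U\<close>, contracted with \<open>X\<^sub>1, X\<^sub>2\<close>, the derivatives of \<open>W\<close> drop out: the
  tangential ones because the surface is totally geodesic, the transverse one because the
  anti-self-dual part of \<open>W\<close> vanishes off the surface as well. What is left is the vanishing of the
  projective Cotton tensor \<open>\<nabla>\<^sub>1p\<^sub>2\<^sub>k - \<nabla>\<^sub>2p\<^sub>1\<^sub>k\<close>. Therefore the linear system
  \<open>\<nabla>\<^sub>i\<partial>\<^sub>j\<sigma> + p\<^sub>i\<^sub>j\<sigma> = 0\<close> is integrable. Three independent local solutions are the homogeneous
  coordinates of a map to the projective plane. Along a geodesic they satisfy one and the same second
  order equation, so geodesics are mapped into lines. Conformal invariance of null geodesics shows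
  that all induced connections are projectively equivalent.\<close>

section \<open>Holomorphic functions of several variables\<close>

text \<open>\<open>holo_fun\<close> supplies no more than a complex linear derivative at each point,
  whereas the argument differentiates the metric three times and solves an overdetermined linear
  system. Cauchy integrals together with Osgood's theorem provide the higher derivatives, and a
  Picard iteration along rays takes the place of the Frobenius theorem. In two dimensions there is
  no projective Weyl tensor, so the Cotton tensor is the only obstruction to flatness. The Gauss
  equation identifies p as the projective Schouten tensor of the induced connection; its symmetry
  allows the equation for \<sigma> to be posed for functions instead of densities. The zero set of a
  solution plays the role of the zero set of a linear form on \<complex>^3, that is, of a projective
  line. The obstacle in the transverse derivative of W is that X1 \<and> X2 is anti-self-dual only
  at the point of the surface. A fixed bivector is therefore replaced, at each nearby point, by its
  anti-self-dual projection there.\<close>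

definition cdiff_at :: "(complex^'n::finite \<Rightarrow> complex) \<Rightarrow> complex^'n \<Rightarrow> bool" where
  "cdiff_at f z \<longleftrightarrow> (\<exists>a::complex^'n. (f has_derivative (\<lambda>v. \<Sum>i\<in>UNIV. a $ i * v $ i)) (at z))"

lemma holo_fun_iff: "holo_fun f S \<longleftrightarrow> (\<forall>z\<in>S. cdiff_at f z)"
  by (simp add: holo_fun_def cdiff_at_def)

lemma holo_funD: "holo_fun f S \<Longrightarrow> z \<in> S \<Longrightarrow> cdiff_at f z"
  by (simp add: holo_fun_iff)

lemma norm_smult_axis [simp]: "norm (t *s axis i (1::complex)) = norm t"
proof -
  have "t *s axis i (1::complex) = axis i t"
    by (simp add: axis_def vec_eq_iff)
  moreover have "norm (axis i t) = norm t"
    by (simp add: norm_vec_def L2_set_def axis_def if_distrib[of norm] if_distrib[of "\<lambda>x. x\<^sup>2"] cong: if_cong)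
  ultimately show ?thesis by simp
qed

lemma bounded_linear_smult_vec: "bounded_linear (\<lambda>t::complex. t *s (v::complex^'n::finite))"
  by (rule linear_conv_bounded_linear[THEN iffD1], rule linearI)
     (auto simp: vec_eq_iff algebra_simps)

lemma has_derivative_vec_curve:
  fixes c :: "complex \<Rightarrow> complex^'n::finite"
  assumes "\<And>i. ((\<lambda>s. c s $ i) has_field_derivative c' $ i) (at t)"
  shows "(c has_derivative (\<lambda>h. h *s c')) (at t)"
proof -
  have "((\<lambda>s. \<Sum>i\<in>UNIV. (c s $ i) *s axis i 1) has_derivative
        (\<lambda>h. \<Sum>i\<in>UNIV. (c' $ i * h) *s axis i (1::complex))) (at t)"
    by (intro has_derivative_sum
        bounded_linear.has_derivative[OF bounded_linear_smult_vec]
        assms[unfolded has_field_derivative_def])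
  moreover have "(\<lambda>h. \<Sum>i\<in>UNIV. (c' $ i * h) *s axis i (1::complex)) = (\<lambda>h. h *s c')"
    using basis_expansion[of "h *s c'" for h] by (auto simp: fun_eq_iff mult.commute)
  ultimately show ?thesis by (simp add: basis_expansion)
qed

lemma has_derivative_curve:
  fixes a :: "'n::finite \<Rightarrow> complex"
  assumes "(f has_derivative (\<lambda>v. \<Sum>i\<in>UNIV. a i * v $ i)) (at (c t))"
    and "\<And>i. ((\<lambda>s. c s $ i) has_field_derivative c' $ i) (at t)"
  shows "((\<lambda>s. f (c s)) has_field_derivative (\<Sum>i\<in>UNIV. a i * c' $ i)) (at t)"
proof -
  have "((f \<circ> c) has_derivative (\<lambda>v. \<Sum>i\<in>UNIV. a i * v $ i) \<circ> (\<lambda>h. h *s c')) (at t)"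
    by (rule diff_chain_at[OF has_derivative_vec_curve[OF assms(2)] assms(1)])
  moreover have "(\<lambda>v. \<Sum>i\<in>UNIV. a i * v $ i) \<circ> (\<lambda>h. h *s c') = (*) (\<Sum>i\<in>UNIV. a i * c' $ i)"
    by (auto simp: fun_eq_iff sum_distrib_left sum_distrib_right mult_ac)
  ultimately show ?thesis by (simp add: has_field_derivative_def o_def)
qed

lemma line_has_field_derivative:
  "((\<lambda>s. (z + s *s v) $ i) has_field_derivative v $ i) (at (t::complex))"
  by (auto intro!: derivative_eq_intros)

text \<open>Restriction to a coordinate line determines the coefficients of a complex linear
  derivative, so the existential quantifier in \<open>cdiff_at\<close> always has the partial
  derivatives as its witness.\<close>

lemma cpartial_eqI:
  fixes a :: "'n::finite \<Rightarrow> complex"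
  assumes "(f has_derivative (\<lambda>v. \<Sum>i\<in>UNIV. a i * v $ i)) (at z)"
  shows "cpartial i f z = a i"
proof -
  have "((\<lambda>s. f (z + s *s axis i 1)) has_field_derivative (\<Sum>j\<in>UNIV. a j * axis i 1 $ j)) (at 0)"
    by (rule has_derivative_curve[where c="\<lambda>s. z + s *s axis i 1"])
       (use assms line_has_field_derivative[of z "axis i 1"] in auto)
  moreover have "(\<Sum>j\<in>UNIV. a j * axis i 1 $ j) = a i"
    by (simp add: axis_def if_distrib cong: if_cong)
  ultimately show ?thesis by (simp add: cpartial_def DERIV_imp_deriv)
qed

lemma cdiffI:
  fixes a :: "'n::finite \<Rightarrow> complex"
  assumes "(f has_derivative (\<lambda>v. \<Sum>i\<in>UNIV. a i * v $ i)) (at z)"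
  shows "cdiff_at f z"
  unfolding cdiff_at_def using assms by (intro exI[of _ "\<chi> i. a i"]) simp

lemma cdiff_has_derivative:
  "cdiff_at f z \<Longrightarrow> (f has_derivative (\<lambda>v. \<Sum>i\<in>UNIV. cpartial i f z * v $ i)) (at z)"
  unfolding cdiff_at_def by (auto simp: cpartial_eqI)

lemma cdiff_curve:
  assumes "cdiff_at f (c t)"
    and "\<And>i. ((\<lambda>s. c s $ i) has_field_derivative c' $ i) (at t)"
  shows "((\<lambda>s. f (c s)) has_field_derivative (\<Sum>i\<in>UNIV. cpartial i f (c t) * c' $ i)) (at t)"
  by (rule has_derivative_curve[OF cdiff_has_derivative[OF assms(1)] assms(2)])

lemma cdiff_slice:
  assumes "cdiff_at f (z + t *s axis i 1)"
  shows "((\<lambda>s. f (z + s *s axis i 1)) has_field_derivative cpartial i f (z + t *s axis i 1)) (at t)"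
proof -
  have "((\<lambda>s. f (z + s *s axis i 1)) has_field_derivative
      (\<Sum>j\<in>UNIV. cpartial j f (z + t *s axis i 1) * axis i 1 $ j)) (at t)"
    by (rule cdiff_curve[where c="\<lambda>s. z + s *s axis i 1"])
       (use assms line_has_field_derivative[of z "axis i 1"] in auto)
  moreover have "(\<Sum>j\<in>UNIV. b j * axis i (1::complex) $ j) = b i" for b
    by (simp add: axis_def if_distrib cong: if_cong)
  ultimately show ?thesis by simp
qed

lemma cdiff_isCont: "cdiff_at f z \<Longrightarrow> isCont f z"
  using cdiff_has_derivative has_derivative_continuous by blast

lemma holo_fun_continuous_on: "holo_fun f S \<Longrightarrow> continuous_on S f"
  by (simp add: holo_fun_iff cdiff_isCont continuous_at_imp_continuous_on)

lemma cdiff_const [simp]: "cdiff_at (\<lambda>z. c) z"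
  and cpartial_const [simp]: "cpartial i (\<lambda>z. c) z = 0"
proof -
  have "((\<lambda>z. c) has_derivative (\<lambda>v. \<Sum>i\<in>UNIV. 0 * v $ i)) (at z)" by simp
  from cdiffI[OF this] cpartial_eqI[OF this] show "cdiff_at (\<lambda>z. c) z" "cpartial i (\<lambda>z. c) z = 0" by auto
qed

lemma cdiff_nth [simp]: "cdiff_at (\<lambda>z. z $ k) z"
  and cpartial_nth: "cpartial i (\<lambda>z. z $ k) z = (if i = k then 1 else 0)"
proof -
  have "(\<lambda>v::complex^'a. \<Sum>i\<in>UNIV. (if i = k then 1 else 0) * v $ i) = (\<lambda>v. v $ k)"
    by (simp add: fun_eq_iff if_distrib[of "\<lambda>x. x * _"] cong: if_cong)
  then have "((\<lambda>z. z $ k) has_derivative (\<lambda>v. \<Sum>i\<in>UNIV. (if i = k then 1 else 0) * v $ i)) (at z)"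
    by (auto intro: bounded_linear_imp_has_derivative bounded_linear_vec_nth)
  from cdiffI[OF this] cpartial_eqI[OF this]
  show "cdiff_at (\<lambda>z. z $ k) z" "cpartial i (\<lambda>z. z $ k) z = (if i = k then 1 else 0)" by auto
qed

lemma
  assumes "cdiff_at f z" "cdiff_at g z"
  shows cdiff_add [intro]: "cdiff_at (\<lambda>w. f w + g w) z"
    and cpartial_add: "cpartial i (\<lambda>w. f w + g w) z = cpartial i f z + cpartial i g z"
proof -
  have "((\<lambda>w. f w + g w) has_derivative (\<lambda>v. \<Sum>i\<in>UNIV. (cpartial i f z + cpartial i g z) * v $ i)) (at z)"
    using has_derivative_add[OF cdiff_has_derivative[OF assms(1)] cdiff_has_derivative[OF assms(2)]]
    by (simp add: algebra_simps sum.distrib)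
  from cdiffI[OF this] cpartial_eqI[OF this]
  show "cdiff_at (\<lambda>w. f w + g w) z" "cpartial i (\<lambda>w. f w + g w) z = cpartial i f z + cpartial i g z" by auto
qed

lemma
  assumes "cdiff_at f z" "cdiff_at g z"
  shows cdiff_mult [intro]: "cdiff_at (\<lambda>w. f w * g w) z"
    and cpartial_mult: "cpartial i (\<lambda>w. f w * g w) z = f z * cpartial i g z + cpartial i f z * g z"
proof -
  have "((\<lambda>w. f w * g w) has_derivative (\<lambda>v. \<Sum>i\<in>UNIV. (f z * cpartial i g z + cpartial i f z * g z) * v $ i)) (at z)"
    using has_derivative_mult[OF cdiff_has_derivative[OF assms(1)] cdiff_has_derivative[OF assms(2)]]
    by (simp add: algebra_simps sum.distrib sum_distrib_left)
  from cdiffI[OF this] cpartial_eqI[OF this]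
  show "cdiff_at (\<lambda>w. f w * g w) z"
    "cpartial i (\<lambda>w. f w * g w) z = f z * cpartial i g z + cpartial i f z * g z" by auto
qed

lemma
  assumes "cdiff_at f z" "(h has_field_derivative d) (at (f z))"
  shows cdiff_outer: "cdiff_at (\<lambda>w. h (f w)) z"
    and cpartial_outer: "cpartial i (\<lambda>w. h (f w)) z = d * cpartial i f z"
proof -
  have "((\<lambda>w. h (f w)) has_derivative (\<lambda>v. \<Sum>i\<in>UNIV. (d * cpartial i f z) * v $ i)) (at z)"
    using diff_chain_at[OF cdiff_has_derivative[OF assms(1)] assms(2)[unfolded has_field_derivative_def]]
    by (simp add: o_def algebra_simps sum_distrib_left)
  from cdiffI[OF this] cpartial_eqI[OF this]
  show "cdiff_at (\<lambda>w. h (f w)) z" "cpartial i (\<lambda>w. h (f w)) z = d * cpartial i f z" by auto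
qed

lemma
  assumes "cdiff_at f z"
  shows cdiff_minus [intro]: "cdiff_at (\<lambda>w. - f w) z" and cpartial_minus: "cpartial i (\<lambda>w. - f w) z = - cpartial i f z"
proof -
  have "(uminus has_field_derivative - 1) (at (f z))" by (auto intro!: derivative_eq_intros)
  from cdiff_outer[OF assms this] cpartial_outer[OF assms this]
  show "cdiff_at (\<lambda>w. - f w) z" "cpartial i (\<lambda>w. - f w) z = - cpartial i f z" by simp_all
qed

lemma
  assumes "cdiff_at f z" "cdiff_at g z"
  shows cdiff_diff [intro]: "cdiff_at (\<lambda>w. f w - g w) z"
    and cpartial_diff: "cpartial i (\<lambda>w. f w - g w) z = cpartial i f z - cpartial i g z"
  using cdiff_add[OF assms(1) cdiff_minus[OF assms(2)]]
    cpartial_add[OF assms(1) cdiff_minus[OF assms(2)]] by (simp_all add: cpartial_minus assms)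

lemma cdiff_sum_both:
  assumes "\<And>k. k \<in> I \<Longrightarrow> cdiff_at (f k) z"
  shows "cdiff_at (\<lambda>w. \<Sum>k\<in>I. f k w) z \<and> cpartial i (\<lambda>w. \<Sum>k\<in>I. f k w) z = (\<Sum>k\<in>I. cpartial i (f k) z)"
  using assms by (induction I rule: infinite_finite_induct) (auto simp: cpartial_add)

lemma cdiff_sum [intro]: "(\<And>k. k \<in> I \<Longrightarrow> cdiff_at (f k) z) \<Longrightarrow> cdiff_at (\<lambda>w. \<Sum>k\<in>I. f k w) z"
  and cpartial_sum: "(\<And>k. k \<in> I \<Longrightarrow> cdiff_at (f k) z) \<Longrightarrow>
        cpartial i (\<lambda>w. \<Sum>k\<in>I. f k w) z = (\<Sum>k\<in>I. cpartial i (f k) z)"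
  using cdiff_sum_both by blast+

lemma cdiff_prod [intro]: "(\<And>k. k \<in> I \<Longrightarrow> cdiff_at (f k) z) \<Longrightarrow> cdiff_at (\<lambda>w. \<Prod>k\<in>I. f k w) z"
  by (induction I rule: infinite_finite_induct) auto

lemma cdiff_power [intro]: "cdiff_at f z \<Longrightarrow> cdiff_at (\<lambda>w. f w ^ n) z"
  by (induction n) auto

lemma cdiff_divide [intro]:
  assumes "cdiff_at f z" "cdiff_at g z" "g z \<noteq> 0"
  shows "cdiff_at (\<lambda>w. f w / g w) z"
proof -
  have "cdiff_at (\<lambda>w. inverse (g w)) z"
    by (rule cdiff_outer[OF assms(2)]) (rule DERIV_inverse[OF assms(3)])
  from cdiff_mult[OF assms(1) this] show ?thesis by (simp add: field_class.field_divide_inverse)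
qed

lemma cpartial_divide:
  assumes "cdiff_at f z" "cdiff_at g z" "g z \<noteq> 0"
  shows "cpartial i (\<lambda>w. f w / g w) z = (cpartial i f z * g z - f z * cpartial i g z) / (g z)\<^sup>2"
proof -
  have D: "(inverse has_field_derivative - (inverse (g z) ^ Suc (Suc 0))) (at (g z))"
    by (rule DERIV_inverse[OF assms(3)])
  show ?thesis
    using cpartial_mult[OF assms(1) cdiff_outer[OF assms(2) D], of i] cpartial_outer[OF assms(2) D, of i]
      assms(3)
    by (simp add: field_class.field_divide_inverse[symmetric])
       (simp add: field_simps power2_eq_square)
qed

lemma
  fixes F :: "complex^'k::finite \<Rightarrow> complex^'n::finite"
  assumes F: "\<And>i. cdiff_at (\<lambda>w. F w $ i) z" and f: "cdiff_at f (F z)"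
  shows cdiff_compose: "cdiff_at (\<lambda>w. f (F w)) z"
    and cpartial_compose: "cpartial j (\<lambda>w. f (F w)) z = (\<Sum>i\<in>UNIV. cpartial i f (F z) * cpartial j (\<lambda>w. F w $ i) z)"
proof -
  have "((\<lambda>w. \<Sum>i\<in>UNIV. (F w $ i) *s axis i 1) has_derivative
        (\<lambda>v. \<Sum>i\<in>UNIV. (\<Sum>j\<in>UNIV. cpartial j (\<lambda>w. F w $ i) z * v $ j) *s axis i (1::complex))) (at z)"
    by (intro has_derivative_sum bounded_linear.has_derivative[OF bounded_linear_smult_vec]
        cdiff_has_derivative[OF F])
  then have 1: "(F has_derivative (\<lambda>v. \<chi> i. \<Sum>j\<in>UNIV. cpartial j (\<lambda>w. F w $ i) z * v $ j)) (at z)"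
    using basis_expansion[of "\<chi> i. \<Sum>j\<in>UNIV. cpartial j (\<lambda>w. F w $ i) z * v $ j" for v]
    by (simp add: basis_expansion)
  have "((f \<circ> F) has_derivative (\<lambda>v. \<Sum>i\<in>UNIV. cpartial i f (F z) * v $ i) \<circ>
       (\<lambda>v. \<chi> i. \<Sum>j\<in>UNIV. cpartial j (\<lambda>w. F w $ i) z * v $ j)) (at z)"
    by (rule diff_chain_at[OF 1 cdiff_has_derivative[OF f]])
  moreover have "(\<lambda>v. \<Sum>i\<in>UNIV. cpartial i f (F z) * v $ i) \<circ>
       (\<lambda>v. \<chi> i. \<Sum>j\<in>UNIV. cpartial j (\<lambda>w. F w $ i) z * v $ j)
     = (\<lambda>v. \<Sum>j\<in>UNIV. (\<Sum>i\<in>UNIV. cpartial i f (F z) * cpartial j (\<lambda>w. F w $ i) z) * v $ j)"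
  proof
    fix v :: "complex^'k"
    have "(\<Sum>i\<in>UNIV. cpartial i f (F z) * (\<Sum>j\<in>UNIV. cpartial j (\<lambda>w. F w $ i) z * v $ j))
       = (\<Sum>i\<in>UNIV. \<Sum>j\<in>UNIV. cpartial i f (F z) * cpartial j (\<lambda>w. F w $ i) z * v $ j)"
      by (simp add: sum_distrib_left mult_ac)
    also have "\<dots> = (\<Sum>j\<in>UNIV. \<Sum>i\<in>UNIV. cpartial i f (F z) * cpartial j (\<lambda>w. F w $ i) z * v $ j)"
      by (rule sum.swap)
    finally show "((\<lambda>v. \<Sum>i\<in>UNIV. cpartial i f (F z) * v $ i) \<circ>
       (\<lambda>v. \<chi> i. \<Sum>j\<in>UNIV. cpartial j (\<lambda>w. F w $ i) z * v $ j)) v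
       = (\<Sum>j\<in>UNIV. (\<Sum>i\<in>UNIV. cpartial i f (F z) * cpartial j (\<lambda>w. F w $ i) z) * v $ j)"
      by (simp add: sum_distrib_right)
  qed
  ultimately have *: "((\<lambda>w. f (F w)) has_derivative
      (\<lambda>v. \<Sum>j\<in>UNIV. (\<Sum>i\<in>UNIV. cpartial i f (F z) * cpartial j (\<lambda>w. F w $ i) z) * v $ j)) (at z)"
    by (simp add: o_def)
  from cdiffI[OF *] cpartial_eqI[OF *] show "cdiff_at (\<lambda>w. f (F w)) z"
    "cpartial j (\<lambda>w. f (F w)) z = (\<Sum>i\<in>UNIV. cpartial i f (F z) * cpartial j (\<lambda>w. F w $ i) z)"
    by auto
qed

lemma isCont_line: "isCont (\<lambda>t::complex. z + t *s (v::complex^'n::finite)) t"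
  by (intro continuous_intros linear_continuous_at bounded_linear_smult_vec)

lemma cpartial_cong:
  assumes "open S" "z \<in> S" "\<And>w. w \<in> S \<Longrightarrow> f w = g w"
  shows "cpartial i f z = cpartial i g z"
proof -
  have "\<forall>\<^sub>F t in nhds (0::complex). z + t *s axis i 1 \<in> S"
  proof -
    have "open ((\<lambda>t::complex. z + t *s axis i 1) -` S)"
      by (intro open_vimage assms continuous_at_imp_continuous_on ballI isCont_line)
    from eventually_nhds_in_open[OF this, of 0] assms(2) show ?thesis by simp
  qed
  then show ?thesis
    unfolding cpartial_def by (intro deriv_cong_ev) (auto elim: eventually_mono simp: assms(3))
qed

lemma cdiff_cong:
  assumes "open S" "z \<in> S" "\<And>w. w \<in> S \<Longrightarrow> f w = g w" "cdiff_at f z"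
  shows "cdiff_at g z"
proof -
  from assms(4) obtain a where "(f has_derivative (\<lambda>v. \<Sum>i\<in>UNIV. a $ i * v $ i)) (at z)"
    unfolding cdiff_at_def ..
  from has_derivative_transform_within_open[OF this assms(1,2)] assms(3)
  show ?thesis unfolding cdiff_at_def by blast
qed

lemma holo_fun_cong:
  assumes "open S" "\<And>w. w \<in> S \<Longrightarrow> f w = g w" "holo_fun f S"
  shows "holo_fun g S"
  using assms(3) cdiff_cong[OF assms(1), of _ f g] assms(2) by (auto simp: holo_fun_iff)

lemmas cdiff_intros = cdiff_add cdiff_minus cdiff_diff cdiff_mult cdiff_sum cdiff_prod cdiff_power cdiff_const cdiff_nth

lemma cpartial_translate: "cpartial i (\<lambda>w. f (a + w)) z = cpartial i f (a + z)"
  by (simp add: cpartial_def add.assoc)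

lemma cdiff_translate: "cdiff_at f (a + z) \<Longrightarrow> cdiff_at (\<lambda>w. f (a + w)) z"
  by (rule cdiff_compose[where F="\<lambda>w. a + w"]) (auto intro: cdiff_add)

text \<open>Separate holomorphy: each variable on its own, without joint regularity. This is what
  differentiation under an integral sign or a locally uniform limit delivers directly;
  \<open>osgood\<close> upgrades it for continuous functions.\<close>

definition slices_diff :: "(complex^'n::finite \<Rightarrow> complex) \<Rightarrow> (complex^'n) set \<Rightarrow> bool" where
  "slices_diff f S \<longleftrightarrow> (\<forall>z\<in>S. \<forall>i. (\<lambda>t. f (z + t *s axis i 1)) field_differentiable at 0)"

text \<open>The definition speaks of the parameter value 0 only. Rebasing the slice at its point
  with parameter \<open>t\<close> gives all other values.\<close>

lemma slice_shift:
  assumes "slices_diff f S" "z + t *s axis i 1 \<in> S"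
  shows "((\<lambda>s. f (z + s *s axis i 1)) has_field_derivative cpartial i f (z + t *s axis i 1)) (at t)"
proof -
  have "((\<lambda>s. f ((z + t *s axis i 1) + s *s axis i 1)) has_field_derivative
      cpartial i f (z + t *s axis i 1)) (at 0)"
    using assms unfolding slices_diff_def cpartial_def DERIV_deriv_iff_field_differentiable by blast
  then have "((\<lambda>s. f (z + (s + t) *s axis i 1)) has_field_derivative
      cpartial i f (z + t *s axis i 1)) (at 0)"
    by (simp add: algebra_simps vector_sadd_rdistrib)
  then show ?thesis
    using DERIV_shift[of "\<lambda>s. f (z + s *s axis i 1)" _ 0 t] by (simp add: add.commute)
qed

lemma holo_fun_slices_diff: "holo_fun f S \<Longrightarrow> slices_diff f S"
  unfolding slices_diff_def field_differentiable_def
proof (intro ballI allI)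
  fix z i assume "holo_fun f S" "z \<in> S"
  then show "\<exists>f'. ((\<lambda>t. f (z + t *s axis i 1)) has_field_derivative f') (at 0)"
    using cdiff_slice[of f z 0 i] holo_funD by fastforce
qed

text \<open>Cauchy's formula for the first derivative on the circle u = r exp(2 \<pi> i \<theta>):
  since du = 2 \<pi> i u d\<theta>, the kernel du / (2 \<pi> i u^2) becomes d\<theta> / u. The
  contour integral is written over the unit interval so that the theorems on integrals with
  parameters apply.\<close>

lemma cauchy_partial:
  fixes f :: "complex^'n::finite \<Rightarrow> complex"
  assumes sl: "slices_diff f S" and r: "r > 0"
    and sub: "\<And>t. norm t \<le> r \<Longrightarrow> z + t *s axis i 1 \<in> S"
  shows "cpartial i f z =
    integral {0..1} (\<lambda>\<theta>. f (z + (of_real r * exp (2 * of_real pi * \<i> * of_real \<theta>)) *s axis i 1) *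
        (exp (- (2 * of_real pi * \<i> * of_real \<theta>)) / of_real r))"
proof -
  define h where "h = (\<lambda>t. f (z + t *s axis i 1))"
  have d: "(h has_field_derivative cpartial i f (z + t *s axis i 1)) (at t)" if "norm t \<le> r" for t
    unfolding h_def by (rule slice_shift[OF sl sub[OF that]])
  have hc: "continuous_on (cball 0 r) h"
    by (intro continuous_at_imp_continuous_on ballI DERIV_isCont[OF d]) simp
  have hh: "h holomorphic_on ball 0 r"
    unfolding holomorphic_on_open[OF open_ball] by (intro ballI exI, rule d) simp
  have "(h has_field_derivative (1 / (2 * of_real pi * \<i>) *
      contour_integral (circlepath 0 r) (\<lambda>u. h u / (u - 0)^2))) (at 0)"
    by (rule Cauchy_derivative_integral_circlepath(2)[OF hc hh]) (use r in auto)
  then have "cpartial i f z = 1 / (2 * of_real pi * \<i>) *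
      contour_integral (circlepath 0 r) (\<lambda>u. h u / (u - 0)^2)"
    using d[of 0] r DERIV_unique by fastforce
  also have "\<dots> = 1 / (2 * of_real pi * \<i>) *
      integral {0..1} (\<lambda>x. h (circlepath 0 r x) / (circlepath 0 r x)^2 *
         (2 * pi * \<i> * r * exp (2 * of_real pi * \<i> * x)))"
    by (simp add: contour_integral_integral vector_derivative_circlepath)
  also have "\<dots> = integral {0..1} (\<lambda>x. 1 / (2 * of_real pi * \<i>) * (h (circlepath 0 r x) / (circlepath 0 r x)^2 *
         (2 * pi * \<i> * r * exp (2 * of_real pi * \<i> * x))))"
    by (rule integral_mult_right[symmetric])
  also have "\<dots> = integral {0..1} (\<lambda>\<theta>. h (of_real r * exp (2 * of_real pi * \<i> * of_real \<theta>)) *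
        (exp (- (2 * of_real pi * \<i> * of_real \<theta>)) / of_real r))"
    by (rule integral_cong) (use r in \<open>simp add: circlepath_def part_circlepath_def exp_minus field_simps power2_eq_square linepath_def\<close>)
  finally show ?thesis by (simp add: h_def)
qed

lemma continuous_on_smult_axis [continuous_intros]:
  assumes "continuous_on A f"
  shows "continuous_on A (\<lambda>x. f x *s (v::complex^'n::finite))"
  using continuous_on_compose2[OF linear_continuous_on[OF bounded_linear_smult_vec] assms, of UNIV] by simp

lemma circle_integrand_continuous:
  fixes f :: "complex^'n::finite \<Rightarrow> complex"
  assumes f: "continuous_on S f"
    and sub: "\<And>z t. z \<in> U \<Longrightarrow> norm t \<le> r \<Longrightarrow> z + t *s axis i 1 \<in> S" and "r > 0"
  shows "continuous_on (U \<times> cbox 0 (1::real)) (\<lambda>(z, \<theta>).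
      f (z + (of_real r * exp (2 * of_real pi * \<i> * of_real \<theta>)) *s axis i 1) *
        (exp (- (2 * of_real pi * \<i> * of_real \<theta>)) / of_real r))"
proof -
  have *: "z + (of_real r * exp (2 * of_real pi * \<i> * of_real \<theta>)) *s axis i 1 \<in> S" if "z \<in> U" for z and \<theta>::real
    using sub[OF that, of "of_real r * exp (2 * of_real pi * \<i> * of_real \<theta>)"] \<open>r > 0\<close>
    by (simp add: norm_mult)
  show ?thesis
    unfolding split_beta
    by (intro continuous_intros continuous_on_compose2[OF f]) (use * \<open>r > 0\<close> in auto)
qed

lemma ball_slice_subset:
  assumes "open S" "z0 \<in> S"
  obtains r where "r > 0" "\<And>z t i. z \<in> ball z0 r \<Longrightarrow> norm t \<le> r \<Longrightarrow> z + t *s axis i (1::complex) \<in> S"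
    "ball z0 r \<subseteq> (S :: (complex^'n::finite) set)"
proof -
  obtain e where e: "e > 0" "ball z0 e \<subseteq> S" using assms open_contains_ball by blast
  \<comment> \<open>One half of the radius is reserved for the base point, the other half for the
    displacement.\<close>
  show ?thesis
  proof (rule that[of "e/2"])
    fix z i and t :: complex assume z: "z \<in> ball z0 (e/2)" and t: "norm t \<le> e/2"
    have "dist z0 (z + t *s axis i 1) \<le> dist z0 z + norm t"
      using dist_triangle[of z0 "z + t *s axis i 1" z] by (simp add: dist_norm)
    with z t e show "z + t *s axis i 1 \<in> S" by (auto simp: subset_iff)
  qed (use e in auto)
qed

text \<open>Near each point the partial derivative is a Cauchy integral over circles of one fixed
  radius, and such an integral depends continuously on the centre.\<close>

lemma cpartial_continuous_on:
  fixes f :: "complex^'n::finite \<Rightarrow> complex"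
  assumes S: "open S" and f: "continuous_on S f" and sl: "slices_diff f S"
  shows "continuous_on S (cpartial i f)"
proof (rule continuous_at_imp_continuous_on, rule ballI)
  fix z0 assume "z0 \<in> S"
  then obtain r where r: "r > 0" "\<And>z t i. z \<in> ball z0 r \<Longrightarrow> norm t \<le> r \<Longrightarrow> z + t *s axis i (1::complex) \<in> S"
    using ball_slice_subset[OF S] by metis
  have "continuous_on (ball z0 r) (cpartial i f)
    \<longleftrightarrow> continuous_on (ball z0 r) (\<lambda>z. integral (cbox 0 1) (\<lambda>\<theta>.
      f (z + (of_real r * exp (2 * of_real pi * \<i> * of_real \<theta>)) *s axis i 1) *
        (exp (- (2 * of_real pi * \<i> * of_real \<theta>)) / of_real r)))"
    by (rule continuous_on_cong) (use r cauchy_partial[OF sl] in auto)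
  also have \<dots>
    by (rule integral_continuous_on_param circle_integrand_continuous[OF f])+ (use r in auto)
  finally show "isCont (cpartial i f) z0"
    using r(1) by (simp add: continuous_on_eq_continuous_at)
qed

text \<open>The partial derivatives are continuous by Cauchy's formula. The increment from z to y is
  split into steps along single coordinates, and the mean value bound controls each step by the
  oscillation of one partial derivative.\<close>

theorem osgood:
  fixes f :: "complex^'n::finite \<Rightarrow> complex"
  assumes S: "open S" and f: "continuous_on S f" and sl: "slices_diff f S"
  shows "holo_fun f S"
  unfolding holo_fun_iff
proof
  fix z assume z: "z \<in> S"
  define a where "a = (\<lambda>i. cpartial i f z)"
  have "(f has_derivative (\<lambda>v. \<Sum>i\<in>UNIV. a i * v $ i)) (at z)"
    unfolding has_derivative_within_alt
  proof (intro conjI allI impI)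
    show "bounded_linear (\<lambda>v. \<Sum>i\<in>UNIV. a i * v $ i)"
      by (intro bounded_linear_sum bounded_linear_const_mult bounded_linear_vec_nth)
  next
    fix e :: real assume e: "e > 0"
    \<comment> \<open>Each of the \<open>CARD('n)\<close> coordinate steps may contribute an error
      of \<open>e' * norm v\<close>.\<close>
    define e' where "e' = e / CARD('n)"
    have e': "e' > 0" using e by (simp add: e'_def)
    have "\<exists>d>0. \<forall>w. dist w z < d \<longrightarrow> dist (cpartial i f w) (a i) < e'" for i
      using cpartial_continuous_on[OF S f sl, of i] z S e' unfolding a_def
      by (metis continuous_on_eq_continuous_at continuous_at_eps_delta dist_commute)
    then obtain d where d: "\<And>i. d i > 0" "\<And>i w. dist w z < d i \<Longrightarrow> dist (cpartial i f w) (a i) < e'"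
      by metis
    obtain d0 where d0: "d0 > 0" "ball z d0 \<subseteq> S" using S z open_contains_ball by blast
    define D where "D = Min (insert d0 (range d))"
    have D: "D > 0" "D \<le> d0" "\<And>i. D \<le> d i"
      unfolding D_def using d d0 by (simp_all add: Min_gr_iff min.coboundedI2)
    show "\<exists>D>0. \<forall>y\<in>UNIV. norm (y - z) < D \<longrightarrow>
        norm (f y - f z - (\<Sum>i\<in>UNIV. a i * (y - z) $ i)) \<le> e * norm (y - z)"
    proof (intro exI[of _ D] conjI ballI impI D(1))
      fix y assume y: "norm (y - z) < D"
      define v where "v = y - z"
      \<comment> \<open>\<open>p I\<close> switches on the coordinates of \<open>v\<close> that lie
        in \<open>I\<close>, and induction on \<open>I\<close> follows a polygonal path from
        \<open>z\<close> to \<open>y\<close>. The path stays within \<open>norm v\<close> of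
        \<open>z\<close>, because each displacement is bounded componentwise by
        \<open>v\<close>.\<close>
      define p where "p = (\<lambda>I. \<chi> i. if i \<in> I then v $ i else 0)"
      have "norm (f (z + p I) - f z - (\<Sum>i\<in>I. a i * v $ i)) \<le> card I * (e' * norm v)" for I
      proof (induction I rule: infinite_finite_induct)
        case (insert j I)
        have pj: "p (insert j I) = p I + (v $ j) *s axis j 1"
          using insert(2) by (auto simp: p_def vec_eq_iff axis_def)
        define h where "h = (\<lambda>t. f ((z + p I) + t *s axis j 1) - a j * t)"
        have near: "norm (p I + t *s axis j 1) < D" if "t \<in> closed_segment 0 (v $ j)" for t
        proof -
          have "norm t \<le> norm (v $ j)" using that by (metis norm_minus_commute diff_zero segment_bound1)
          then have "norm (p I + t *s axis j 1) \<le> norm v"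
            using insert(2) by (intro norm_le_componentwise_cart) (auto simp: p_def axis_def)
          with y show ?thesis by (simp add: v_def)
        qed
        have "norm (h (v $ j) - h 0) \<le> e' * norm (v $ j - 0)"
        proof (rule field_differentiable_bound)
          fix t assume t: "t \<in> closed_segment 0 (v $ j)"
          have dist: "dist (z + p I + t *s axis j 1) z < D"
            using near[OF t] by (simp add: dist_norm add.assoc)
          then have "z + p I + t *s axis j 1 \<in> S" using d0(2) D(2) by (auto simp: subset_iff dist_commute)
          from slice_shift[OF sl this]
          show "(h has_field_derivative (cpartial j f (z + p I + t *s axis j 1) - a j)) (at t within closed_segment 0 (v $ j))"
            unfolding h_def by (auto intro!: derivative_eq_intros intro: has_field_derivative_at_within)
          show "norm (cpartial j f (z + p I + t *s axis j 1) - a j) \<le> e'"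
            using d(2)[of "z + p I + t *s axis j 1" j] dist D(3)[of j] by (simp add: dist_norm)
        qed auto
        also have "\<dots> \<le> e' * norm v" using e' by (simp add: Finite_Cartesian_Product.norm_nth_le)
        finally have 1: "norm (h (v $ j) - h 0) \<le> e' * norm v" .
        have "f (z + p (insert j I)) - f z - (\<Sum>i\<in>insert j I. a i * v $ i)
            = (h (v $ j) - h 0) + (f (z + p I) - f z - (\<Sum>i\<in>I. a i * v $ i))"
          using insert(1,2) by (simp add: h_def pj add.assoc)
        also have "norm \<dots> \<le> e' * norm v + card I * (e' * norm v)"
          by (rule norm_triangle_le[OF add_mono[OF 1 insert.IH]])
        also have "\<dots> = card (insert j I) * (e' * norm v)" using insert by (simp add: algebra_simps)
        finally show ?case .
      qed (auto simp: p_def zero_vec_def[symmetric])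
      note this[of UNIV]
      moreover have "z + p UNIV = y" "card (UNIV::'n set) * (e' * norm v) = e * norm (y - z)"
        by (simp_all add: p_def v_def e'_def vec_eq_iff)
      ultimately show "norm (f y - f z - (\<Sum>i\<in>UNIV. a i * (y - z) $ i)) \<le> e * norm (y - z)"
        unfolding v_def by metis
    qed
  qed
  then show "cdiff_at f z" by (rule cdiffI)
qed

text \<open>Differentiating the Cauchy integral for \<partial>_i f in direction j under the integral
  sign gives the same integral with \<partial>_j f in place of f. Existence of this derivative is
  separate holomorphy of \<partial>_i f; reading the result as Cauchy's formula for \<partial>_i
  (\<partial>_j f) is the symmetry of second derivatives.\<close>

lemma
  fixes f :: "complex^'n::finite \<Rightarrow> complex"
  assumes S: "open S" and f: "holo_fun f S"
  shows holo_fun_cpartial: "holo_fun (cpartial i f) S"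
    and cpartial_commute: "z \<in> S \<Longrightarrow> cpartial j (cpartial i f) z = cpartial i (cpartial j f) z"
proof -
  have fc: "continuous_on S f" by (rule holo_fun_continuous_on[OF f])
  note sl = holo_fun_slices_diff[OF f]
  have key: "((\<lambda>s. cpartial i f (z0 + s *s axis j 1)) has_field_derivative
      integral (cbox 0 (1::real)) (\<lambda>\<theta>. cpartial j f (z0 + (of_real r * exp (2 * of_real pi * \<i> * of_real \<theta>)) *s axis i 1) *
          (exp (- (2 * of_real pi * \<i> * of_real \<theta>)) / of_real r))) (at 0)"
    if r: "r > 0" and sub: "\<And>z t i. z \<in> ball z0 r \<Longrightarrow> norm t \<le> r \<Longrightarrow> z + t *s axis i (1::complex) \<in> S" for z0 r i j
  proof -
    let ?e = "\<lambda>\<theta>::real. of_real r * exp (2 * of_real pi * \<i> * of_real \<theta>)"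
    let ?k = "\<lambda>\<theta>::real. exp (- (2 * of_real pi * \<i> * of_real \<theta>)) / of_real r"
    define p where "p = (\<lambda>s. z0 + s *s axis j (1::complex))"
    have pb: "p s \<in> ball z0 r" if "s \<in> ball 0 r" for s using that by (simp add: p_def dist_norm)
    have ne: "norm (?e \<theta>) \<le> r" for \<theta> using r by (simp add: norm_mult)
    \<comment> \<open>The two displacements are interchanged, so that \<open>s\<close> runs along a
      slice in direction \<open>j\<close> based at a point of the circle.\<close>
    have swap: "p s + t *s axis i 1 = (z0 + t *s axis i 1) + s *s axis j 1" for s t
      by (simp add: p_def algebra_simps)
    have pc: "continuous_on A p" for A unfolding p_def by (intro continuous_intros)
    have "((\<lambda>s. integral (cbox 0 1) (\<lambda>\<theta>. f (p s + ?e \<theta> *s axis i 1) * ?k \<theta>)) has_field_derivative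
        integral (cbox 0 1) (\<lambda>\<theta>. cpartial j f (p 0 + ?e \<theta> *s axis i 1) * ?k \<theta>)) (at 0 within ball 0 r)"
    proof (rule leibniz_rule_field_derivative)
      fix s \<theta> assume s: "s \<in> ball (0::complex) r" and "\<theta> \<in> cbox 0 (1::real)"
      have "(z0 + ?e \<theta> *s axis i 1) + s *s axis j 1 \<in> S"
        using sub[OF pb[OF s] ne, where i=i] unfolding swap .
      from DERIV_cmult_right[OF has_field_derivative_at_within[OF slice_shift[OF sl this]], where c="?k \<theta>"]
      show "((\<lambda>s. f (p s + ?e \<theta> *s axis i 1) * ?k \<theta>) has_field_derivative
          cpartial j f (p s + ?e \<theta> *s axis i 1) * ?k \<theta>) (at s within ball 0 r)"
        unfolding swap by simp
    next
      fix s assume s: "s \<in> ball (0::complex) r"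
      have "continuous_on ({p s} \<times> cbox 0 (1::real)) (\<lambda>(z, \<theta>). f (z + ?e \<theta> *s axis i 1) * ?k \<theta>)"
        by (rule circle_integrand_continuous[OF fc]) (use sub pb[OF s] r in auto)
      from continuous_on_compose2[OF this, of "cbox 0 1" "\<lambda>\<theta>. (p s, \<theta>)"]
      show "(\<lambda>\<theta>. f (p s + ?e \<theta> *s axis i 1) * ?k \<theta>) integrable_on cbox 0 1"
        by (intro integrable_continuous) (simp add: continuous_on_Pair image_subset_iff)
    next
      have "continuous_on (ball z0 r \<times> cbox 0 (1::real)) (\<lambda>(z, \<theta>). cpartial j f (z + ?e \<theta> *s axis i 1) * ?k \<theta>)"
        by (rule circle_integrand_continuous[OF cpartial_continuous_on[OF S fc sl]]) (use sub r in auto)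
      note F = this[unfolded split_beta]
      have c: "continuous_on (ball 0 r \<times> cbox 0 (1::real)) (\<lambda>x. (p (fst x), snd x))"
        unfolding p_def by (intro continuous_intros)
      have "(\<lambda>x. (p (fst x), snd x)) ` (ball 0 r \<times> cbox 0 (1::real)) \<subseteq> ball z0 r \<times> cbox 0 1"
        using pb by (auto simp del: mem_ball)
      from continuous_on_compose2[OF F c this] show "continuous_on (ball 0 r \<times> cbox 0 1) (\<lambda>(s, \<theta>). cpartial j f (p s + ?e \<theta> *s axis i 1) * ?k \<theta>)"
        unfolding split_beta fst_conv snd_conv .
    qed (use r in auto)
    then have "((\<lambda>s. integral (cbox 0 1) (\<lambda>\<theta>. f (p s + ?e \<theta> *s axis i 1) * ?k \<theta>)) has_field_derivative
        integral (cbox 0 1) (\<lambda>\<theta>. cpartial j f (p 0 + ?e \<theta> *s axis i 1) * ?k \<theta>)) (at 0)"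
      unfolding at_within_open[OF centre_in_ball[THEN iffD2, OF r] open_ball] .
    then have "((\<lambda>s. cpartial i f (p s)) has_field_derivative
        integral (cbox 0 1) (\<lambda>\<theta>. cpartial j f (p 0 + ?e \<theta> *s axis i 1) * ?k \<theta>)) (at 0)"
    proof (rule has_field_derivative_transform_within_open)
      show "open (ball (0::complex) r)" "0 \<in> ball (0::complex) r" using r by auto
      fix s assume "s \<in> ball (0::complex) r"
      from cauchy_partial[OF sl r sub[OF pb[OF this]]]
      show "integral (cbox 0 1) (\<lambda>\<theta>. f (p s + ?e \<theta> *s axis i 1) * ?k \<theta>) = cpartial i f (p s)"
        by (simp only: interval_cbox)
    qed
    then show ?thesis by (simp add: p_def)
  qed
  have sl': "slices_diff (cpartial i f) S" for i
    unfolding slices_diff_def field_differentiable_def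
  proof (intro ballI allI)
    fix z j assume "z \<in> S"
    then obtain r where "r > 0" "\<And>w t i. w \<in> ball z r \<Longrightarrow> norm t \<le> r \<Longrightarrow> w + t *s axis i (1::complex) \<in> S"
      using ball_slice_subset[OF S] by metis
    from key[OF this] show "\<exists>f'. ((\<lambda>t. cpartial i f (z + t *s axis j 1)) has_field_derivative f') (at 0)" ..
  qed
  show "holo_fun (cpartial i f) S"
    by (rule osgood[OF S cpartial_continuous_on[OF S fc sl] sl'])
  show "cpartial j (cpartial i f) z = cpartial i (cpartial j f) z" if z: "z \<in> S"
  proof -
    obtain r where r: "r > 0" "\<And>w t i. w \<in> ball z r \<Longrightarrow> norm t \<le> r \<Longrightarrow> w + t *s axis i (1::complex) \<in> S"
      using ball_slice_subset[OF S z] by metis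
    have "cpartial j (cpartial i f) z = integral (cbox 0 (1::real)) (\<lambda>\<theta>. cpartial j f (z + (of_real r * exp (2 * of_real pi * \<i> * of_real \<theta>)) *s axis i 1) *
          (exp (- (2 * of_real pi * \<i> * of_real \<theta>)) / of_real r))"
      unfolding cpartial_def[of j "cpartial i f"] by (rule DERIV_imp_deriv[OF key[OF r]])
    also have "\<dots> = cpartial i (cpartial j f) z"
      unfolding interval_cbox[symmetric] by (rule cauchy_partial[OF sl' r(1) r(2), symmetric]) (use r(1) in auto)
    finally show ?thesis .
  qed
qed

text \<open>Osgood's theorem reduces the claim to one variable, where it is the theorem of
  Weierstrass on a small disc in each slice.\<close>

lemma holo_fun_uniform_limit:
  fixes f :: "nat \<Rightarrow> complex^'n::finite \<Rightarrow> complex"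
  assumes S: "open S" and f: "\<And>n. holo_fun (f n) S" and lim: "uniform_limit S f g sequentially"
  shows "holo_fun g S"
proof (rule osgood[OF S])
  show "continuous_on S g"
    by (rule uniform_limit_theorem[OF _ lim]) (auto intro!: always_eventually holo_fun_continuous_on f)
  show "slices_diff g S"
    unfolding slices_diff_def
  proof (intro ballI allI)
    fix z i assume "z \<in> S"
    then obtain r where r: "r > 0" "\<And>w t i. w \<in> ball z r \<Longrightarrow> norm t \<le> r \<Longrightarrow> w + t *s axis i (1::complex) \<in> S"
      using ball_slice_subset[OF S] by metis
    have "(\<lambda>t. g (z + t *s axis i 1)) holomorphic_on ball 0 r"
    proof (rule holomorphic_uniform_limit)
      show "\<forall>\<^sub>F n in sequentially. continuous_on (cball 0 r) (\<lambda>t. f n (z + t *s axis i 1)) \<and>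
          (\<lambda>t. f n (z + t *s axis i 1)) holomorphic_on ball 0 r"
      proof (intro always_eventually allI conjI)
        fix n
        have d: "((\<lambda>t. f n (z + t *s axis i 1)) has_field_derivative cpartial i (f n) (z + t *s axis i 1)) (at t)"
          if "norm t \<le> r" for t
          by (rule slice_shift[OF holo_fun_slices_diff[OF f]]) (use r that in auto)
        show "continuous_on (cball 0 r) (\<lambda>t. f n (z + t *s axis i 1))"
          by (intro continuous_at_imp_continuous_on ballI DERIV_isCont[OF d]) simp
        show "(\<lambda>t. f n (z + t *s axis i 1)) holomorphic_on ball 0 r"
          unfolding holomorphic_on_open[OF open_ball] by (intro ballI exI, rule d) simp
      qed
      show "uniform_limit (cball 0 r) (\<lambda>n t. f n (z + t *s axis i 1)) (\<lambda>t. g (z + t *s axis i 1)) sequentially"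
        by (rule uniform_limit_compose'[OF lim]) (use r in auto)
    qed auto
    then show "(\<lambda>t. g (z + t *s axis i 1)) field_differentiable at 0"
      using r(1) by (simp add: holomorphic_on_open field_differentiable_def)
  qed
qed

section \<open>Integrable linear systems\<close>

text \<open>The mean over the segment from 0 to z, as in the Poincare homotopy: \<Sum> z_i
  \<open>radint h_i z\<close> is the integral of the one-form \<Sum> h_i dz_i along the ray to
  z.\<close>

definition radint :: "(complex^'n::finite \<Rightarrow> complex) \<Rightarrow> complex^'n \<Rightarrow> complex" where
  "radint h z = integral (cbox 0 1) (\<lambda>s::real. h (s *\<^sub>R z))"

lemma of_real_smult: "of_real s *s z = s *\<^sub>R (z :: complex^'n::finite)"
  by (simp add: vec_eq_iff scaleR_conv_of_real[of _ "_ :: complex"])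

lemma scaleR_in_ball:
  assumes "z \<in> ball (0::complex^'n::finite) R" "s \<in> cbox 0 (1::real)"
  shows "s *\<^sub>R z \<in> ball 0 R"
proof -
  have "\<bar>s\<bar> * norm z \<le> 1 * norm z" using assms(2) by (intro mult_right_mono) auto
  with assms(1) show ?thesis by simp
qed

lemma ray_integrand_continuous:
  assumes "continuous_on (ball 0 R) h"
  shows "continuous_on (ball 0 R \<times> cbox 0 (1::real)) (\<lambda>(z, s). h (s *\<^sub>R (z::complex^'n::finite)))"
  unfolding split_beta
  by (intro continuous_on_compose2[OF assms] continuous_intros) (use scaleR_in_ball in fastforce)

lemma ray_continuous:
  assumes "continuous_on (ball 0 R) h" "z \<in> ball 0 R"
  shows "continuous_on (cbox 0 (1::real)) (\<lambda>s. h (s *\<^sub>R (z::complex^'n::finite)))"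
  by (intro continuous_on_compose2[OF assms(1)] continuous_intros) (use scaleR_in_ball[OF assms(2)] in blast)

lemma ray_integrable:
  fixes h :: "complex^'n::finite \<Rightarrow> complex"
  assumes "continuous_on (ball 0 R) h" "z \<in> ball 0 R"
  shows "(\<lambda>s. h (s *\<^sub>R z)) integrable_on cbox 0 (1::real)"
  by (rule integrable_continuous[OF ray_continuous[OF assms]])

lemma sum_axis: "(\<Sum>j\<in>UNIV. b j * axis i (1::complex) $ j) = b i"
  by (simp add: axis_def if_distrib cong: if_cong)

lemma
  fixes h :: "complex^'n::finite \<Rightarrow> complex"
  assumes h: "holo_fun h (ball 0 R)"
  shows holo_fun_radint: "holo_fun (radint h) (ball 0 R)"
    and cpartial_radint: "z \<in> ball 0 R \<Longrightarrow>
      cpartial j (radint h) z = integral (cbox 0 1) (\<lambda>s::real. of_real s * cpartial j h (s *\<^sub>R z))"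
proof -
  have hc: "continuous_on (ball 0 R) h" by (rule holo_fun_continuous_on[OF h])
  have pc: "continuous_on (ball 0 R) (cpartial j h)" for j
    by (rule holo_fun_continuous_on[OF holo_fun_cpartial[OF open_ball h]])
  have key: "((\<lambda>t. radint h (z0 + t *s axis j 1)) has_field_derivative
      integral (cbox 0 1) (\<lambda>s::real. of_real s * cpartial j h (s *\<^sub>R z0))) (at 0)"
    if z0: "z0 \<in> ball 0 R" for z0 j
  proof -
    define e where "e = R - norm z0"
    have e: "e > 0" using z0 by (simp add: e_def)
    define p where "p = (\<lambda>t. z0 + t *s axis j (1::complex))"
    have pb: "p t \<in> ball 0 R" if "t \<in> ball 0 e" for t
      using that norm_triangle_ineq[of z0 "t *s axis j 1"] by (simp add: p_def e_def)
    have pcont: "continuous_on A p" for A unfolding p_def by (intro continuous_intros)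
    have "((\<lambda>t. integral (cbox 0 1) (\<lambda>s::real. h (s *\<^sub>R p t))) has_field_derivative
        integral (cbox 0 1) (\<lambda>s::real. of_real s * cpartial j h (s *\<^sub>R p 0))) (at 0 within ball 0 e)"
    proof (rule leibniz_rule_field_derivative)
      fix t s assume t: "t \<in> ball (0::complex) e" and s: "s \<in> cbox 0 (1::real)"
      have "((\<lambda>t. h (s *\<^sub>R p t)) has_field_derivative
          (\<Sum>i\<in>UNIV. cpartial i h (s *\<^sub>R p t) * (of_real s *s axis j 1) $ i)) (at t)"
      proof (rule cdiff_curve[where c="\<lambda>t. s *\<^sub>R p t"])
        show "cdiff_at h (s *\<^sub>R p t)" using holo_funD[OF h] scaleR_in_ball[OF pb[OF t] s] by blast
        show "((\<lambda>t. (s *\<^sub>R p t) $ i) has_field_derivative (of_real s *s axis j 1) $ i) (at t)" for i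
          unfolding p_def by (auto intro!: derivative_eq_intros simp: scaleR_conv_of_real[of _ "_ :: complex"])
      qed
      moreover have "(\<Sum>i\<in>UNIV. cpartial i h (s *\<^sub>R p t) * (of_real s *s axis j 1) $ i)
          = of_real s * cpartial j h (s *\<^sub>R p t)"
        using sum_axis[of "\<lambda>i. cpartial i h (s *\<^sub>R p t) * of_real s" j] by (simp add: mult_ac)
      ultimately show "((\<lambda>t. h (s *\<^sub>R p t)) has_field_derivative
          of_real s * cpartial j h (s *\<^sub>R p t)) (at t within ball 0 e)"
        by (simp add: has_field_derivative_at_within)
    next
      fix t assume "t \<in> ball (0::complex) e"
      then show "(\<lambda>s. h (s *\<^sub>R p t)) integrable_on cbox 0 1"
        by (intro ray_integrable[OF hc] pb)
    next
      have "continuous_on (ball 0 e \<times> cbox 0 1) (\<lambda>x. cpartial j h (snd x *\<^sub>R p (fst x)))"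
      proof -
        note F = ray_integrand_continuous[OF pc[of j], unfolded split_beta]
        have c: "continuous_on (ball 0 e \<times> cbox 0 (1::real)) (\<lambda>x. (p (fst x), snd x))"
          unfolding p_def by (intro continuous_intros)
        have "(\<lambda>x. (p (fst x), snd x)) ` (ball 0 e \<times> cbox 0 (1::real)) \<subseteq> ball 0 R \<times> cbox 0 1"
          using pb by (auto simp del: mem_ball)
        from continuous_on_compose2[OF F c this] show ?thesis unfolding fst_conv snd_conv .
      qed
      then show "continuous_on (ball 0 e \<times> cbox 0 1) (\<lambda>(t, s). of_real s * cpartial j h (s *\<^sub>R p t))"
        unfolding split_beta by (intro continuous_intros)
    qed (use e in auto)
    moreover have "p 0 = z0" by (simp add: p_def)
    ultimately show ?thesis
      unfolding at_within_open[OF centre_in_ball[THEN iffD2, OF e] open_ball] radint_def by (simp only: p_def)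
  qed
  show "holo_fun (radint h) (ball 0 R)"
  proof (rule osgood)
    show "continuous_on (ball 0 R) (radint h)"
      unfolding radint_def by (rule integral_continuous_on_param ray_integrand_continuous[OF hc])+
    show "slices_diff (radint h) (ball 0 R)"
      unfolding slices_diff_def field_differentiable_def using key by blast
  qed auto
  show "z \<in> ball 0 R \<Longrightarrow>
      cpartial j (radint h) z = integral (cbox 0 1) (\<lambda>s::real. of_real s * cpartial j h (s *\<^sub>R z))"
    unfolding cpartial_def[of j "radint h"] by (rule DERIV_imp_deriv[OF key])
qed

lemma radint_sum:
  assumes "\<And>i. i \<in> I \<Longrightarrow> continuous_on (ball 0 R) (h i)" "z \<in> ball 0 R"
  shows "(\<Sum>i\<in>I. c i * radint (h i) z) = integral (cbox 0 1) (\<lambda>s. \<Sum>i\<in>I. c i * h i (s *\<^sub>R z))"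
proof (cases "finite I")
  case True
  have "integral (cbox 0 1) (\<lambda>s::real. \<Sum>i\<in>I. c i * h i (s *\<^sub>R z))
     = (\<Sum>i\<in>I. integral (cbox 0 1) (\<lambda>s. c i * h i (s *\<^sub>R z)))"
    by (rule integral_sum[OF True]) (intro integrable_on_mult_right ray_integrable[OF assms(1)] assms(2))
  then show ?thesis by (simp add: radint_def)
qed simp

lemma integral_unit_bound:
  assumes "continuous_on (cbox 0 (1::real)) f" "\<And>s. s \<in> cbox 0 1 \<Longrightarrow> norm (f s :: complex) \<le> B"
  shows "norm (integral (cbox 0 1) f) \<le> B"
proof -
  have "B \<ge> 0" using order_trans[OF norm_ge_zero assms(2)[of 0]] by simp
  from has_integral_bound[OF this integrable_integral[OF integrable_continuous[OF assms(1)]] assms(2)]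
  show ?thesis by simp
qed

text \<open>The integrand is the s-derivative of s * h (s z), which is 0 at s = 0 and h z at s =
  1.\<close>

lemma radint_euler:
  fixes h :: "complex^'n::finite \<Rightarrow> complex"
  assumes h: "holo_fun h (ball 0 R)" and z: "z \<in> ball 0 R"
  shows "h z = radint (\<lambda>w. h w + (\<Sum>i\<in>UNIV. w $ i * cpartial i h w)) z"
proof -
  have "((\<lambda>s. of_real s * h (of_real s *s z)) has_vector_derivative
      h (s *\<^sub>R z) + (\<Sum>i\<in>UNIV. (s *\<^sub>R z) $ i * cpartial i h (s *\<^sub>R z))) (at s within {0..1})"
    if "s \<in> {0..1}" for s :: real
  proof (rule has_vector_derivative_real_field[where f="\<lambda>t. t * h (t *s z)"])
    have s: "of_real s *s z \<in> ball 0 R" unfolding of_real_smult using scaleR_in_ball[OF z] that by auto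
    have 1: "((\<lambda>t. h (t *s z)) has_field_derivative
        (\<Sum>i\<in>UNIV. cpartial i h (of_real s *s z) * z $ i)) (at (of_real s))"
      by (rule cdiff_curve[where c="\<lambda>t. t *s z"]) (use s holo_funD[OF h] in \<open>auto intro!: derivative_eq_intros\<close>)
    show "((\<lambda>t. t * h (t *s z)) has_field_derivative
      h (s *\<^sub>R z) + (\<Sum>i\<in>UNIV. (s *\<^sub>R z) $ i * cpartial i h (s *\<^sub>R z))) (at (of_real s))"
      using DERIV_mult[OF DERIV_ident 1]
      by (simp add: of_real_smult scaleR_conv_of_real[of _ "_ :: complex"] sum_distrib_left sum_distrib_right mult_ac add.commute)
  qed
  from fundamental_theorem_of_calculus[OF _ this]
  have "((\<lambda>s. h (s *\<^sub>R z) + (\<Sum>i\<in>UNIV. (s *\<^sub>R z) $ i * cpartial i h (s *\<^sub>R z))) has_integral h z) {0..1}"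
    by simp
  then show ?thesis by (simp add: radint_def integral_unique)
qed

text \<open>\<open>radint\<close> inverts the operator h + \<Sum> z_i \<partial>_i h from both
  sides; differentiation under the integral sign reduces this side to
  \<open>radint_euler\<close>.\<close>

lemma euler_radint:
  fixes h :: "complex^'n::finite \<Rightarrow> complex"
  assumes h: "holo_fun h (ball 0 R)" and z: "z \<in> ball 0 R"
  shows "radint h z + (\<Sum>i\<in>UNIV. z $ i * cpartial i (radint h) z) = h z"
proof -
  have pc: "continuous_on (ball 0 R) (cpartial j h)" for j
    by (rule holo_fun_continuous_on[OF holo_fun_cpartial[OF open_ball h]])
  have int: "(\<lambda>s. z $ i * (of_real s * cpartial i h (s *\<^sub>R z))) integrable_on cbox 0 (1::real)" for i
    by (intro integrable_continuous continuous_intros ray_continuous[OF pc z])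
  have "radint h z + (\<Sum>i\<in>UNIV. z $ i * cpartial i (radint h) z)
      = integral (cbox 0 1) (\<lambda>s. h (s *\<^sub>R z)) +
        (\<Sum>i\<in>UNIV. integral (cbox 0 1) (\<lambda>s::real. z $ i * (of_real s * cpartial i h (s *\<^sub>R z))))"
    using z by (simp add: cpartial_radint[OF h] radint_def)
  also have "\<dots> = integral (cbox 0 1) (\<lambda>s. h (s *\<^sub>R z) +
        (\<Sum>i\<in>UNIV. z $ i * (of_real s * cpartial i h (s *\<^sub>R z))))"
    by (simp only: Henstock_Kurzweil_Integration.integral_add[OF ray_integrable[OF holo_fun_continuous_on[OF h] z]
          integrable_sum[OF finite int]] integral_sum[OF finite int])
  also have "\<dots> = radint (\<lambda>w. h w + (\<Sum>i\<in>UNIV. w $ i * cpartial i h w)) z"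
    by (simp add: radint_def scaleR_conv_of_real[of _ "_ :: complex"] mult_ac)
  also have "\<dots> = h z" by (rule radint_euler[OF h z, symmetric])
  finally show ?thesis .
qed

text \<open>Picard iteration along rays solves the system in the radial direction. The defect
  \<open>D\<^sub>j = \<partial>\<^sub>j \<Psi> - A\<^sub>j \<Psi>\<close> of the solution then satisfies a homogeneous radial system by flatness,
  so it vanishes.\<close>

theorem linear_system_solvable:
  fixes A :: "'n::finite \<Rightarrow> complex^'n \<Rightarrow> complex^'m^'m::finite"
  assumes R: "R > 0"
    and holo: "\<And>i k l. holo_fun (\<lambda>z. A i z $ k $ l) (ball 0 R)"
    and flat: "\<And>i j k l z. z \<in> ball 0 R \<Longrightarrow>
      cpartial i (\<lambda>z. A j z $ k $ l) z + (\<Sum>m\<in>UNIV. A j z $ k $ m * A i z $ m $ l) =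
      cpartial j (\<lambda>z. A i z $ k $ l) z + (\<Sum>m\<in>UNIV. A i z $ k $ m * A j z $ m $ l)"
  obtains r where "0 < r" "r \<le> R"
    "\<And>\<psi>::complex^'m. \<exists>\<Psi>. (\<forall>k. holo_fun (\<lambda>z. \<Psi> z $ k) (ball 0 r)) \<and> \<Psi> 0 = \<psi> \<and>
      (\<forall>z\<in>ball 0 r. \<forall>i k. cpartial i (\<lambda>z. \<Psi> z $ k) z = (\<Sum>l\<in>UNIV. A i z $ k $ l * \<Psi> z $ l))"
proof -
  have "\<exists>B. \<forall>z\<in>cball 0 (R/2). norm (A i z $ k $ l) \<le> B" for i k l
  proof -
    have "continuous_on (cball 0 (R/2)) (\<lambda>z. A i z $ k $ l)"
      by (rule continuous_on_subset[OF holo_fun_continuous_on[OF holo]]) (use R in auto)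
    then have "bounded ((\<lambda>z. A i z $ k $ l) ` cball 0 (R/2))"
      by (intro compact_imp_bounded compact_continuous_image compact_cball)
    then show ?thesis by (auto simp: bounded_iff)
  qed
  then obtain B where B: "\<And>i k l z. z \<in> cball 0 (R/2) \<Longrightarrow> norm (A i z $ k $ l) \<le> B i k l" by metis
  \<comment> \<open>One bound for all entries on the closed half ball, where compactness provides
    it. The summand 1 keeps it positive when A vanishes.\<close>
  define K where "K = 1 + (\<Sum>i\<in>UNIV. \<Sum>k\<in>UNIV. \<Sum>l\<in>UNIV. \<bar>B i k l\<bar>)"
  have K0: "K > 0" unfolding K_def by (intro add_pos_nonneg sum_nonneg) auto
  have K: "norm (A i z $ k $ l) \<le> K" if "z \<in> cball 0 (R/2)" for i k l z
  proof -
    have "\<bar>B i k l\<bar> \<le> (\<Sum>l\<in>UNIV. \<bar>B i k l\<bar>)" by (rule member_le_sum) auto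
    also have "\<dots> \<le> (\<Sum>k\<in>UNIV. \<Sum>l\<in>UNIV. \<bar>B i k l\<bar>)"
      by (rule member_le_sum[of _ _ "\<lambda>k. \<Sum>l\<in>UNIV. \<bar>B i k l\<bar>"]) (auto intro: sum_nonneg)
    also have "\<dots> \<le> (\<Sum>i\<in>UNIV. \<Sum>k\<in>UNIV. \<Sum>l\<in>UNIV. \<bar>B i k l\<bar>)"
      by (rule member_le_sum[of _ _ "\<lambda>i. \<Sum>k\<in>UNIV. \<Sum>l\<in>UNIV. \<bar>B i k l\<bar>"]) (auto intro!: sum_nonneg)
    finally show ?thesis using B[OF that, of i k l] by (simp add: K_def)
  qed
  define N where "N = real CARD('n) * real CARD('m)"
  have N: "N > 0" by (simp add: N_def)
  \<comment> \<open>The second entry of the minimum makes r N K at most 1/2, where N counts the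
    terms of the double sum over directions and components.\<close>
  define r where "r = min (R/2) (1 / (2 * N * K))"
  have r: "r > 0" "r \<le> R" "r \<le> R/2" using R N K0 by (auto simp: r_def)
  have rN: "r * N * K \<le> 1/2"
  proof -
    have "r * (N * K) \<le> 1 / (2 * N * K) * (N * K)"
      using N K0 by (intro mult_right_mono) (auto simp: r_def)
    then show ?thesis using N K0 by (simp add: mult.assoc)
  qed
  \<comment> \<open>The radial integral operator contracts by the factor 1/2 in the supremum norm.
    This serves twice: for convergence of the iteration, and later for uniqueness, applied to the
    defect.\<close>
  have small: "norm (\<Sum>i\<in>UNIV. z $ i * (\<Sum>l\<in>UNIV. A i w $ k $ l * x l)) \<le> M / 2"
    if "z \<in> ball 0 r" "w \<in> ball 0 r" "\<And>l. norm (x l) \<le> M" for z w x M k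
  proof -
    have M: "M \<ge> 0" using that(3) norm_ge_zero order_trans by blast
    have wR: "w \<in> cball 0 (R/2)" using that(2) r by auto
    have zr: "norm (z $ i) \<le> r" for i using that(1) Finite_Cartesian_Product.norm_nth_le[of z i] by simp
    have "norm (\<Sum>i\<in>UNIV. z $ i * (\<Sum>l\<in>UNIV. A i w $ k $ l * x l)) \<le> (\<Sum>i::'n\<in>UNIV. r * (\<Sum>l::'m\<in>UNIV. K * M))"
      unfolding norm_mult
      by (intro sum_norm_le order_trans[OF norm_mult_ineq] mult_mono zr K wR that(3))
         (use r K0 M in \<open>auto intro: sum_nonneg\<close>)
    also have "\<dots> = r * N * K * M" by (simp add: N_def)
    also have "\<dots> \<le> 1/2 * M" by (rule mult_right_mono[OF rN M])
    finally show ?thesis by simp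
  qed
  have holo': "holo_fun (\<lambda>z. A i z $ k $ l) (ball 0 r)" for i k l
    using holo r(2) by (auto simp: holo_fun_iff)
  show ?thesis
  proof (rule that[OF r(1,2)])
    fix \<psi> :: "complex^'m"
    \<comment> \<open>A fixed point satisfies the integrated form of the system contracted with z:
      of all the equations only the radial combination \<Sum> z_i \<partial>_i is imposed.\<close>
    define T where "T = (\<lambda>\<Psi> z k. \<psi> $ k + (\<Sum>i\<in>UNIV. z $ i * radint (\<lambda>w. \<Sum>l\<in>UNIV. A i w $ k $ l * \<Psi> w l) z))"
    define P where "P = (\<lambda>n. (T ^^ n) (\<lambda>z k. \<psi> $ k))"
    have P0: "P 0 = (\<lambda>z k. \<psi> $ k)" and PS: "P (Suc n) = T (P n)" for n by (simp_all add: P_def)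
    have H: "holo_fun (\<lambda>w. \<Sum>l\<in>UNIV. A i w $ k $ l * \<Psi> w l) (ball 0 r)"
      if "\<And>l. holo_fun (\<lambda>w. \<Psi> w l) (ball 0 r)" for \<Psi> i k
      using that holo' unfolding holo_fun_iff by (intro ballI cdiff_sum cdiff_mult) blast+
    have TH: "holo_fun (\<lambda>z. T \<Psi> z k) (ball 0 r)"
      if "\<And>l. holo_fun (\<lambda>w. \<Psi> w l) (ball 0 r)" for \<Psi> k
    proof -
      have "holo_fun (radint (\<lambda>w. \<Sum>l\<in>UNIV. A i w $ k $ l * \<Psi> w l)) (ball 0 r)" for i
        by (rule holo_fun_radint[OF H[OF that]])
      then show ?thesis unfolding T_def holo_fun_iff by (intro ballI cdiff_intros) blast
    qed
    have PH: "holo_fun (\<lambda>z. P n z k) (ball 0 r)" for n k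
      by (induction n arbitrary: k) (simp add: P0 holo_fun_iff, simp only: PS, rule TH)
    have Tdiff: "norm (T \<Psi> z k - T \<Phi> z k) \<le> M / 2"
      if \<Psi>: "\<And>l. holo_fun (\<lambda>w. \<Psi> w l) (ball 0 r)" and \<Phi>: "\<And>l. holo_fun (\<lambda>w. \<Phi> w l) (ball 0 r)"
        and M: "\<And>w l. w \<in> ball 0 r \<Longrightarrow> norm (\<Psi> w l - \<Phi> w l) \<le> M" and z: "z \<in> ball 0 r" for \<Psi> \<Phi> z k M
    proof -
      note c\<Psi> = holo_fun_continuous_on[OF H[OF \<Psi>]] and c\<Phi> = holo_fun_continuous_on[OF H[OF \<Phi>]]
      let ?f = "\<lambda>s::real. \<Sum>i\<in>UNIV. z $ i * (\<Sum>l\<in>UNIV. A i (s *\<^sub>R z) $ k $ l * \<Psi> (s *\<^sub>R z) l)"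
      let ?g = "\<lambda>s::real. \<Sum>i\<in>UNIV. z $ i * (\<Sum>l\<in>UNIV. A i (s *\<^sub>R z) $ k $ l * \<Phi> (s *\<^sub>R z) l)"
      have cont: "continuous_on (cbox 0 1) ?f" "continuous_on (cbox 0 1) ?g"
        by (intro continuous_on_sum[of UNIV "cbox 0 1"] continuous_on_mult_left
            ray_continuous[OF c\<Psi> z] ray_continuous[OF c\<Phi> z])+
      have "T \<Psi> z k - T \<Phi> z k = integral (cbox 0 1) ?f - integral (cbox 0 1) ?g"
        unfolding T_def by (simp add: radint_sum[OF c\<Psi> z] radint_sum[OF c\<Phi> z])
      also have "\<dots> = integral (cbox 0 1) (\<lambda>s. ?f s - ?g s)"
        by (rule Henstock_Kurzweil_Integration.integral_diff[symmetric]) (intro integrable_continuous cont)+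
      also have "norm \<dots> \<le> M / 2"
      proof (rule integral_unit_bound)
        show "continuous_on (cbox 0 1) (\<lambda>s. ?f s - ?g s)" by (intro continuous_on_diff cont)
        fix s :: real assume s: "s \<in> cbox 0 1"
        have "?f s - ?g s = (\<Sum>i\<in>UNIV. z $ i * (\<Sum>l\<in>UNIV. A i (s *\<^sub>R z) $ k $ l * (\<Psi> (s *\<^sub>R z) l - \<Phi> (s *\<^sub>R z) l)))"
          by (simp add: sum_subtractf right_diff_distrib)
        also have "norm \<dots> \<le> M / 2"
          by (rule small[OF z scaleR_in_ball[OF z s] M[OF scaleR_in_ball[OF z s]]])
        finally show "norm (?f s - ?g s) \<le> M / 2" .
      qed
      finally show ?thesis .
    qed
    have step: "\<exists>C. \<forall>n k. \<forall>z\<in>ball 0 r. norm (P (Suc n) z k - P n z k) \<le> C * (1/2) ^ n"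
    proof -
      have b: "norm (P 1 z k - P 0 z k) \<le> norm \<psi> / 2" if z: "z \<in> ball 0 r" for z k
      proof -
        \<comment> \<open>The zero function is mapped to the constant \<psi>, which is
          \<open>P 0\<close>. The first increment is thus a difference of two values of
          \<open>T\<close> and falls under \<open>Tdiff\<close>.\<close>
        have "T (\<lambda>z k. 0) z k = \<psi> $ k" by (simp add: T_def radint_def)
        moreover have "norm (T (P 0) z k - T (\<lambda>z k. 0) z k) \<le> norm \<psi> / 2"
          by (rule Tdiff[OF PH _ _ z])
             (simp_all add: P0 holo_fun_iff Finite_Cartesian_Product.norm_nth_le)
        ultimately show ?thesis by (simp add: PS P0)
      qed
      have "\<forall>k. \<forall>z\<in>ball 0 r. norm (P (Suc n) z k - P n z k) \<le> (norm \<psi> / 2) * (1/2) ^ n" for n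
      proof (induction n)
        case (Suc n)
        show ?case
        proof (intro allI ballI)
          fix k z assume z: "z \<in> ball (0::complex^'n) r"
          have "norm (T (P (Suc n)) z k - T (P n) z k) \<le> (norm \<psi> / 2) * (1/2) ^ n / 2"
            by (rule Tdiff[OF PH PH _ z]) (use Suc in blast)
          then show "norm (P (Suc (Suc n)) z k - P (Suc n) z k) \<le> (norm \<psi> / 2) * (1/2) ^ Suc n"
            by (simp add: PS)
        qed
      qed (use b in auto)
      then show ?thesis by blast
    qed
    then obtain C where C: "\<And>n k z. z \<in> ball 0 r \<Longrightarrow> norm (P (Suc n) z k - P n z k) \<le> C * (1/2) ^ n" by blast
    define L where "L = (\<lambda>z k. \<psi> $ k + (\<Sum>n. P (Suc n) z k - P n z k))"
    have lim: "uniform_limit (ball 0 r) (\<lambda>n z. P n z k) (\<lambda>z. L z k) sequentially" for k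
    proof -
      have "uniform_limit (ball 0 r) (\<lambda>n z. \<Sum>j<n. P (Suc j) z k - P j z k)
          (\<lambda>z. \<Sum>n. P (Suc n) z k - P n z k) sequentially"
        by (rule Weierstrass_m_test[OF C]) (auto intro: summable_mult)
      from uniform_limit_add[OF uniform_limit_const this, of "\<lambda>z. \<psi> $ k"]
      moreover have "(\<lambda>n z. P n z k) = (\<lambda>n z. \<psi> $ k + (\<Sum>j<n. P (Suc j) z k - P j z k))"
        by (simp add: sum_lessThan_telescope[of "\<lambda>j. P j z k" for z] P0 fun_eq_iff)
      ultimately show ?thesis by (simp only: L_def)
    qed
    have LH: "holo_fun (\<lambda>z. L z k) (ball 0 r)" for k
      by (rule holo_fun_uniform_limit[OF open_ball PH lim])
    have fix_: "L z k = T L z k" if z: "z \<in> ball 0 r" for z k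
    proof (rule LIMSEQ_unique)
      show "(\<lambda>n. P (Suc n) z k) \<longlonglongrightarrow> L z k"
        using tendsto_uniform_limitI[OF lim z] by (rule LIMSEQ_Suc)
      show "(\<lambda>n. P (Suc n) z k) \<longlonglongrightarrow> T L z k"
      proof (rule tendstoI)
        fix e :: real assume e: "e > 0"
        have "\<forall>\<^sub>F n in sequentially. \<forall>l\<in>UNIV. \<forall>w\<in>ball 0 r. dist (P n w l) (L w l) < e"
          by (rule eventually_ball_finite) (use lim e in \<open>auto simp: uniform_limit_iff\<close>)
        then show "\<forall>\<^sub>F n in sequentially. dist (P (Suc n) z k) (T L z k) < e"
        proof (rule eventually_mono)
          fix n assume n: "\<forall>l\<in>UNIV. \<forall>w\<in>ball 0 r. dist (P n w l) (L w l) < e"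
          have "norm (T (P n) z k - T L z k) \<le> e / 2"
            by (rule Tdiff[OF PH LH _ z]) (use n in \<open>auto simp: dist_norm less_imp_le simp del: mem_ball\<close>)
          with e show "dist (P (Suc n) z k) (T L z k) < e" by (simp add: PS dist_norm)
        qed
      qed
    qed
    define Dk where "Dk = (\<lambda>j k z. cpartial j (\<lambda>z. L z k) z - (\<Sum>l\<in>UNIV. A j z $ k $ l * L z l))"
    have HL: "holo_fun (\<lambda>w. \<Sum>l\<in>UNIV. A i w $ k $ l * L w l) (ball 0 r)" for i k
      by (rule H[OF LH])
    have DH: "holo_fun (Dk j k) (ball 0 r)" for j k
      unfolding Dk_def using holo_fun_cpartial[OF open_ball LH] HL
      unfolding holo_fun_iff by (intro ballI cdiff_diff) blast+
    \<comment> \<open>\<open>euler_radint\<close> turns the derivative of the fixed point equation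
      along z back into \<Sum> z_i A_i L, so the radial component of the defect is zero.\<close>
    have E1: "(\<Sum>j\<in>UNIV. z $ j * Dk j k z) = 0" if z: "z \<in> ball 0 r" for z k
    proof -
      define J where "J = (\<lambda>i. radint (\<lambda>w. \<Sum>l\<in>UNIV. A i w $ k $ l * L w l))"
      have JH: "cdiff_at (J i) z" for i
        unfolding J_def using holo_fun_radint[OF HL] z by (rule holo_funD)
      have "cpartial j (\<lambda>z. L z k) z = cpartial j (\<lambda>z. \<psi> $ k + (\<Sum>i\<in>UNIV. z $ i * J i z)) z" for j
        by (rule cpartial_cong[OF open_ball z]) (simp only: fix_[of _ k] T_def J_def)
      also have "\<dots> j = J j z + (\<Sum>i\<in>UNIV. z $ i * cpartial j (J i) z)" for j
        by (simp add: cpartial_add cdiff_sum cdiff_mult JH cpartial_sum cpartial_mult cpartial_nth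
            sum.distrib if_distrib[of "\<lambda>x. x * _"] cong: if_cong)
      finally have "(\<Sum>j\<in>UNIV. z $ j * cpartial j (\<lambda>z. L z k) z)
          = (\<Sum>j\<in>UNIV. z $ j * (J j z + (\<Sum>i\<in>UNIV. z $ i * cpartial j (J i) z)))" by simp
      also have "\<dots> = (\<Sum>j\<in>UNIV. z $ j * J j z) + (\<Sum>j\<in>UNIV. \<Sum>i\<in>UNIV. z $ j * (z $ i * cpartial j (J i) z))"
        by (simp add: distrib_left sum.distrib sum_distrib_left)
      also have "(\<Sum>j\<in>UNIV. \<Sum>i\<in>UNIV. z $ j * (z $ i * cpartial j (J i) z))
          = (\<Sum>i\<in>UNIV. \<Sum>j\<in>UNIV. z $ j * (z $ i * cpartial j (J i) z))"
        by (rule sum.swap)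
      also have "(\<Sum>j\<in>UNIV. z $ j * J j z) + \<dots> = (\<Sum>i\<in>UNIV. z $ i * (J i z + (\<Sum>j\<in>UNIV. z $ j * cpartial j (J i) z)))"
        by (simp add: distrib_left sum.distrib sum_distrib_left mult_ac)
      also have "\<dots> = (\<Sum>i\<in>UNIV. z $ i * (\<Sum>l\<in>UNIV. A i z $ k $ l * L z l))"
        unfolding J_def by (simp only: euler_radint[OF HL z])
      finally show ?thesis by (simp add: Dk_def right_diff_distrib sum_subtractf)
    qed
    \<comment> \<open>In the derivative of D_j, \<partial>_i L is replaced by D_i + A_i L. Second
      derivatives of L commute and the terms proportional to L agree by flatness; what is left says
      that D is closed for the covariant exterior derivative.\<close>
    have E2: "cpartial i (Dk j k) z + (\<Sum>l\<in>UNIV. A j z $ k $ l * Dk i l z)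
        = cpartial j (Dk i k) z + (\<Sum>l\<in>UNIV. A i z $ k $ l * Dk j l z)" if z: "z \<in> ball 0 r" for i j k z
    proof -
      have zR: "z \<in> ball 0 R" using z r by auto
      note LHz = holo_funD[OF LH z] and AHz = holo_funD[OF holo' z]
      have e: "cpartial i (Dk j k) z + (\<Sum>l\<in>UNIV. A j z $ k $ l * Dk i l z)
         = cpartial i (cpartial j (\<lambda>z. L z k)) z
           - (\<Sum>l\<in>UNIV. (cpartial i (\<lambda>z. A j z $ k $ l) z + (\<Sum>m\<in>UNIV. A j z $ k $ m * A i z $ m $ l)) * L z l)"
        for i j
      proof -
        have a: "cpartial i (Dk j k) z = cpartial i (cpartial j (\<lambda>z. L z k)) z
            - (\<Sum>l\<in>UNIV. A j z $ k $ l * cpartial i (\<lambda>z. L z l) z + cpartial i (\<lambda>z. A j z $ k $ l) z * L z l)"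
          unfolding Dk_def
          using holo_funD[OF holo_fun_cpartial[OF open_ball LH] z]
          by (simp add: cpartial_diff cpartial_sum cpartial_mult cdiff_sum cdiff_mult LHz AHz)
        have b: "cpartial i (\<lambda>z. L z l) z = Dk i l z + (\<Sum>m\<in>UNIV. A i z $ l $ m * L z m)" for l
          by (simp add: Dk_def)
        have c: "(\<Sum>l\<in>UNIV. A j z $ k $ l * (\<Sum>m\<in>UNIV. A i z $ l $ m * L z m))
           = (\<Sum>l\<in>UNIV. (\<Sum>m\<in>UNIV. A j z $ k $ m * A i z $ m $ l) * L z l)"
          unfolding sum_distrib_left sum_distrib_right by (subst sum.swap) (simp add: mult_ac)
        show ?thesis
          unfolding a b distrib_left distrib_right sum.distrib c by simp
      qed
      show ?thesis
        unfolding e by (simp only: flat[OF zR, of i j] cpartial_commute[OF open_ball LH z, where i=i and j=j])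
    qed
    \<comment> \<open>This is E1 differentiated in direction j, with \<partial>_j D_i exchanged for
      \<partial>_i D_j by E2. The additional term \<Sum> z_i A_j D_i vanishes by E1 once
      more.\<close>
    have E3: "Dk j k z + (\<Sum>i\<in>UNIV. z $ i * cpartial i (Dk j k) z)
        = (\<Sum>i\<in>UNIV. z $ i * (\<Sum>l\<in>UNIV. A i z $ k $ l * Dk j l z))" if z: "z \<in> ball 0 r" for j k z
    proof -
      note DHz = holo_funD[OF DH z]
      have "cpartial j (\<lambda>z. \<Sum>i\<in>UNIV. z $ i * Dk i k z) z = cpartial j (\<lambda>z. 0) z"
        by (rule cpartial_cong[OF open_ball z E1])
      then have "0 = cpartial j (\<lambda>z. \<Sum>i\<in>UNIV. z $ i * Dk i k z) z" by simp
      also have "\<dots> = Dk j k z + (\<Sum>i\<in>UNIV. z $ i * cpartial j (Dk i k) z)"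
        by (simp add: cdiff_mult DHz cpartial_sum cpartial_mult cpartial_nth
            sum.distrib if_distrib[of "\<lambda>x. x * _"] cong: if_cong)
      finally have 1: "Dk j k z = - (\<Sum>i\<in>UNIV. z $ i * cpartial j (Dk i k) z)" by (simp add: eq_neg_iff_add_eq_0)
      have "(\<Sum>i\<in>UNIV. z $ i * (\<Sum>l\<in>UNIV. A j z $ k $ l * Dk i l z))
          = (\<Sum>l\<in>UNIV. A j z $ k $ l * (\<Sum>i\<in>UNIV. z $ i * Dk i l z))"
        unfolding sum_distrib_left by (subst sum.swap) (simp add: mult_ac)
      then have 2: "(\<Sum>i\<in>UNIV. z $ i * (\<Sum>l\<in>UNIV. A j z $ k $ l * Dk i l z)) = 0"
        by (simp add: E1[OF z])
      have "(\<Sum>i\<in>UNIV. z $ i * cpartial i (Dk j k) z)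
          = (\<Sum>i\<in>UNIV. z $ i * (cpartial j (Dk i k) z + (\<Sum>l\<in>UNIV. A i z $ k $ l * Dk j l z)
               - (\<Sum>l\<in>UNIV. A j z $ k $ l * Dk i l z)))"
        by (simp add: E2[OF z, symmetric])
      also have "\<dots> = (\<Sum>i\<in>UNIV. z $ i * cpartial j (Dk i k) z)
          + (\<Sum>i\<in>UNIV. z $ i * (\<Sum>l\<in>UNIV. A i z $ k $ l * Dk j l z))
          - (\<Sum>i\<in>UNIV. z $ i * (\<Sum>l\<in>UNIV. A j z $ k $ l * Dk i l z))"
        by (simp add: distrib_left right_diff_distrib sum.distrib sum_subtractf)
      finally show ?thesis using 1 2 by simp
    qed
    \<comment> \<open>By \<open>radint_euler\<close> and E3 the defect is a radial integral of
      \<Sum> z_i A_i D_j, so \<open>small\<close> halves every bound for it. The closed ball of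
      radius \<open>norm z\<close> is stable under shrinking along rays and, being compact, provides
      an initial bound.\<close>
    have zero: "Dk j k z = 0" if z: "z \<in> ball 0 r" for j k z
    proof -
      define \<rho> where "\<rho> = norm z"
      have \<rho>: "cball 0 \<rho> \<subseteq> ball (0::complex^'n) r" using z by (auto simp: \<rho>_def)
      have "\<exists>B. \<forall>w\<in>cball 0 \<rho>. norm (Dk j k w) \<le> B" for k
      proof -
        have "bounded (Dk j k ` cball 0 \<rho>)"
          by (intro compact_imp_bounded compact_continuous_image compact_cball
              continuous_on_subset[OF holo_fun_continuous_on[OF DH] \<rho>])
        then show ?thesis by (auto simp: bounded_iff)
      qed
      then obtain B where B: "\<And>k w. w \<in> cball 0 \<rho> \<Longrightarrow> norm (Dk j k w) \<le> B k" by metis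
      define M where "M = (\<Sum>k\<in>UNIV. \<bar>B k\<bar>)"
      have "\<forall>k. \<forall>w\<in>cball 0 \<rho>. norm (Dk j k w) \<le> M * (1/2) ^ n" for n
      proof (induction n)
        case 0
        have "B k \<le> M" for k
          using member_le_sum[of k UNIV "\<lambda>k. \<bar>B k\<bar>"] by (simp add: M_def)
        then show ?case using B order_trans by fastforce
      next
        case (Suc n)
        show ?case
        proof (intro allI ballI)
          fix k w assume w: "w \<in> cball (0::complex^'n) \<rho>"
          then have wr: "w \<in> ball 0 r" using \<rho> by blast
          have sw: "s *\<^sub>R w \<in> cball 0 \<rho>" if "s \<in> cbox 0 (1::real)" for s
            using w that mult_right_mono[of "\<bar>s\<bar>" 1 "norm w"] by auto
          let ?h = "\<lambda>w. Dk j k w + (\<Sum>i\<in>UNIV. w $ i * cpartial i (Dk j k) w)"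
          have hH: "holo_fun ?h (ball 0 r)"
            using holo_fun_cpartial[OF open_ball DH[of j k]] DH[of j k]
            unfolding holo_fun_iff by (intro ballI cdiff_intros) blast+
          have "Dk j k w = radint ?h w" by (rule radint_euler[OF DH wr])
          also have "norm \<dots> \<le> M * (1/2) ^ n / 2"
            unfolding radint_def
          proof (rule integral_unit_bound)
            show "continuous_on (cbox 0 1) (\<lambda>s. ?h (s *\<^sub>R w))"
              by (rule ray_continuous[OF holo_fun_continuous_on[OF hH] wr])
            fix s :: real assume s: "s \<in> cbox 0 1"
            show "norm (?h (s *\<^sub>R w)) \<le> M * (1/2) ^ n / 2"
              unfolding E3[OF scaleR_in_ball[OF wr s]]
              by (rule small[OF scaleR_in_ball[OF wr s] scaleR_in_ball[OF wr s]]) (use Suc sw[OF s] in blast)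
          qed
          finally show "norm (Dk j k w) \<le> M * (1/2) ^ Suc n" by simp
        qed
      qed
      then have "norm (Dk j k z) \<le> M * (1/2) ^ n" for n by (simp add: \<rho>_def)
      moreover have "(\<lambda>n. M * (1/2) ^ n) \<longlonglongrightarrow> M * 0"
        by (intro tendsto_mult_left LIMSEQ_power_zero) auto
      ultimately have "norm (Dk j k z) \<le> M * 0" by (intro LIMSEQ_le_const) auto
      then show ?thesis by simp
    qed
    show "\<exists>\<Psi>. (\<forall>k. holo_fun (\<lambda>z. \<Psi> z $ k) (ball 0 r)) \<and> \<Psi> 0 = \<psi> \<and>
      (\<forall>z\<in>ball 0 r. \<forall>i k. cpartial i (\<lambda>z. \<Psi> z $ k) z = (\<Sum>l\<in>UNIV. A i z $ k $ l * \<Psi> z $ l))"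
    proof (intro exI[of _ "\<lambda>z. \<chi> k. L z k"] conjI allI ballI)
      have "T L 0 k = \<psi> $ k" for k by (simp add: T_def)
      then show "(\<chi> k. L 0 k) = \<psi>" using fix_[of 0] r(1) by (simp add: vec_eq_iff)
      show "cpartial i (\<lambda>z. (\<chi> k. L z k) $ k) z = (\<Sum>l\<in>UNIV. A i z $ k $ l * (\<chi> k. L z k) $ l)"
        if "z \<in> ball 0 r" for i k z
        using zero[OF that, of i k] by (simp add: Dk_def)
    qed (use LH in simp)
  qed
qed

section \<open>Directional derivatives and bilinear forms\<close>

definition dd :: "(complex^'n::finite \<Rightarrow> complex) \<Rightarrow> complex^'n \<Rightarrow> complex^'n \<Rightarrow> complex" where
  "dd f z t = (\<Sum>i\<in>UNIV. cpartial i f z * t $ i)"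

definition vd :: "(complex^'n::finite \<Rightarrow> complex^'k::finite) \<Rightarrow> complex^'n \<Rightarrow> complex^'n \<Rightarrow> complex^'k" where
  "vd V z t = (\<chi> k. dd (\<lambda>w. V w $ k) z t)"

text \<open>The coefficients form a function of two indices, so that a metric, one upper index of a
  Christoffel symbol and coordinate derivatives of either all fit.\<close>

definition bil :: "('n \<Rightarrow> 'n \<Rightarrow> complex) \<Rightarrow> complex^'n::finite \<Rightarrow> complex^'n \<Rightarrow> complex" where
  "bil B u v = (\<Sum>i\<in>UNIV. \<Sum>j\<in>UNIV. B i j * u $ i * v $ j)"

lemma vd_nth [simp]: "vd V z t $ k = dd (\<lambda>w. V w $ k) z t"
  by (simp add: vd_def)

lemma axis_nth: "axis i (1::complex) $ j = (if j = i then 1 else 0)"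
  by (simp add: axis_def)

lemma dd_axis [simp]: "dd f z (axis i 1) = cpartial i f z"
  by (simp add: dd_def sum_axis)

lemma dd_linear:
  "dd f z (s + t) = dd f z s + dd f z t" "dd f z (s - t) = dd f z s - dd f z t"
  "dd f z (- t) = - dd f z t" "dd f z (c *s t) = c * dd f z t" "dd f z 0 = 0"
  by (simp_all add: dd_def algebra_simps sum.distrib sum_subtractf sum_negf sum_distrib_left)

lemma dd_const [simp]: "dd (\<lambda>w. c) z t = 0"
  by (simp add: dd_def)

lemma dd_add: "cdiff_at f z \<Longrightarrow> cdiff_at g z \<Longrightarrow> dd (\<lambda>w. f w + g w) z t = dd f z t + dd g z t"
  by (simp add: dd_def cpartial_add algebra_simps sum.distrib)

lemma dd_diff: "cdiff_at f z \<Longrightarrow> cdiff_at g z \<Longrightarrow> dd (\<lambda>w. f w - g w) z t = dd f z t - dd g z t"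
  by (simp add: dd_def cpartial_diff algebra_simps sum_subtractf)

lemma dd_mult: "cdiff_at f z \<Longrightarrow> cdiff_at g z \<Longrightarrow> dd (\<lambda>w. f w * g w) z t = f z * dd g z t + dd f z t * g z"
  by (simp add: dd_def cpartial_mult algebra_simps sum.distrib sum_distrib_left)

lemma dd_sum: "(\<And>k. k \<in> I \<Longrightarrow> cdiff_at (f k) z) \<Longrightarrow> dd (\<lambda>w. \<Sum>k\<in>I. f k w) z t = (\<Sum>k\<in>I. dd (f k) z t)"
  unfolding dd_def by (subst sum.swap) (simp add: cpartial_sum sum_distrib_right)

lemma dd_cong: "open S \<Longrightarrow> z \<in> S \<Longrightarrow> (\<And>w. w \<in> S \<Longrightarrow> f w = g w) \<Longrightarrow> dd f z t = dd g z t"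
  unfolding dd_def by (simp add: cpartial_cong[of S z f g])

lemma dd_compose:
  assumes "\<And>i. cdiff_at (\<lambda>w. F w $ i) z" "cdiff_at f (F z)"
  shows "dd (\<lambda>w. f (F w)) z t = dd f (F z) (vd F z t)"
proof -
  have "dd (\<lambda>w. f (F w)) z t = (\<Sum>j\<in>UNIV. \<Sum>i\<in>UNIV. cpartial i f (F z) * cpartial j (\<lambda>w. F w $ i) z * t $ j)"
    by (simp add: dd_def cpartial_compose[OF assms] sum_distrib_right)
  also have "\<dots> = dd f (F z) (vd F z t)"
    by (subst sum.swap) (simp add: dd_def sum_distrib_left mult.assoc)
  finally show ?thesis .
qed

lemma holo_fun_dd: "open S \<Longrightarrow> holo_fun f S \<Longrightarrow> holo_fun (\<lambda>w. dd f w t) S"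
  unfolding dd_def using holo_fun_cpartial[of S f] unfolding holo_fun_iff
  by (intro ballI cdiff_intros) blast

lemma dd_commute:
  assumes "open S" "holo_fun f S" "z \<in> S"
  shows "dd (\<lambda>w. dd f w t) z s = dd (\<lambda>w. dd f w s) z t"
proof -
  have c: "cdiff_at (cpartial i f) z" for i
    using holo_fun_cpartial[OF assms(1,2)] assms(3) by (rule holo_funD)
  have "dd (\<lambda>w. dd f w t) z s = (\<Sum>i\<in>UNIV. \<Sum>j\<in>UNIV. cpartial j (cpartial i f) z * t $ i * s $ j)" for s t
    by (simp add: dd_def cpartial_sum cdiff_mult c cpartial_mult sum_distrib_right) (rule sum.swap)
  from this[of t s] this[of s t] show ?thesis
    by (subst (asm) (2) sum.swap) (simp add: cpartial_commute[OF assms(1,2,3)] mult_ac)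
qed

lemma bil_linear:
  "bil B (u + u') v = bil B u v + bil B u' v" "bil B u (v + v') = bil B u v + bil B u v'"
  "bil B (u - u') v = bil B u v - bil B u' v" "bil B u (v - v') = bil B u v - bil B u v'"
  "bil B (- u) v = - bil B u v" "bil B u (- v) = - bil B u v"
  "bil B (c *s u) v = c * bil B u v" "bil B u (c *s v) = c * bil B u v"
  "bil B 0 v = 0" "bil B u 0 = 0"
  by (simp_all add: bil_def algebra_simps sum.distrib sum_subtractf sum_negf sum_distrib_left)

lemma bil_axis_left: "bil B (axis i 1) v = (\<Sum>j\<in>UNIV. B i j * v $ j)"
proof -
  have "bil B (axis i 1) v = (\<Sum>k\<in>UNIV. (\<Sum>j\<in>UNIV. B k j * v $ j) * axis i 1 $ k)"
    by (simp add: bil_def sum_distrib_left sum_distrib_right mult_ac)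
  then show ?thesis by (simp only: sum_axis)
qed

lemma bil_axis [simp]: "bil B (axis i 1) (axis j 1) = B i j"
  by (simp only: bil_axis_left sum_axis)

lemma bil_commute: "(\<And>i j. B i j = B j i) \<Longrightarrow> bil B u v = bil B v u"
  unfolding bil_def by (subst sum.swap) (simp add: mult_ac)

lemma bil_form_linear:
  "bil (\<lambda>i j. B i j + B' i j) u v = bil B u v + bil B' u v"
  "bil (\<lambda>i j. B i j - B' i j) u v = bil B u v - bil B' u v"
  "bil (\<lambda>i j. c * B i j) u v = c * bil B u v"
  by (simp_all add: bil_def algebra_simps sum.distrib sum_subtractf sum_distrib_left)

lemma cdiff_bil:
  assumes "\<And>i j. cdiff_at (\<lambda>w. B w i j) z" "\<And>i. cdiff_at (\<lambda>w. V w $ i) z" "\<And>i. cdiff_at (\<lambda>w. W w $ i) z"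
  shows "cdiff_at (\<lambda>w. bil (B w) (V w) (W w)) z"
  unfolding bil_def by (intro cdiff_intros assms)

lemma dd_bil:
  assumes "\<And>i j. cdiff_at (\<lambda>w. B w i j) z" "\<And>i. cdiff_at (\<lambda>w. V w $ i) z" "\<And>i. cdiff_at (\<lambda>w. W w $ i) z"
  shows "dd (\<lambda>w. bil (B w) (V w) (W w)) z t = bil (\<lambda>i j. dd (\<lambda>w. B w i j) z t) (V z) (W z)
    + bil (B z) (vd V z t) (W z) + bil (B z) (V z) (vd W z t)"
  by (simp add: bil_def dd_sum cdiff_sum cdiff_mult assms dd_mult algebra_simps sum.distrib)

lemma dd_bil_const:
  assumes "\<And>i j. cdiff_at (\<lambda>w. B w i j) z"
  shows "dd (\<lambda>w. bil (B w) u v) z t = bil (\<lambda>i j. dd (\<lambda>w. B w i j) z t) u v"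
  using dd_bil[OF assms, of "\<lambda>w. u" "\<lambda>w. v"] by (simp add: vd_def bil_linear flip: zero_vec_def)

text \<open>The bridge from index formulas to multilinear ones: an identity checked on basis vectors
  is freed of them one argument at a time.\<close>

lemma linear_ext:
  fixes f g :: "complex^'n::finite \<Rightarrow> complex"
  assumes "\<And>x y. f (x + y) = f x + f y" "\<And>c x. f (c *s x) = c * f x"
    and "\<And>x y. g (x + y) = g x + g y" "\<And>c x. g (c *s x) = c * g x"
    and "\<And>i. f (axis i 1) = g (axis i 1)"
  shows "f x = g x"
proof -
  have h: "h x = (\<Sum>i\<in>UNIV. x $ i * h (axis i 1))"
    if a: "\<And>x y. h (x + y) = h x + h y" and m: "\<And>c x. h (c *s x) = c * h x" for h :: "complex^'n \<Rightarrow> complex"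
  proof -
    have h0: "h 0 = 0" using m[of 0 0] by simp
    have "h (\<Sum>i\<in>I. x $ i *s axis i 1) = (\<Sum>i\<in>I. x $ i * h (axis i 1))" if "finite I" for I
      using that by (induction I) (auto simp: a m h0)
    from this[of UNIV] show ?thesis by (simp add: basis_expansion)
  qed
  show ?thesis using h[of f, OF assms(1,2)] h[of g, OF assms(3,4)] assms(5) by simp
qed

lemma cdiff_det:
  fixes M :: "complex^'k::finite \<Rightarrow> complex^'n^'n::finite"
  assumes "\<And>i j. cdiff_at (\<lambda>w. M w $ i $ j) z"
  shows "cdiff_at (\<lambda>w. det (M w)) z"
  unfolding det_def by (intro cdiff_intros assms)

lemma matrix_inv_both:
  fixes A :: "complex^'n^'n::finite"
  assumes "det A \<noteq> 0"
  shows "A ** matrix_inv A = mat 1 \<and> matrix_inv A ** A = mat 1"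
  using assms unfolding invertible_det_nz[symmetric] invertible_def matrix_inv_def by (rule someI_ex)

section \<open>Curvature of a holomorphic metric\<close>

locale metric_on =
  fixes G :: "complex^'n::finite \<Rightarrow> complex^'n^'n" and S :: "(complex^'n) set"
  assumes open_S: "open S" and metric: "holo_metric G S"
begin

text \<open>Tensors are contracted with vectors that are constant in the coordinates: \<open>gm\<close> is the metric,
  \<open>Ga\<close> the Christoffel symbol, \<open>g1\<close>, \<open>Ga1\<close>, \<open>Ga2\<close> are their coordinate derivatives, \<open>Rv z u v w\<close> is
  \<open>R(u,v)w\<close>, and the arguments of \<open>Rl\<close> are ordered as the indices of \<^const>\<open>riemann_low\<close>.\<close>

definition "gm z = bil (\<lambda>i j. G z $ i $ j)"
definition "g1 z t = bil (\<lambda>i j. dd (\<lambda>w. G w $ i $ j) z t)"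
definition "Ga z u v = (\<chi> k. bil (\<lambda>i j. christoffel G z $ k $ i $ j) u v)"
definition "Ga1 z t u v = (\<chi> k. bil (\<lambda>i j. dd (\<lambda>w. christoffel G w $ k $ i $ j) z t) u v)"
definition "Ga2 z s t u v = (\<chi> k. bil (\<lambda>i j. dd (\<lambda>w. dd (\<lambda>w. christoffel G w $ k $ i $ j) w t) z s) u v)"
definition "Rv z u v w = Ga1 z u v w - Ga1 z v u w + Ga z u (Ga z v w) - Ga z v (Ga z u w)"
definition "Rl z a b c d = gm z a (Rv z c d b)"

lemma gm_linear:
  "gm z (u + u') v = gm z u v + gm z u' v" "gm z u (v + v') = gm z u v + gm z u v'"
  "gm z (u - u') v = gm z u v - gm z u' v" "gm z u (v - v') = gm z u v - gm z u v'"
  "gm z (- u) v = - gm z u v" "gm z u (- v) = - gm z u v"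
  "gm z (c *s u) v = c * gm z u v" "gm z u (c *s v) = c * gm z u v"
  "gm z 0 v = 0" "gm z u 0 = 0"
  by (simp_all add: gm_def bil_linear)

lemma Ga_linear:
  "Ga z (u + u') v = Ga z u v + Ga z u' v" "Ga z u (v + v') = Ga z u v + Ga z u v'"
  "Ga z (u - u') v = Ga z u v - Ga z u' v" "Ga z u (v - v') = Ga z u v - Ga z u v'"
  "Ga z (- u) v = - Ga z u v" "Ga z u (- v) = - Ga z u v"
  "Ga z (c *s u) v = c *s Ga z u v" "Ga z u (c *s v) = c *s Ga z u v"
  by (simp_all add: Ga_def bil_linear vec_eq_iff)

lemma Ga1_linear:
  "Ga1 z (t + t') u v = Ga1 z t u v + Ga1 z t' u v"
  "Ga1 z t (u + u') v = Ga1 z t u v + Ga1 z t u' v" "Ga1 z t u (v + v') = Ga1 z t u v + Ga1 z t u v'"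
  "Ga1 z (c *s t) u v = c *s Ga1 z t u v"
  "Ga1 z t (c *s u) v = c *s Ga1 z t u v" "Ga1 z t u (c *s v) = c *s Ga1 z t u v"
  by (simp_all add: Ga1_def bil_linear bil_form_linear dd_linear vec_eq_iff)

lemma Rv_linear:
  "Rv z (u + u') v w = Rv z u v w + Rv z u' v w" "Rv z u (v + v') w = Rv z u v w + Rv z u v' w"
  "Rv z u v (w + w') = Rv z u v w + Rv z u v w'"
  "Rv z (c *s u) v w = c *s Rv z u v w" "Rv z u (c *s v) w = c *s Rv z u v w"
  "Rv z u v (c *s w) = c *s Rv z u v w"
  by (simp_all add: Rv_def Ga_linear Ga1_linear vector_add_ldistrib vector_ssub_ldistrib)

lemma Rv_skew: "Rv z u v w = - Rv z v u w"
  by (simp add: Rv_def)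

lemma G_holo: "holo_fun (\<lambda>z. G z $ i $ j) S"
  using metric by (simp add: holo_metric_def)

lemma G_cdiff: "z \<in> S \<Longrightarrow> cdiff_at (\<lambda>z. G z $ i $ j) z"
  by (rule holo_funD[OF G_holo])

lemma G_sym: "z \<in> S \<Longrightarrow> G z $ i $ j = G z $ j $ i"
proof -
  assume "z \<in> S"
  then have "transpose (G z) = G z" using metric by (simp add: holo_metric_def)
  from arg_cong[OF this, of "\<lambda>M. M $ j $ i"] show ?thesis by (simp add: transpose_def)
qed

lemma G_det: "z \<in> S \<Longrightarrow> det (G z) \<noteq> 0"
  using metric by (simp add: holo_metric_def)

lemma G_inv: "z \<in> S \<Longrightarrow> G z ** matrix_inv (G z) = mat 1" "z \<in> S \<Longrightarrow> matrix_inv (G z) ** G z = mat 1"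
  using matrix_inv_both[OF G_det] by blast+

lemma G_inv_sym: "z \<in> S \<Longrightarrow> matrix_inv (G z) $ i $ j = matrix_inv (G z) $ j $ i"
proof -
  assume z: "z \<in> S"
  let ?I = "matrix_inv (G z)"
  have t: "transpose (G z) = G z" using metric z by (simp add: holo_metric_def)
  have "transpose ?I ** G z = mat 1"
    using arg_cong[OF G_inv(1)[OF z], of transpose] by (simp add: matrix_transpose_mul t transpose_mat)
  then have "transpose ?I ** (G z ** ?I) = ?I" by (simp add: matrix_mul_assoc)
  then have "transpose ?I = ?I" by (simp add: G_inv(1)[OF z])
  from arg_cong[OF this, of "\<lambda>M. M $ j $ i"] show ?thesis by (simp add: transpose_def)
qed

text \<open>By Cramer's rule the entries of the inverse are quotients of determinants, hence
  rational in the entries of the metric.\<close>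

lemma inv_holo: "holo_fun (\<lambda>z. matrix_inv (G z) $ k $ l) S"
proof (rule holo_fun_cong[OF open_S])
  fix z assume z: "z \<in> S"
  have "G z *v column l (matrix_inv (G z)) = column l (mat 1)"
  proof -
    have "G z *v column l (matrix_inv (G z)) = column l (G z ** matrix_inv (G z))"
      by (simp add: vec_eq_iff column_def matrix_vector_mult_def matrix_matrix_mult_def)
    then show ?thesis by (simp only: G_inv(1)[OF z])
  qed
  then have "column l (matrix_inv (G z)) =
      (\<chi> k. det (\<chi> i j. if j = k then column l (mat 1) $ i else G z $ i $ j) / det (G z))"
    by (subst (asm) cramer[OF G_det[OF z]])
  then show "det (\<chi> i j. if j = k then column l (mat 1) $ i else G z $ i $ j) / det (G z) = matrix_inv (G z) $ k $ l"
    by (simp add: column_def vec_eq_iff)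
next
  show "holo_fun (\<lambda>z. det (\<chi> i j. if j = k then column l (mat 1) $ i else G z $ i $ j) / det (G z)) S"
  proof -
    have "cdiff_at (\<lambda>w. if j = k then c else G w $ i $ j) z" if "z \<in> S" for z i j c
      using that by (cases "j = k") (auto simp: G_cdiff)
    then show ?thesis
      unfolding holo_fun_iff by (intro ballI cdiff_divide cdiff_det G_det) (auto simp: G_cdiff)
  qed
qed

lemma christoffel_holo: "holo_fun (\<lambda>z. christoffel G z $ k $ i $ j) S"
  using holo_fun_cpartial[OF open_S G_holo] inv_holo
  unfolding christoffel_def vec_lambda_beta holo_fun_iff
  by (intro ballI cdiff_divide cdiff_intros) auto

lemma christoffel_cdiff: "z \<in> S \<Longrightarrow> cdiff_at (\<lambda>z. christoffel G z $ k $ i $ j) z"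
  by (rule holo_funD[OF christoffel_holo])

lemma christoffel_dd_cdiff: "z \<in> S \<Longrightarrow> cdiff_at (\<lambda>z. dd (\<lambda>w. christoffel G w $ k $ i $ j) z t) z"
  by (rule holo_funD[OF holo_fun_dd[OF open_S christoffel_holo]])

lemma cpartial_G_sym: "z \<in> S \<Longrightarrow> cpartial k (\<lambda>w. G w $ i $ j) z = cpartial k (\<lambda>w. G w $ j $ i) z"
  by (rule cpartial_cong[OF open_S]) (auto simp: G_sym)

lemma christoffel_sym: "z \<in> S \<Longrightarrow> christoffel G z $ k $ i $ j = christoffel G z $ k $ j $ i"
  by (simp add: christoffel_def cpartial_G_sym[of z _ i j] algebra_simps)

lemma gm_commute: "z \<in> S \<Longrightarrow> gm z u v = gm z v u"
  unfolding gm_def by (rule bil_commute) (rule G_sym)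

lemma g1_commute: "z \<in> S \<Longrightarrow> g1 z t u v = g1 z t v u"
  unfolding g1_def by (rule bil_commute) (rule dd_cong[OF open_S], auto simp: G_sym)

lemma Ga_commute: "z \<in> S \<Longrightarrow> Ga z u v = Ga z v u"
  unfolding Ga_def by (simp add: vec_eq_iff bil_commute[OF christoffel_sym])

lemma Ga1_commute: "z \<in> S \<Longrightarrow> Ga1 z t u v = Ga1 z t v u"
proof -
  assume z: "z \<in> S"
  have "bil (\<lambda>i j. dd (\<lambda>w. christoffel G w $ k $ i $ j) z t) u v
      = bil (\<lambda>i j. dd (\<lambda>w. christoffel G w $ k $ i $ j) z t) v u" for k
    by (rule bil_commute, rule dd_cong[OF open_S z]) (rule christoffel_sym)
  then show ?thesis by (simp add: Ga1_def)
qed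

lemma Ga2_commute1: "z \<in> S \<Longrightarrow> Ga2 z s t u v = Ga2 z t s u v"
  by (simp add: Ga2_def dd_commute[OF open_S christoffel_holo, of z _ _ _ t s])

section \<open>The Levi-Civita connection: Koszul formula and compatibility with the metric\<close>

lemma koszul_index:
  assumes "z \<in> S"
  shows "(\<Sum>k\<in>UNIV. G z $ m $ k * christoffel G z $ k $ i $ j) =
    (cpartial i (\<lambda>w. G w $ j $ m) z + cpartial j (\<lambda>w. G w $ i $ m) z - cpartial m (\<lambda>w. G w $ i $ j) z) / 2"
proof -
  let ?b = "\<lambda>l. cpartial i (\<lambda>w. G w $ j $ l) z + cpartial j (\<lambda>w. G w $ i $ l) z - cpartial l (\<lambda>w. G w $ i $ j) z"
  have "(\<Sum>k\<in>UNIV. G z $ m $ k * christoffel G z $ k $ i $ j)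
      = (\<Sum>k\<in>UNIV. \<Sum>l\<in>UNIV. G z $ m $ k * matrix_inv (G z) $ k $ l * ?b l) / 2"
    by (simp add: christoffel_def sum_divide_distrib sum_distrib_left mult.assoc)
  also have "\<dots> = (\<Sum>l\<in>UNIV. (\<Sum>k\<in>UNIV. G z $ m $ k * matrix_inv (G z) $ k $ l) * ?b l) / 2"
    by (subst sum.swap) (simp add: sum_distrib_right)
  finally have *: "(\<Sum>k\<in>UNIV. G z $ m $ k * christoffel G z $ k $ i $ j) =
      (\<Sum>l\<in>UNIV. (\<Sum>k\<in>UNIV. G z $ m $ k * matrix_inv (G z) $ k $ l) * ?b l) / 2" .
  have "(\<Sum>k\<in>UNIV. G z $ m $ k * matrix_inv (G z) $ k $ l) = (if m = l then 1 else 0)" for l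
    using arg_cong[OF G_inv(1)[OF assms], of "\<lambda>M. M $ m $ l"] by (simp add: matrix_matrix_mult_def mat_def)
  with * show ?thesis by (simp add: if_distrib[of "\<lambda>x. x * _"] cong: if_cong)
qed

text \<open>The Koszul formula for constant coordinate fields, whose brackets vanish. Lowering the
  index cancels the inverse metric in \<open>christoffel\<close>; the three vector arguments are
  then freed in turn by \<open>linear_ext\<close>.\<close>

lemma koszul:
  assumes z: "z \<in> S"
  shows "gm z w (Ga z u v) = (g1 z u v w + g1 z v u w - g1 z w u v) / 2"
proof -
  have 1: "gm z (axis m 1) (Ga z (axis i 1) (axis j 1)) =
      (g1 z (axis i 1) (axis j 1) (axis m 1) + g1 z (axis j 1) (axis i 1) (axis m 1) - g1 z (axis m 1) (axis i 1) (axis j 1)) / 2"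
    for i j m
    using koszul_index[OF z, of m i j] by (simp add: gm_def g1_def Ga_def bil_axis_left[of _ m])
  note lin = gm_linear Ga_linear g1_def bil_linear bil_form_linear dd_linear
  have 2: "gm z (axis m 1) (Ga z (axis i 1) v) =
      (g1 z (axis i 1) v (axis m 1) + g1 z v (axis i 1) (axis m 1) - g1 z (axis m 1) (axis i 1) v) / 2" for i m v
    by (rule linear_ext[where f="\<lambda>v. gm z (axis m 1) (Ga z (axis i 1) v)"], simp_all only: 1)
       (simp_all add: lin algebra_simps add_divide_distrib diff_divide_distrib)
  have 3: "gm z (axis m 1) (Ga z u v) =
      (g1 z u v (axis m 1) + g1 z v u (axis m 1) - g1 z (axis m 1) u v) / 2" for m
    by (rule linear_ext[where f="\<lambda>u. gm z (axis m 1) (Ga z u v)"], simp_all only: 2)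
       (simp_all add: lin algebra_simps add_divide_distrib diff_divide_distrib)
  show ?thesis
    by (rule linear_ext[where f="\<lambda>w. gm z w (Ga z u v)"], simp_all only: 3)
       (simp_all add: lin algebra_simps add_divide_distrib diff_divide_distrib)
qed

text \<open>The two Koszul formulas are added; the symmetry of \<open>g1\<close> in its last two
  arguments cancels everything but the derivative in direction \<open>t\<close>.\<close>

lemma compat:
  assumes z: "z \<in> S"
  shows "g1 z t u v = gm z (Ga z t u) v + gm z u (Ga z t v)"
  unfolding gm_commute[OF z, of "Ga z t u" v] koszul[OF z] g1_commute[OF z, of t v u]
  by (simp add: field_simps)

lemma dd_gm:
  assumes "z \<in> S" "\<And>i. cdiff_at (\<lambda>w. V w $ i) z" "\<And>i. cdiff_at (\<lambda>w. W w $ i) z"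
  shows "dd (\<lambda>w. gm w (V w) (W w)) z t = g1 z t (V z) (W z) + gm z (vd V z t) (W z) + gm z (V z) (vd W z t)"
  unfolding gm_def g1_def by (rule dd_bil) (auto simp: assms G_cdiff)

lemma Ga_cdiff:
  assumes "z \<in> S" "\<And>i. cdiff_at (\<lambda>w. V w $ i) z" "\<And>i. cdiff_at (\<lambda>w. W w $ i) z"
  shows "cdiff_at (\<lambda>w. Ga w (V w) (W w) $ i) z"
  unfolding Ga_def vec_lambda_beta by (rule cdiff_bil) (auto simp: assms christoffel_cdiff)

lemma Ga1_cdiff: "z \<in> S \<Longrightarrow> cdiff_at (\<lambda>w. Ga1 w t u v $ i) z"
  unfolding Ga1_def vec_lambda_beta by (rule cdiff_bil) (auto simp: christoffel_dd_cdiff)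

lemma vd_Ga:
  assumes "z \<in> S" "\<And>i. cdiff_at (\<lambda>w. V w $ i) z" "\<And>i. cdiff_at (\<lambda>w. W w $ i) z"
  shows "vd (\<lambda>w. Ga w (V w) (W w)) z t = Ga1 z t (V z) (W z) + Ga z (vd V z t) (W z) + Ga z (V z) (vd W z t)"
  unfolding vec_eq_iff Ga_def Ga1_def vd_nth vec_lambda_beta vector_add_component
  by (intro allI dd_bil) (auto simp: assms christoffel_cdiff)

lemma vd_const [simp]: "vd (\<lambda>w. u) z t = 0"
  by (simp add: vec_eq_iff)

lemma Ga_zero [simp]: "Ga z 0 v = 0" "Ga z u 0 = 0"
  by (simp_all add: Ga_def bil_linear vec_eq_iff)

lemma vd_Ga_const: "z \<in> S \<Longrightarrow> vd (\<lambda>w. Ga w u v) z t = Ga1 z t u v"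
  using vd_Ga[of z "\<lambda>w. u" "\<lambda>w. v"] by simp

lemma vd_Ga1: "z \<in> S \<Longrightarrow> vd (\<lambda>w. Ga1 w t u v) z s = Ga2 z s t u v"
  unfolding vec_eq_iff Ga1_def Ga2_def vd_nth vec_lambda_beta
  by (intro allI dd_bil_const) (rule christoffel_dd_cdiff)

section \<open>Symmetries of the curvature tensor\<close>

lemma Rv_metric_skew:
  assumes z: "z \<in> S"
  shows "gm z (Rv z s t u) v = - gm z u (Rv z s t v)"
proof -
  define f where "f = (\<lambda>w. gm w u v)"
  have fh: "holo_fun f S"
    unfolding holo_fun_iff f_def gm_def by (intro ballI cdiff_bil) (auto simp: G_cdiff)
  have f1: "dd f w t = gm w (Ga w t u) v + gm w u (Ga w t v)" if "w \<in> S" for w t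
    unfolding f_def using dd_gm[OF that, of "\<lambda>w. u" "\<lambda>w. v" t] compat[OF that] by (simp add: gm_linear)
  have f2: "dd (\<lambda>w. dd f w t) z s =
      (gm z (Ga z s (Ga z t u)) v + gm z (Ga z t u) (Ga z s v) + gm z (Ga1 z s t u) v) +
      (gm z (Ga z s u) (Ga z t v) + gm z u (Ga z s (Ga z t v)) + gm z u (Ga1 z s t v))" for s t
  proof -
    have c: "cdiff_at (\<lambda>w. Ga w a b $ i) z" for a b i by (rule Ga_cdiff[OF z]) auto
    have cg: "cdiff_at (\<lambda>w. gm w (V w) (W w)) z"
      if "\<And>i. cdiff_at (\<lambda>w. V w $ i) z" "\<And>i. cdiff_at (\<lambda>w. W w $ i) z" for V W
      unfolding gm_def by (rule cdiff_bil) (auto simp: that G_cdiff z)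
    have "dd (\<lambda>w. dd f w t) z s = dd (\<lambda>w. gm w (Ga w t u) v + gm w u (Ga w t v)) z s"
      by (rule dd_cong[OF open_S z f1])
    also have "\<dots> = dd (\<lambda>w. gm w (Ga w t u) v) z s + dd (\<lambda>w. gm w u (Ga w t v)) z s"
      by (intro dd_add cg c cdiff_const)
    finally show ?thesis
      by (simp add: dd_gm[OF z] c vd_Ga_const[OF z] compat[OF z] gm_linear)
  qed
  have "dd (\<lambda>w. dd f w t) z s = dd (\<lambda>w. dd f w s) z t" by (rule dd_commute[OF open_S fh z])
  then show ?thesis
    unfolding f2 Rv_def gm_linear by (simp add: algebra_simps)
qed

text \<open>Without torsion, \<open>Ga\<close> and \<open>Ga1\<close> are symmetric in their last
  two arguments, and all terms of the cyclic sum cancel in pairs.\<close>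

lemma Rv_cyclic:
  assumes z: "z \<in> S"
  shows "Rv z u v w + Rv z v w u + Rv z w u v = 0"
  by (simp add: Rv_def Ga_commute[OF z] Ga1_commute[OF z])

lemma Rl_skew:
  assumes z: "z \<in> S"
  shows "Rl z b a c d = - Rl z a b c d" and "Rl z a b d c = - Rl z a b c d"
  using Rv_metric_skew[OF z, of c d b a] gm_commute[OF z, of "Rv z c d b" a] Rv_skew[of z d c b]
  by (simp_all add: Rl_def gm_linear)

lemma Rl_cyclic: "z \<in> S \<Longrightarrow> Rl z a b c d + Rl z a c d b + Rl z a d b c = 0"
  using Rv_cyclic[of z c d b] by (simp add: Rl_def flip: gm_linear) (simp add: algebra_simps gm_linear)

text \<open>The classical octahedron argument: four instances of the first Bianchi identity,
  combined by means of skewness in each pair.\<close>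

lemma Rl_pair:
  assumes z: "z \<in> S"
  shows "Rl z a b c d = Rl z c d a b"
proof -
  show ?thesis
    using Rl_cyclic[OF z, of a b c d] Rl_cyclic[OF z, of b c d a] Rl_cyclic[OF z, of c d a b] Rl_cyclic[OF z, of d a b c]
      Rl_skew(1)[OF z, of a b c d] Rl_skew(1)[OF z, of a c d b] Rl_skew(1)[OF z, of a d b c]
      Rl_skew(1)[OF z, of b c d a] Rl_skew(1)[OF z, of b d a c] Rl_skew(1)[OF z, of c d a b]
      Rl_skew(2)[OF z, of a b c d] Rl_skew(2)[OF z, of b a c d] Rl_skew(2)[OF z, of c d a b] Rl_skew(2)[OF z, of d c a b]
      Rl_skew(2)[OF z, of a c b d] Rl_skew(2)[OF z, of c a b d] Rl_skew(2)[OF z, of b d a c] Rl_skew(2)[OF z, of d b a c]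
      Rl_skew(2)[OF z, of a d b c] Rl_skew(2)[OF z, of d a b c] Rl_skew(2)[OF z, of b c a d] Rl_skew(2)[OF z, of c b a d]
    by algebra
qed

text \<open>The covariant derivative of the curvature in direction \<open>t\<close> on constant
  vectors, whose own covariant derivatives are the \<open>Ga\<close> terms.\<close>

definition "DR z t a b c d = dd (\<lambda>w. Rl w a b c d) z t - Rl z (Ga z t a) b c d - Rl z a (Ga z t b) c d
  - Rl z a b (Ga z t c) d - Rl z a b c (Ga z t d)"

lemma vd_Rv:
  assumes z: "z \<in> S"
  shows "vd (\<lambda>w. Rv w u v x) z t = Ga2 z t u v x - Ga2 z t v u x
    + Ga1 z t u (Ga z v x) + Ga z u (Ga1 z t v x) - Ga1 z t v (Ga z u x) - Ga z v (Ga1 z t u x)"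
    and Rv_cdiff: "cdiff_at (\<lambda>w. Rv w u v x $ i) z"
proof -
  have c: "cdiff_at (\<lambda>w. Ga w a b $ i) z" for a b i by (rule Ga_cdiff[OF z]) auto
  have cc: "cdiff_at (\<lambda>w. Ga w a (Ga w b d) $ i) z" for a b d i by (rule Ga_cdiff[OF z cdiff_const c])
  note c1 = Ga1_cdiff[OF z]
  show "cdiff_at (\<lambda>w. Rv w u v x $ i) z"
    unfolding Rv_def vector_add_component vector_minus_component by (intro cdiff_intros c cc c1)
  have v: "vd (\<lambda>w. Ga w a (Ga w b d)) z t = Ga1 z t a (Ga z b d) + Ga z a (Ga1 z t b d)" for a b d
    using vd_Ga[OF z cdiff_const c, of a b d t] by (simp add: vd_Ga_const[OF z])
  have "vd (\<lambda>w. Rv w u v x) z t = vd (\<lambda>w. Ga1 w u v x) z t - vd (\<lambda>w. Ga1 w v u x) z t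
     + vd (\<lambda>w. Ga w u (Ga w v x)) z t - vd (\<lambda>w. Ga w v (Ga w u x)) z t"
    by (simp add: vec_eq_iff Rv_def dd_add dd_diff cdiff_add cdiff_diff c cc c1)
  then show "vd (\<lambda>w. Rv w u v x) z t = Ga2 z t u v x - Ga2 z t v u x
    + Ga1 z t u (Ga z v x) + Ga z u (Ga1 z t v x) - Ga1 z t v (Ga z u x) - Ga z v (Ga1 z t u x)"
    by (simp add: vd_Ga1[OF z] v)
qed

lemma Rl_cdiff: "z \<in> S \<Longrightarrow> cdiff_at (\<lambda>w. Rl w a b c d) z"
  unfolding Rl_def gm_def by (rule cdiff_bil) (auto simp: G_cdiff Rv_cdiff)

text \<open>By \<open>compat\<close> the covariant derivative commutes with lowering the first
  index, so the cyclic sum can be taken for the vector-valued curvature. There the second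
  derivatives of the Christoffel symbols cancel because \<open>Ga2\<close> is symmetric in its two
  directions, and the lower terms cancel by the symmetry of \<open>Ga\<close>.\<close>

lemma bianchi2:
  assumes z: "z \<in> S"
  shows "DR z t a b c d + DR z c a b d t + DR z d a b t c = 0"
proof -
  have D: "DR z t a b c d = gm z a (vd (\<lambda>w. Rv w c d b) z t + Ga z t (Rv z c d b) - Rv z c d (Ga z t b)
      - Rv z (Ga z t c) d b - Rv z c (Ga z t d) b)" for t c d
    using dd_gm[OF z, of "\<lambda>w. a" "\<lambda>w. Rv w c d b" t] compat[OF z, of t a "Rv z c d b"]
    by (simp add: DR_def Rl_def Rv_cdiff[OF z] gm_linear)
  have "(vd (\<lambda>w. Rv w c d b) z t + Ga z t (Rv z c d b) - Rv z c d (Ga z t b)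
      - Rv z (Ga z t c) d b - Rv z c (Ga z t d) b) +
     (vd (\<lambda>w. Rv w d t b) z c + Ga z c (Rv z d t b) - Rv z d t (Ga z c b)
      - Rv z (Ga z c d) t b - Rv z d (Ga z c t) b) +
     (vd (\<lambda>w. Rv w t c b) z d + Ga z d (Rv z t c b) - Rv z t c (Ga z d b)
      - Rv z (Ga z d t) c b - Rv z t (Ga z d c) b) = 0"
    unfolding vd_Rv[OF z] Rv_skew[of z d "Ga z c t"] Rv_skew[of z t "Ga z d c"] Rv_skew[of z c "Ga z t d"]
      Ga_commute[OF z, of c t] Ga_commute[OF z, of d c] Ga_commute[OF z, of t d]
      Ga2_commute1[OF z, of c t] Ga2_commute1[OF z, of d c] Ga2_commute1[OF z, of t d]
    by (simp add: Rv_def Ga_linear)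
  then show ?thesis unfolding D gm_linear(2)[symmetric] by (simp add: gm_linear)
qed

lemma Rv_axis: "Rv z (axis k 1) (axis l 1) (axis j 1) $ i = riemann G z i j k l"
  by (simp add: Rv_def Ga1_def Ga_def riemann_def bil_axis_left[of _ k] bil_axis_left[of _ l] sum_subtractf)

lemma Rl_axis: "Rl z (axis i 1) (axis j 1) (axis k 1) (axis l 1) = riemann_low G z i j k l"
  by (simp add: Rl_def gm_def bil_axis_left Rv_axis riemann_low_def)

lemma riemann_of_low:
  assumes z: "z \<in> S"
  shows "riemann G z m j k l = (\<Sum>i\<in>UNIV. matrix_inv (G z) $ m $ i * riemann_low G z i j k l)"
proof -
  have "(\<Sum>i\<in>UNIV. matrix_inv (G z) $ m $ i * riemann_low G z i j k l)
      = (\<Sum>p\<in>UNIV. (\<Sum>i\<in>UNIV. matrix_inv (G z) $ m $ i * G z $ i $ p) * riemann G z p j k l)"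
    unfolding riemann_low_def sum_distrib_left sum_distrib_right by (subst sum.swap) (simp add: mult.assoc)
  moreover have "(\<Sum>i\<in>UNIV. matrix_inv (G z) $ m $ i * G z $ i $ p) = (if m = p then 1 else 0)" for p
    using arg_cong[OF G_inv(2)[OF z], of "\<lambda>M. M $ m $ p"] by (simp add: matrix_matrix_mult_def mat_def)
  ultimately show ?thesis by (simp add: if_distrib[of "\<lambda>x. x * _"] cong: if_cong)
qed

text \<open>Pair symmetry of the curvature and symmetry of the inverse metric exchange the free
  indices, up to renaming the summation indices.\<close>

lemma ricci_sym:
  assumes z: "z \<in> S"
  shows "ricci G z j l = ricci G z l j"
proof -
  have *: "ricci G z j l = (\<Sum>k\<in>UNIV. \<Sum>i\<in>UNIV. matrix_inv (G z) $ k $ i * riemann_low G z i j k l)" for j l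
    by (simp add: ricci_def riemann_of_low[OF z])
  have "ricci G z j l = (\<Sum>k\<in>UNIV. \<Sum>i\<in>UNIV. matrix_inv (G z) $ i $ k * riemann_low G z k l i j)"
    unfolding * by (intro sum.cong refl arg_cong2[of _ _ _ _ "(*)"] G_inv_sym[OF z])
      (simp flip: Rl_axis add: Rl_pair[OF z, of _ "axis j 1" _ "axis l 1"])
  also have "\<dots> = ricci G z l j" unfolding * by (rule sum.swap)
  finally show ?thesis .
qed

lemma Rv_holo: "holo_fun (\<lambda>w. Rv w u v x $ i) S"
  by (simp add: holo_fun_iff Rv_cdiff)

lemma riemann_holo: "holo_fun (\<lambda>w. riemann G w i j k l) S"
  using Rv_holo by (simp flip: Rv_axis)

lemma ricci_holo: "holo_fun (\<lambda>w. ricci G w i j) S"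
  using riemann_holo unfolding holo_fun_iff ricci_def by (intro ballI cdiff_sum) blast

lemma scalar_curv_holo: "holo_fun (scalar_curv G) S"
  using ricci_holo inv_holo unfolding holo_fun_iff scalar_curv_def[abs_def] by (intro ballI cdiff_sum cdiff_mult) blast+

end

section \<open>Weyl tensor in dimension four and beta-surfaces\<close>

locale metric4 = metric_on G S for G :: "complex^4 \<Rightarrow> complex^4^4" and S
begin

text \<open>The general formula (Ric - s g / (2 (n - 1))) / (n - 2) at n = 4, with s the scalar
  curvature.\<close>

definition "schouten z i j = ricci G z i j / 2 - scalar_curv G z / 12 * G z $ i $ j"
definition "Pl z = bil (schouten z)"
text \<open>The Kulkarni-Nomizu product of the metric and the Schouten tensor, that is, the part of
  the curvature determined by the Ricci tensor.\<close>

definition "Ql z a b c d = gm z a c * Pl z b d - gm z a d * Pl z b c - gm z b c * Pl z a d + gm z b d * Pl z a c"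
definition "Wl z a b c d = Rl z a b c d - Ql z a b c d"
definition "DP z t b d = dd (\<lambda>w. Pl w b d) z t - Pl z (Ga z t b) d - Pl z b (Ga z t d)"

lemma Pl_linear:
  "Pl z (u + u') v = Pl z u v + Pl z u' v" "Pl z u (v + v') = Pl z u v + Pl z u v'"
  "Pl z (c *s u) v = c * Pl z u v" "Pl z u (c *s v) = c * Pl z u v"
  by (simp_all add: Pl_def bil_linear)

lemma Wl_linear:
  "Wl z (a + a') b c d = Wl z a b c d + Wl z a' b c d" "Wl z a (b + b') c d = Wl z a b c d + Wl z a b' c d"
  "Wl z a b (c + c') d = Wl z a b c d + Wl z a b c' d" "Wl z a b c (d + d') = Wl z a b c d + Wl z a b c d'"
  "Wl z (k *s a) b c d = k * Wl z a b c d" "Wl z a (k *s b) c d = k * Wl z a b c d"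
  "Wl z a b (k *s c) d = k * Wl z a b c d" "Wl z a b c (k *s d) = k * Wl z a b c d"
  by (simp_all add: Wl_def Rl_def Ql_def gm_linear Rv_linear Pl_linear algebra_simps)

text \<open>The four scalar curvature terms of \<open>Ql\<close>, each with coefficient 1/12,
  coincide in pairs; this is the 1/6 in \<open>weyl_low\<close>.\<close>

lemma Wl_axis: "Wl z (axis i 1) (axis j 1) (axis k 1) (axis l 1) = weyl_low G z i j k l"
  unfolding Wl_def Rl_axis weyl_low_def
  by (simp add: Ql_def gm_def Pl_def schouten_def) (simp add: field_simps)

lemma Pl_commute: "z \<in> S \<Longrightarrow> Pl z u v = Pl z v u"
  unfolding Pl_def by (rule bil_commute) (simp add: schouten_def ricci_sym G_sym[of z])

lemma Wl_pair: "z \<in> S \<Longrightarrow> Wl z a b c d = Wl z c d a b"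
  by (simp add: Wl_def Ql_def Rl_pair[of z a b c d] gm_commute[of z c a] gm_commute[of z c b] gm_commute[of z d a]
      gm_commute[of z d b] Pl_commute[of z c a] Pl_commute[of z c b] Pl_commute[of z d a] Pl_commute[of z d b])

lemma Wl_skew: "z \<in> S \<Longrightarrow> Wl z b a c d = - Wl z a b c d"
  using Rl_skew(1)[of z b a c d] by (simp add: Wl_def Ql_def)

lemma Wl_same: "z \<in> S \<Longrightarrow> Wl z a a c d = 0"
  using Wl_skew[of z a a c d] by simp

lemma schouten_cdiff: "z \<in> S \<Longrightarrow> cdiff_at (\<lambda>w. schouten w i j) z"
  using ricci_holo scalar_curv_holo G_holo unfolding schouten_def holo_fun_iff
  by (intro cdiff_diff cdiff_divide cdiff_mult) auto

lemma Pl_cdiff: "z \<in> S \<Longrightarrow> cdiff_at (\<lambda>w. Pl w u v) z"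
  unfolding Pl_def by (rule cdiff_bil) (auto simp: schouten_cdiff)

lemma gm_cdiff: "z \<in> S \<Longrightarrow> cdiff_at (\<lambda>w. gm w u v) z"
  unfolding gm_def by (rule cdiff_bil) (auto simp: G_cdiff)

lemma Ql_cdiff: "z \<in> S \<Longrightarrow> cdiff_at (\<lambda>w. Ql w a b c d) z"
  unfolding Ql_def by (intro cdiff_intros Pl_cdiff gm_cdiff)

lemma Wl_cdiff: "z \<in> S \<Longrightarrow> cdiff_at (\<lambda>w. Wl w a b c d) z"
  unfolding Wl_def by (intro cdiff_intros Rl_cdiff Ql_cdiff)

definition "DW z t a b c d = dd (\<lambda>w. Wl w a b c d) z t - Wl z (Ga z t a) b c d - Wl z a (Ga z t b) c d
  - Wl z a b (Ga z t c) d - Wl z a b c (Ga z t d)"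

lemma dd_gm_const: "z \<in> S \<Longrightarrow> dd (\<lambda>w. gm w u v) z t = gm z (Ga z t u) v + gm z u (Ga z t v)"
  using dd_gm[of z "\<lambda>w. u" "\<lambda>w. v" t] compat[of z t u v] by (simp add: gm_linear)

text \<open>The metric is parallel, so in the Kulkarni-Nomizu product the covariant derivative acts
  on the Schouten factor alone.\<close>

lemma DR_split:
  assumes z: "z \<in> S"
  shows "DR z t a b c d = DW z t a b c d + (gm z a c * DP z t b d - gm z a d * DP z t b c
    - gm z b c * DP z t a d + gm z b d * DP z t a c)"
proof -
  have R: "Rl w a b c d = Wl w a b c d + Ql w a b c d" for w a b c d by (simp add: Wl_def)
  have Q: "dd (\<lambda>w. Ql w a b c d) z t =
      (gm z a c * dd (\<lambda>w. Pl w b d) z t + (gm z (Ga z t a) c + gm z a (Ga z t c)) * Pl z b d)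
      - (gm z a d * dd (\<lambda>w. Pl w b c) z t + (gm z (Ga z t a) d + gm z a (Ga z t d)) * Pl z b c)
      - (gm z b c * dd (\<lambda>w. Pl w a d) z t + (gm z (Ga z t b) c + gm z b (Ga z t c)) * Pl z a d)
      + (gm z b d * dd (\<lambda>w. Pl w a c) z t + (gm z (Ga z t b) d + gm z b (Ga z t d)) * Pl z a c)"
    unfolding Ql_def
    by (simp add: dd_add dd_diff dd_mult cdiff_add cdiff_diff cdiff_mult Pl_cdiff[OF z] gm_cdiff[OF z] dd_gm_const[OF z])
  have "dd (\<lambda>w. Rl w a b c d) z t = dd (\<lambda>w. Wl w a b c d) z t + dd (\<lambda>w. Ql w a b c d) z t"
    unfolding R by (intro dd_add Wl_cdiff[OF z] Ql_cdiff[OF z])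
  then show ?thesis
    unfolding DR_def DW_def DP_def R Q by (simp add: Ql_def algebra_simps)
qed

lemma gm_nondegenerate:
  assumes z: "z \<in> S" and 0: "\<And>u. gm z v u = 0"
  shows "v = 0"
proof -
  have "G z *v v = 0"
  proof -
    have "(G z *v v) $ i = gm z (axis i 1) v" for i
      by (simp add: gm_def bil_axis_left matrix_vector_mult_def)
    moreover have "gm z (axis i 1) v = 0" for i
      using 0[of "axis i 1"] gm_commute[OF z, of v "axis i 1"] by simp
    ultimately show ?thesis by (simp add: vec_eq_iff)
  qed
  have "v = (matrix_inv (G z) ** G z) *v v" by (simp add: G_inv(2)[OF z])
  also have "\<dots> = matrix_inv (G z) *v (G z *v v)" by (rule matrix_vector_mul_assoc[symmetric])
  also have "\<dots> = 0" unfolding \<open>G z *v v = 0\<close> by (rule matrix_vector_mult_0_right)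
  finally show ?thesis .
qed

text \<open>Exposes the first pair of arguments as a bilinear form, so that the Weyl tensor can be
  differentiated along a surface on which these arguments vary.\<close>

lemma Wl_bil: "Wl z a b c d = bil (\<lambda>i j. Wl z (axis i 1) (axis j 1) c d) a b"
proof -
  have "Wl z (axis i 1) b c d = bil (\<lambda>i j. Wl z (axis i 1) (axis j 1) c d) (axis i 1) b" for i
    by (rule linear_ext[where f="\<lambda>b. Wl z (axis i 1) b c d" and x=b and
        g="\<lambda>b. bil (\<lambda>i j. Wl z (axis i 1) (axis j 1) c d) (axis i 1) b"])
      (simp_all only: Wl_linear bil_linear bil_axis)
  then show ?thesis
    by (intro linear_ext[where f="\<lambda>a. Wl z a b c d" and x=a and
        g="\<lambda>a. bil (\<lambda>i j. Wl z (axis i 1) (axis j 1) c d) a b"])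
      (simp_all only: Wl_linear bil_linear)
qed

end

section \<open>Null surfaces in coordinates: Cotton identity and Gauss equation\<close>

locale surface_patch = metric4 +
  fixes F :: "complex^2 \<Rightarrow> complex^4" and D :: "(complex^2) set" and \<gamma> :: "complex^2 \<Rightarrow> complex^2^2^2"
  assumes open_D: "open D" and F_holo: "holo_map F D" and F_D: "F ` D \<subseteq> S"
begin

definition "X i z = (\<chi> k. cpartial i (\<lambda>w. F w $ k) z)"

end

text \<open>In \<open>trans\<close> the coordinate fields are frozen at \<open>z\<close> while the
  base point moves in any ambient direction; this is the only assumption on the Weyl tensor off the
  surface. In \<open>W0\<close> one pair of arguments is arbitrary.\<close>

locale beta_patch = surface_patch +
  assumes null: "\<And>z i j. z \<in> D \<Longrightarrow> gm (F z) (X i z) (X j z) = 0"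
    and W0: "\<And>z a b. z \<in> D \<Longrightarrow> Wl (F z) a b (X 1 z) (X 2 z) = 0"
    and trans: "\<And>z t. z \<in> D \<Longrightarrow> dd (\<lambda>w. Wl w (X 1 z) (X 2 z) (X 1 z) (X 2 z)) (F z) t = 0"
    and indep: "\<And>z a b. z \<in> D \<Longrightarrow> a *s X 1 z + b *s X 2 z = 0 \<Longrightarrow> a = 0 \<and> b = 0"
    and geod: "\<And>z i j. z \<in> D \<Longrightarrow> cov_coord G F z i j = (\<Sum>k\<in>UNIV. \<gamma> z $ k $ i $ j *s X k z)"
    and \<gamma>_holo: "\<And>k i j. holo_fun (\<lambda>z. \<gamma> z $ k $ i $ j) D"
    and \<gamma>_sym: "\<And>z k i j. z \<in> D \<Longrightarrow> \<gamma> z $ k $ i $ j = \<gamma> z $ k $ j $ i"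
begin

text \<open>The ambient covariant derivative of the j-th coordinate field along the i-th; total
  geodesy makes it tangent to the surface (\<open>N_span\<close>).\<close>

definition "N i j z = vd (X j) z (axis i 1) + Ga (F z) (X i z) (X j z)"
definition "p i j z = Pl (F z) (X i z) (X j z)"

lemma F_cdiff: "z \<in> D \<Longrightarrow> cdiff_at (\<lambda>w. F w $ k) z"
  using F_holo by (auto simp: holo_map_def dest: holo_funD)

lemma F_S: "z \<in> D \<Longrightarrow> F z \<in> S"
  using F_D by blast

lemma vd_F: "vd F z (axis i 1) = X i z"
  by (simp add: vec_eq_iff X_def)

lemma X_holo: "holo_fun (\<lambda>w. X i w $ k) D"
  using holo_fun_cpartial[OF open_D, of "\<lambda>w. F w $ k" i] F_holo by (simp add: X_def holo_map_def)

lemma X_cdiff: "z \<in> D \<Longrightarrow> cdiff_at (\<lambda>w. X i w $ k) z"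
  by (rule holo_funD[OF X_holo])

lemma N_cov: "N i j z = cov_coord G F z i j"
  by (simp add: vec_eq_iff N_def cov_coord_def X_def Ga_def bil_def jac_def)

lemma N_span: "z \<in> D \<Longrightarrow> N i j z = \<gamma> z $ 1 $ i $ j *s X 1 z + \<gamma> z $ 2 $ i $ j *s X 2 z"
  by (simp add: N_cov geod sum_2)

lemma dd_bil_F:
  assumes z: "z \<in> D" and B: "\<And>i j. cdiff_at (\<lambda>w. B w i j) (F z)"
    and V: "\<And>i. cdiff_at (\<lambda>w. V w $ i) z" "\<And>i. cdiff_at (\<lambda>w. W w $ i) z"
  shows "dd (\<lambda>w. bil (B (F w)) (V w) (W w)) z t = dd (\<lambda>x. bil (B x) (V z) (W z)) (F z) (vd F z t)
    + bil (B (F z)) (vd V z t) (W z) + bil (B (F z)) (V z) (vd W z t)"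
proof -
  have "dd (\<lambda>w. B (F w) i j) z t = dd (\<lambda>x. B x i j) (F z) (vd F z t)" for i j
    by (rule dd_compose[OF F_cdiff[OF z] B])
  then show ?thesis
    using dd_bil[of "\<lambda>w. B (F w)" z V W t, OF cdiff_compose[OF F_cdiff[OF z] B] V]
    by (simp add: dd_bil_const[OF B])
qed

text \<open>The identity W(X1, X2, c, d) = 0 is differentiated along the surface. The covariant
  derivatives of X1 and X2 are combinations of X1 and X2, so the correction terms are again
  multiples of W(X1, X2, c, d) or vanish by skewness.\<close>

lemma DW_tangent:
  assumes z: "z \<in> D"
  shows "DW (F z) (X i z) (X 1 z) (X 2 z) c d = 0"
proof -
  note FS = F_S[OF z]
  have W12: "Wl (F w) (X 1 w) (X 2 w) c d = 0" if "w \<in> D" for w c d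
    using W0[OF that] Wl_pair[OF F_S[OF that]] by metis
  have "dd (\<lambda>w. bil (\<lambda>i j. Wl (F w) (axis i 1) (axis j 1) c d) (X 1 w) (X 2 w)) z (axis i 1)
      = dd (\<lambda>w. 0) z (axis i 1)"
    by (rule dd_cong[OF open_D z]) (simp flip: Wl_bil add: W12)
  moreover have "dd (\<lambda>w. bil (\<lambda>i j. Wl (F w) (axis i 1) (axis j 1) c d) (X 1 w) (X 2 w)) z (axis i 1)
      = dd (\<lambda>x. Wl x (X 1 z) (X 2 z) c d) (F z) (X i z)
       + Wl (F z) (vd (X 1) z (axis i 1)) (X 2 z) c d + Wl (F z) (X 1 z) (vd (X 2) z (axis i 1)) c d"
    using dd_bil_F[where B="\<lambda>w i j. Wl w (axis i 1) (axis j 1) c d" and V="X 1" and W="X 2" and t="axis i 1",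
        OF z Wl_cdiff[OF FS] X_cdiff[OF z] X_cdiff[OF z]]
    by (simp flip: Wl_bil add: vd_F)
  ultimately have "dd (\<lambda>x. Wl x (X 1 z) (X 2 z) c d) (F z) (X i z)
      = - Wl (F z) (vd (X 1) z (axis i 1)) (X 2 z) c d - Wl (F z) (X 1 z) (vd (X 2) z (axis i 1)) c d"
    by (simp add: eq_neg_iff_add_eq_0 algebra_simps)
  then have "DW (F z) (X i z) (X 1 z) (X 2 z) c d = - Wl (F z) (N i 1 z) (X 2 z) c d - Wl (F z) (X 1 z) (N i 2 z) c d"
    by (simp add: DW_def N_def Wl_linear W12[OF z])
  also have "\<dots> = 0"
    by (simp add: N_span[OF z] Wl_linear W12[OF z] Wl_same[OF FS])
  finally show ?thesis .
qed

text \<open>Each of the four correction terms retains one intact pair X1, X2 and vanishes by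
  \<open>W0\<close>, if necessary after exchanging the pairs.\<close>

lemma DW_transverse:
  assumes z: "z \<in> D"
  shows "DW (F z) t (X 1 z) (X 2 z) (X 1 z) (X 2 z) = 0"
  using trans[OF z] W0[OF z] Wl_pair[OF F_S[OF z], of "X 1 z" "X 2 z"] by (simp add: DW_def)

lemma DP_commute: "z \<in> S \<Longrightarrow> DP z t b d = DP z t d b"
proof -
  assume z: "z \<in> S"
  have "dd (\<lambda>w. Pl w b d) z t = dd (\<lambda>w. Pl w d b) z t"
    by (rule dd_cong[OF open_S z Pl_commute])
  then show ?thesis unfolding DP_def by (simp add: Pl_commute[OF z])
qed

text \<open>The direction U occurs in \<open>DP\<close> only with a factor g(X_i, X_j), which is
  zero. The remaining terms form a vector tangent to the surface, paired with the arbitrary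
  U.\<close>

lemma cotton:
  assumes z: "z \<in> D"
  shows "DP (F z) (X 1 z) (X 2 z) (X k z) = DP (F z) (X 2 z) (X 1 z) (X k z)"
proof -
  let ?X = "X 1 z" and ?Y = "X 2 z"
  note FS = F_S[OF z]
  \<comment> \<open>The coefficients of g(X1, U) and g(X2, U) in the Bianchi identity after
    \<open>DR_split\<close>.\<close>
  define \<alpha> where "\<alpha> = DP (F z) ?Y ?Y ?X - DP (F z) ?X ?Y ?Y"
  define \<beta> where "\<beta> = DP (F z) ?X ?X ?Y - DP (F z) ?Y ?X ?X"
  have "gm (F z) (\<alpha> *s ?X + \<beta> *s ?Y) U = 0" for U
    using bianchi2[OF FS, of U ?X ?Y ?X ?Y]
    by (simp add: DR_split[OF FS] DW_tangent[OF z] DW_transverse[OF z] null[OF z] gm_linear \<alpha>_def \<beta>_def algebra_simps)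
  then have "\<alpha> *s ?X + \<beta> *s ?Y = 0" by (rule gm_nondegenerate[OF FS])
  then have "\<alpha> = 0" "\<beta> = 0" using indep[OF z] by auto
  then show ?thesis using exhaust_2[of k] DP_commute[OF FS] by (auto simp: \<alpha>_def \<beta>_def)
qed

lemma p_holo: "holo_fun (p i j) D"
  unfolding holo_fun_iff p_def Pl_def
proof
  fix z assume z: "z \<in> D"
  show "cdiff_at (\<lambda>z. bil (schouten (F z)) (X i z) (X j z)) z"
    by (rule cdiff_bil) (auto intro: cdiff_compose[OF F_cdiff[OF z] schouten_cdiff[OF F_S[OF z]]] X_cdiff[OF z])
qed

lemma p_sym: "z \<in> D \<Longrightarrow> p i j z = p j i z"
  by (simp add: p_def Pl_commute[OF F_S])

lemma cpartial_p:
  assumes z: "z \<in> D"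
  shows "cpartial i (p j k) z = DP (F z) (X i z) (X j z) (X k z) + Pl (F z) (N i j z) (X k z) + Pl (F z) (X j z) (N i k z)"
  using dd_bil_F[where V="X j" and W="X k" and t="axis i 1" and B=schouten,
      OF z schouten_cdiff[OF F_S[OF z]] X_cdiff[OF z] X_cdiff[OF z]]
  by (simp add: p_def[abs_def] DP_def N_def Pl_linear vd_F flip: Pl_def)

text \<open>\<open>cotton\<close> in terms of the induced connection: the corrections with lower
  indices 1 and 2 occur on both sides and cancel by the symmetry of \<gamma>.\<close>

lemma cotton_p:
  assumes z: "z \<in> D"
  shows "cpartial 1 (p 2 k) z - (\<Sum>l\<in>UNIV. \<gamma> z $ l $ 1 $ k * p 2 l z)
       = cpartial 2 (p 1 k) z - (\<Sum>l\<in>UNIV. \<gamma> z $ l $ 2 $ k * p 1 l z)"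
  using cotton[OF z, of k]
  by (simp add: cpartial_p[OF z] N_span[OF z] Pl_linear sum_2 p_def \<gamma>_sym[OF z, of _ 2 1])

text \<open>\<open>W0\<close> removes the Weyl part of the curvature and nullity removes two of the
  four terms of \<open>Ql\<close>; nondegeneracy then strips off the test vector V.\<close>

lemma curvature_restricted:
  assumes z: "z \<in> D"
  shows "Rv (F z) (X 1 z) (X 2 z) (X k z) = p 2 k z *s X 1 z - p 1 k z *s X 2 z"
proof -
  note FS = F_S[OF z]
  have "gm (F z) (Rv (F z) (X 1 z) (X 2 z) (X k z) - (p 2 k z *s X 1 z - p 1 k z *s X 2 z)) V = 0" for V
  proof -
    have "Rl (F z) V (X k z) (X 1 z) (X 2 z) = Ql (F z) V (X k z) (X 1 z) (X 2 z)"
      using W0[OF z, of V "X k z"] by (simp add: Wl_def)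
    then have "gm (F z) V (Rv (F z) (X 1 z) (X 2 z) (X k z)) = gm (F z) V (p 2 k z *s X 1 z - p 1 k z *s X 2 z)"
      by (simp add: Rl_def Ql_def null[OF z] gm_linear p_def Pl_commute[OF FS, of "X k z"])
    then show ?thesis by (simp add: gm_commute[OF FS, of _ V] gm_linear)
  qed
  then have "Rv (F z) (X 1 z) (X 2 z) (X k z) - (p 2 k z *s X 1 z - p 1 k z *s X 2 z) = 0"
    by (rule gm_nondegenerate[OF FS])
  then show ?thesis by simp
qed

lemma vd_Ga_F:
  assumes z: "z \<in> D"
  shows "vd (\<lambda>w. Ga (F w) (X j w) (X k w)) z (axis i 1) = Ga1 (F z) (X i z) (X j z) (X k z)
    + Ga (F z) (vd (X j) z (axis i 1)) (X k z) + Ga (F z) (X j z) (vd (X k) z (axis i 1))"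
proof -
  have "dd (\<lambda>w. bil (\<lambda>a b. christoffel G (F w) $ m $ a $ b) (X j w) (X k w)) z (axis i 1)
    = bil (\<lambda>a b. dd (\<lambda>w. christoffel G w $ m $ a $ b) (F z) (X i z)) (X j z) (X k z)
    + bil (\<lambda>a b. christoffel G (F z) $ m $ a $ b) (vd (X j) z (axis i 1)) (X k z)
    + bil (\<lambda>a b. christoffel G (F z) $ m $ a $ b) (X j z) (vd (X k) z (axis i 1))" for m
    using dd_bil_F[where B="\<lambda>w a b. christoffel G w $ m $ a $ b" and V="X j" and W="X k" and t="axis i 1",
        OF z christoffel_cdiff[OF F_S[OF z]] X_cdiff[OF z] X_cdiff[OF z]]
    by (simp add: dd_bil_const[OF christoffel_cdiff[OF F_S[OF z]]] vd_F)
  then show ?thesis by (simp add: vec_eq_iff Ga_def Ga1_def)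
qed

text \<open>The second covariant derivatives of X_k are commuted in two ways, in ambient terms and
  in terms of \<gamma>. Total geodesy leaves no second fundamental form, so the coefficients of X1
  and X2 can be compared.\<close>

lemma gauss:
  assumes z: "z \<in> D"
  shows "cpartial 1 (\<lambda>w. \<gamma> w $ m $ 2 $ k) z - cpartial 2 (\<lambda>w. \<gamma> w $ m $ 1 $ k) z
     + (\<Sum>l\<in>UNIV. \<gamma> z $ m $ 1 $ l * \<gamma> z $ l $ 2 $ k - \<gamma> z $ m $ 2 $ l * \<gamma> z $ l $ 1 $ k)
     = (if m = 1 then p 2 k z else - p 1 k z)"
proof -
  note \<gamma>_cdiff = holo_funD[OF \<gamma>_holo z]
  have dX: "cdiff_at (\<lambda>w. cpartial j (\<lambda>w. X k w $ m) w) z" for j k m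
    by (rule holo_funD[OF holo_fun_cpartial[OF open_D X_holo] z])
  have GaF: "cdiff_at (\<lambda>w. Ga (F w) (X j w) (X k w) $ m) z" for j k m
    unfolding Ga_def vec_lambda_beta
    by (rule cdiff_bil) (auto intro: cdiff_compose[OF F_cdiff[OF z] christoffel_cdiff[OF F_S[OF z]]] X_cdiff[OF z])
  \<comment> \<open>The ambient expansion; its part skew in i and j is the ambient
    curvature.\<close>
  have N1: "vd (N j k) z (axis i 1) + Ga (F z) (X i z) (N j k z) =
     (\<chi> m. cpartial i (cpartial j (\<lambda>w. X k w $ m)) z) + Ga1 (F z) (X i z) (X j z) (X k z)
       + Ga (F z) (vd (X j) z (axis i 1)) (X k z) + Ga (F z) (X j z) (vd (X k) z (axis i 1))
       + Ga (F z) (X i z) (vd (X k) z (axis j 1)) + Ga (F z) (X i z) (Ga (F z) (X j z) (X k z))" for i j k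
  proof -
    have "vd (N j k) z (axis i 1) = (\<chi> m. cpartial i (cpartial j (\<lambda>w. X k w $ m)) z)
        + vd (\<lambda>w. Ga (F w) (X j w) (X k w)) z (axis i 1)"
      by (simp add: vec_eq_iff N_def[abs_def] cpartial_add dX GaF)
    then show ?thesis by (simp add: vd_Ga_F[OF z] N_def Ga_linear)
  qed
  have comm: "cpartial 1 (cpartial 2 (\<lambda>w. X k w $ m)) z = cpartial 2 (cpartial 1 (\<lambda>w. X k w $ m)) z" for m
    by (rule cpartial_commute[OF open_D X_holo z])
  have X12: "vd (X 2) z (axis 1 1) = vd (X 1) z (axis 2 1)"
    using cpartial_commute[OF open_D, of "\<lambda>w. F w $ m" z 1 2 for m] F_holo z
    by (simp add: vec_eq_iff X_def holo_map_def)
  have R: "Rv (F z) (X 1 z) (X 2 z) (X k z) =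
      (vd (N 2 k) z (axis 1 1) + Ga (F z) (X 1 z) (N 2 k z)) - (vd (N 1 k) z (axis 2 1) + Ga (F z) (X 2 z) (N 1 k z))"
    unfolding N1 Rv_def by (simp add: comm X12 algebra_simps)
  \<comment> \<open>The tangential expansion; its part skew in i and j is the curvature of the
    induced connection.\<close>
  have N2: "vd (N j k) z (axis i 1) + Ga (F z) (X i z) (N j k z) =
      (cpartial i (\<lambda>w. \<gamma> w $ 1 $ j $ k) z + (\<Sum>l\<in>UNIV. \<gamma> z $ 1 $ i $ l * \<gamma> z $ l $ j $ k)) *s X 1 z +
      (cpartial i (\<lambda>w. \<gamma> w $ 2 $ j $ k) z + (\<Sum>l\<in>UNIV. \<gamma> z $ 2 $ i $ l * \<gamma> z $ l $ j $ k)) *s X 2 z" for i j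
  proof -
    have "cpartial i (\<lambda>w. N j k w $ m) z =
        cpartial i (\<lambda>w. \<gamma> w $ 1 $ j $ k * X 1 w $ m + \<gamma> w $ 2 $ j $ k * X 2 w $ m) z" for m
      by (rule cpartial_cong[OF open_D z]) (simp add: N_span)
    then have "vd (N j k) z (axis i 1) =
        cpartial i (\<lambda>w. \<gamma> w $ 1 $ j $ k) z *s X 1 z + \<gamma> z $ 1 $ j $ k *s vd (X 1) z (axis i 1) +
        (cpartial i (\<lambda>w. \<gamma> w $ 2 $ j $ k) z *s X 2 z + \<gamma> z $ 2 $ j $ k *s vd (X 2) z (axis i 1))"
      by (simp add: vec_eq_iff cpartial_add cpartial_mult cdiff_mult \<gamma>_cdiff X_cdiff[OF z])
    moreover have "Ga (F z) (X i z) (N j k z) = \<gamma> z $ 1 $ j $ k *s Ga (F z) (X i z) (X 1 z)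
        + \<gamma> z $ 2 $ j $ k *s Ga (F z) (X i z) (X 2 z)"
      by (simp add: N_span[OF z] Ga_linear)
    ultimately have "vd (N j k) z (axis i 1) + Ga (F z) (X i z) (N j k z) =
        cpartial i (\<lambda>w. \<gamma> w $ 1 $ j $ k) z *s X 1 z + cpartial i (\<lambda>w. \<gamma> w $ 2 $ j $ k) z *s X 2 z
        + \<gamma> z $ 1 $ j $ k *s N i 1 z + \<gamma> z $ 2 $ j $ k *s N i 2 z"
      by (simp add: N_def vector_add_ldistrib algebra_simps)
    then show ?thesis
      by (simp add: N_span[OF z] sum_2 vec_eq_iff algebra_simps)
  qed
  have eq: "p 2 k z *s X 1 z - p 1 k z *s X 2 z =
      ((cpartial 1 (\<lambda>w. \<gamma> w $ 1 $ 2 $ k) z + (\<Sum>l\<in>UNIV. \<gamma> z $ 1 $ 1 $ l * \<gamma> z $ l $ 2 $ k)) *s X 1 z +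
      (cpartial 1 (\<lambda>w. \<gamma> w $ 2 $ 2 $ k) z + (\<Sum>l\<in>UNIV. \<gamma> z $ 2 $ 1 $ l * \<gamma> z $ l $ 2 $ k)) *s X 2 z) -
      ((cpartial 2 (\<lambda>w. \<gamma> w $ 1 $ 1 $ k) z + (\<Sum>l\<in>UNIV. \<gamma> z $ 1 $ 2 $ l * \<gamma> z $ l $ 1 $ k)) *s X 1 z +
      (cpartial 2 (\<lambda>w. \<gamma> w $ 2 $ 1 $ k) z + (\<Sum>l\<in>UNIV. \<gamma> z $ 2 $ 2 $ l * \<gamma> z $ l $ 1 $ k)) *s X 2 z)"
    using R unfolding N2 curvature_restricted[OF z] .
  define c1 where "c1 = cpartial 1 (\<lambda>w. \<gamma> w $ 1 $ 2 $ k) z + (\<Sum>l\<in>UNIV. \<gamma> z $ 1 $ 1 $ l * \<gamma> z $ l $ 2 $ k)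
     - (cpartial 2 (\<lambda>w. \<gamma> w $ 1 $ 1 $ k) z + (\<Sum>l\<in>UNIV. \<gamma> z $ 1 $ 2 $ l * \<gamma> z $ l $ 1 $ k)) - p 2 k z"
  define c2 where "c2 = cpartial 1 (\<lambda>w. \<gamma> w $ 2 $ 2 $ k) z + (\<Sum>l\<in>UNIV. \<gamma> z $ 2 $ 1 $ l * \<gamma> z $ l $ 2 $ k)
     - (cpartial 2 (\<lambda>w. \<gamma> w $ 2 $ 1 $ k) z + (\<Sum>l\<in>UNIV. \<gamma> z $ 2 $ 2 $ l * \<gamma> z $ l $ 1 $ k)) + p 1 k z"
  have "c1 *s X 1 z + c2 *s X 2 z = 0"
    using eq unfolding c1_def c2_def vector_sadd_rdistrib vector_ssub_ldistrib vector_sub_rdistrib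
    by (simp add: algebra_simps)
  then have "c1 = 0 \<and> c2 = 0" by (rule indep[OF z])
  then show ?thesis
    using exhaust_2[of m] by (auto simp: c1_def c2_def sum_2 algebra_simps)
qed

end

section \<open>Projectively flat connections on surfaces\<close>

lemma linear_system_solvable_at:
  fixes A :: "'n::finite \<Rightarrow> complex^'n \<Rightarrow> complex^'m^'m::finite"
  assumes D: "open D" "z0 \<in> D"
    and holo: "\<And>i k l. holo_fun (\<lambda>z. A i z $ k $ l) D"
    and flat: "\<And>i j k l z. z \<in> D \<Longrightarrow>
      cpartial i (\<lambda>z. A j z $ k $ l) z + (\<Sum>m\<in>UNIV. A j z $ k $ m * A i z $ m $ l) =
      cpartial j (\<lambda>z. A i z $ k $ l) z + (\<Sum>m\<in>UNIV. A i z $ k $ m * A j z $ m $ l)"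
  obtains r where "0 < r" "ball z0 r \<subseteq> D"
    "\<And>\<psi>::complex^'m. \<exists>\<Psi>. (\<forall>k. holo_fun (\<lambda>z. \<Psi> z $ k) (ball z0 r)) \<and> \<Psi> z0 = \<psi> \<and>
      (\<forall>z\<in>ball z0 r. \<forall>i k. cpartial i (\<lambda>z. \<Psi> z $ k) z = (\<Sum>l\<in>UNIV. A i z $ k $ l * \<Psi> z $ l))"
proof -
  obtain R where R: "R > 0" "ball z0 R \<subseteq> D" using D open_contains_ball by blast
  have sh: "z0 + z \<in> D" if "z \<in> ball 0 R" for z using that R by (auto simp: dist_norm)
  obtain r where r: "0 < r" "r \<le> R" and sol:
    "\<And>\<psi>::complex^'m. \<exists>\<Psi>. (\<forall>k. holo_fun (\<lambda>z. \<Psi> z $ k) (ball 0 r)) \<and> \<Psi> 0 = \<psi> \<and>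
      (\<forall>z\<in>ball 0 r. \<forall>i k. cpartial i (\<lambda>z. \<Psi> z $ k) z = (\<Sum>l\<in>UNIV. A i (z0 + z) $ k $ l * \<Psi> z $ l))"
  proof (rule linear_system_solvable[of R "\<lambda>i z. A i (z0 + z)"])
    show "holo_fun (\<lambda>z. A i (z0 + z) $ k $ l) (ball 0 R)" for i k l
      using holo sh by (auto simp: holo_fun_iff simp del: mem_ball intro!: cdiff_translate)
    show "cpartial i (\<lambda>z. A j (z0 + z) $ k $ l) z + (\<Sum>m\<in>UNIV. A j (z0 + z) $ k $ m * A i (z0 + z) $ m $ l) =
      cpartial j (\<lambda>z. A i (z0 + z) $ k $ l) z + (\<Sum>m\<in>UNIV. A i (z0 + z) $ k $ m * A j (z0 + z) $ m $ l)"
      if "z \<in> ball 0 R" for i j k l z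
      unfolding cpartial_translate[of _ "\<lambda>z. A _ z $ k $ l"] by (rule flat[OF sh[OF that]])
  qed (use R in auto)
  show ?thesis
  proof (rule that)
    fix \<psi> :: "complex^'m"
    obtain \<Psi> where a: "\<forall>k. holo_fun (\<lambda>z. \<Psi> z $ k) (ball 0 r)" and b: "\<Psi> 0 = \<psi>"
      and c: "\<forall>z\<in>ball 0 r. \<forall>i k. cpartial i (\<lambda>z. \<Psi> z $ k) z = (\<Sum>l\<in>UNIV. A i (z0 + z) $ k $ l * \<Psi> z $ l)"
      using sol by blast
    note \<Psi> = a[rule_format] b c[rule_format]
    have b: "- z0 + z \<in> ball 0 r" if "z \<in> ball z0 r" for z using that by (simp add: dist_norm norm_minus_commute)
    show "\<exists>\<Psi>. (\<forall>k. holo_fun (\<lambda>z. \<Psi> z $ k) (ball z0 r)) \<and> \<Psi> z0 = \<psi> \<and>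
      (\<forall>z\<in>ball z0 r. \<forall>i k. cpartial i (\<lambda>z. \<Psi> z $ k) z = (\<Sum>l\<in>UNIV. A i z $ k $ l * \<Psi> z $ l))"
    proof (intro exI[of _ "\<lambda>z. \<Psi> (- z0 + z)"] conjI allI ballI)
      show "holo_fun (\<lambda>z. \<Psi> (- z0 + z) $ k) (ball z0 r)" for k
        unfolding holo_fun_iff
        by (intro ballI cdiff_translate[where f="\<lambda>z. \<Psi> z $ k"] holo_funD[OF \<Psi>(1)] b)
      show "cpartial i (\<lambda>z. \<Psi> (- z0 + z) $ k) z = (\<Sum>l\<in>UNIV. A i z $ k $ l * \<Psi> (- z0 + z) $ l)"
        if "z \<in> ball z0 r" for z i k
        unfolding cpartial_translate[of _ "\<lambda>z. \<Psi> z $ k"] using \<Psi>(3)[OF b[OF that]] by simp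
    qed (use \<Psi>(2) in simp)
  qed (use r R in auto)
qed

text \<open>The projectively invariant Hessian equation in the scale given by \<gamma>, with p in
  the role of the projective Schouten tensor.\<close>

definition hess_solution ::
  "(complex^2 \<Rightarrow> complex^2^2^2) \<Rightarrow> (2 \<Rightarrow> 2 \<Rightarrow> complex^2 \<Rightarrow> complex) \<Rightarrow> (complex^2) set \<Rightarrow> (complex^2 \<Rightarrow> complex) \<Rightarrow> bool"
where
  "hess_solution \<gamma> p U \<sigma> \<longleftrightarrow> holo_fun \<sigma> U \<and> (\<forall>z\<in>U. \<forall>i j. cpartial i (cpartial j \<sigma>) z =
      (\<Sum>k\<in>UNIV. \<gamma> z $ k $ i $ j * cpartial k \<sigma> z) - p i j z * \<sigma> z)"

lemma hess_solution_subset: "hess_solution \<gamma> p U \<sigma> \<Longrightarrow> V \<subseteq> U \<Longrightarrow> hess_solution \<gamma> p V \<sigma>"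
  by (auto simp: hess_solution_def holo_fun_iff)

text \<open>Prolongation: the equation is a closed first order system for (\<sigma>, \<partial>_1
  \<sigma>, \<partial>_2 \<sigma>). In its flatness condition the first row is the symmetry of
  \<gamma> and p, the first column below it the Cotton identity, and the remaining 2 by 2 block the
  Gauss equation.\<close>

lemma hess_solutions_exist:
  assumes D: "open D" "z0 \<in> D"
    and \<gamma>: "\<And>k i j. holo_fun (\<lambda>z. \<gamma> z $ k $ i $ j) D"
    and \<gamma>_sym: "\<And>z k i j. z \<in> D \<Longrightarrow> \<gamma> z $ k $ i $ j = \<gamma> z $ k $ j $ i"
    and p: "\<And>i j. holo_fun (p i j) D" and p_sym: "\<And>z i j. z \<in> D \<Longrightarrow> p i j z = p j i z"
    and gauss: "\<And>z m k. z \<in> D \<Longrightarrow> cpartial 1 (\<lambda>w. \<gamma> w $ m $ 2 $ k) z - cpartial 2 (\<lambda>w. \<gamma> w $ m $ 1 $ k) z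
     + (\<Sum>l\<in>UNIV. \<gamma> z $ m $ 1 $ l * \<gamma> z $ l $ 2 $ k - \<gamma> z $ m $ 2 $ l * \<gamma> z $ l $ 1 $ k)
     = (if m = 1 then p 2 k z else - p 1 k z)"
    and cotton: "\<And>z k. z \<in> D \<Longrightarrow> cpartial 1 (p 2 k) z - (\<Sum>l\<in>UNIV. \<gamma> z $ l $ 1 $ k * p 2 l z)
       = cpartial 2 (p 1 k) z - (\<Sum>l\<in>UNIV. \<gamma> z $ l $ 2 $ k * p 1 l z)"
  obtains r and \<sigma> :: "3 \<Rightarrow> complex^2 \<Rightarrow> complex" where "0 < r" "ball z0 r \<subseteq> D"
    "\<And>a. hess_solution \<gamma> p (ball z0 r) (\<sigma> a)"
    "\<And>a. \<sigma> a z0 = (if a = 1 then 1 else 0)"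
    "\<And>a. cpartial 1 (\<sigma> a) z0 = (if a = 2 then 1 else 0)"
    "\<And>a. cpartial 2 (\<sigma> a) z0 = (if a = 3 then 1 else 0)"
proof -
  \<comment> \<open>The first row declares the second and third component to be the derivatives of
    the first; the other two rows are the Hessian equation for j = 1 and j = 2.\<close>
  define A :: "2 \<Rightarrow> complex^2 \<Rightarrow> complex^3^3" where
    "A = (\<lambda>i z. vector [vector [0, if i = 1 then 1 else 0, if i = 2 then 1 else 0],
       vector [- p i 1 z, \<gamma> z $ 1 $ i $ 1, \<gamma> z $ 2 $ i $ 1],
       vector [- p i 2 z, \<gamma> z $ 1 $ i $ 2, \<gamma> z $ 2 $ i $ 2]])"
  have A_simps: "A i z $ 1 $ 1 = 0" "A i z $ 1 $ 2 = (if i = 1 then 1 else 0)" "A i z $ 1 $ 3 = (if i = 2 then 1 else 0)"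
    "A i z $ 2 $ 1 = - p i 1 z" "A i z $ 2 $ 2 = \<gamma> z $ 1 $ i $ 1" "A i z $ 2 $ 3 = \<gamma> z $ 2 $ i $ 1"
    "A i z $ 3 $ 1 = - p i 2 z" "A i z $ 3 $ 2 = \<gamma> z $ 1 $ i $ 2" "A i z $ 3 $ 3 = \<gamma> z $ 2 $ i $ 2" for i z
    by (simp_all add: A_def vector_3)
  have hA: "holo_fun (\<lambda>z. A i z $ k $ l) D" for i k l
    using exhaust_3[of k] exhaust_3[of l] \<gamma> p
    by (elim disjE) (simp_all add: A_simps holo_fun_iff cdiff_minus)
  have flat12: "cpartial 1 (\<lambda>z. A 2 z $ k $ l) z + (\<Sum>m\<in>UNIV. A 2 z $ k $ m * A 1 z $ m $ l) =
      cpartial 2 (\<lambda>z. A 1 z $ k $ l) z + (\<Sum>m\<in>UNIV. A 1 z $ k $ m * A 2 z $ m $ l)" if z: "z \<in> D" for k l z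
    using exhaust_3[of k] exhaust_3[of l] gauss[OF z, of 1 1] gauss[OF z, of 1 2] gauss[OF z, of 2 1]
      gauss[OF z, of 2 2] cotton[OF z, of 1] cotton[OF z, of 2]
    by (elim disjE) (simp_all add: A_simps sum_3 sum_2 cpartial_minus holo_funD[OF p z]
      \<gamma>_sym[OF z, of _ 2 1] p_sym[OF z, of 2 1] algebra_simps eq_diff_eq diff_eq_eq)
  have flat: "cpartial i (\<lambda>z. A j z $ k $ l) z + (\<Sum>m\<in>UNIV. A j z $ k $ m * A i z $ m $ l) =
      cpartial j (\<lambda>z. A i z $ k $ l) z + (\<Sum>m\<in>UNIV. A i z $ k $ m * A j z $ m $ l)" if z: "z \<in> D" for i j k l z
    using exhaust_2[of i] exhaust_2[of j] flat12[OF z, of k l] by auto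
  obtain r where r: "0 < r" "ball z0 r \<subseteq> D" and sol:
    "\<And>\<psi>::complex^3. \<exists>\<Psi>. (\<forall>k. holo_fun (\<lambda>z. \<Psi> z $ k) (ball z0 r)) \<and> \<Psi> z0 = \<psi> \<and>
      (\<forall>z\<in>ball z0 r. \<forall>i k. cpartial i (\<lambda>z. \<Psi> z $ k) z = (\<Sum>l\<in>UNIV. A i z $ k $ l * \<Psi> z $ l))"
    by (rule linear_system_solvable_at[OF D hA flat]) blast+
  define good where "good = (\<lambda>(a::3) \<Psi>. (\<forall>k. holo_fun (\<lambda>z. \<Psi> z $ k) (ball z0 r)) \<and> \<Psi> z0 = (axis a 1 :: complex^3) \<and>
      (\<forall>z\<in>ball z0 r. \<forall>i k. cpartial i (\<lambda>z. \<Psi> z $ k) z = (\<Sum>l\<in>UNIV. A i z $ k $ l * \<Psi> z $ l)))"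
  define \<Psi> where "\<Psi> = (\<lambda>a. SOME \<Psi>. good a \<Psi>)"
  have "good a (\<Psi> a)" for a
    unfolding \<Psi>_def by (rule someI_ex[of "good a"]) (unfold good_def, rule sol)
  then have \<Psi>: "\<And>a k. holo_fun (\<lambda>z. \<Psi> a z $ k) (ball z0 r)" "\<And>a. \<Psi> a z0 = (axis a 1 :: complex^3)"
    "\<And>a z i k. z \<in> ball z0 r \<Longrightarrow> cpartial i (\<lambda>z. \<Psi> a z $ k) z = (\<Sum>l\<in>UNIV. A i z $ k $ l * \<Psi> a z $ l)"
    unfolding good_def by blast+
  define \<sigma> where "\<sigma> = (\<lambda>a z. \<Psi> a z $ 1)"
  have d1: "cpartial 1 (\<sigma> a) z = \<Psi> a z $ 2" "cpartial 2 (\<sigma> a) z = \<Psi> a z $ 3" if "z \<in> ball z0 r" for a z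
    unfolding \<sigma>_def using \<Psi>(3)[OF that, of _ a 1] by (simp_all add: sum_3 A_simps)
  have d2: "cpartial i (cpartial 1 (\<sigma> a)) z = cpartial i (\<lambda>z. \<Psi> a z $ 2) z"
    "cpartial i (cpartial 2 (\<sigma> a)) z = cpartial i (\<lambda>z. \<Psi> a z $ 3) z" if "z \<in> ball z0 r" for a z i
    by (rule cpartial_cong[OF open_ball that d1(1)], assumption, rule cpartial_cong[OF open_ball that d1(2)], assumption)
  show ?thesis
  proof (rule that[OF r, of \<sigma>])
    show "hess_solution \<gamma> p (ball z0 r) (\<sigma> a)" for a
      unfolding hess_solution_def
    proof (intro conjI ballI allI)
      show "holo_fun (\<sigma> a) (ball z0 r)" using \<Psi>(1) by (simp add: \<sigma>_def)
      fix z i j assume z: "z \<in> ball z0 r"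
      show "cpartial i (cpartial j (\<sigma> a)) z = (\<Sum>k\<in>UNIV. \<gamma> z $ k $ i $ j * cpartial k (\<sigma> a) z) - p i j z * \<sigma> a z"
      proof -
        have "\<Psi> a z $ 1 = \<sigma> a z" by (simp add: \<sigma>_def)
        then show ?thesis
          using exhaust_2[of j] by (auto simp: d1[OF z] d2[OF z] \<Psi>(3)[OF z] sum_2 sum_3 A_simps)
      qed
    qed
    have z0: "z0 \<in> ball z0 r" using r by simp
    show "\<sigma> a z0 = (if a = 1 then 1 else 0)" "cpartial 1 (\<sigma> a) z0 = (if a = 2 then 1 else 0)"
      "cpartial 2 (\<sigma> a) z0 = (if a = 3 then 1 else 0)" for a
      by (auto simp: \<Psi>(2) d1[OF z0] axis_nth, simp_all add: \<sigma>_def \<Psi>(2) axis_nth)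
  qed
qed

text \<open>Uniqueness for a second order equation on the level of Taylor coefficients: by the
  equation and Leibniz' rule, a derivative of order m + 2 is a combination of derivatives of order
  at most m + 1.\<close>

lemma ode2_derivs_zero:
  assumes T: "open T" "t0 \<in> T" and y: "y holomorphic_on T" and q: "q holomorphic_on T" and P: "P holomorphic_on T"
    and ode: "\<And>t. t \<in> T \<Longrightarrow> deriv (deriv y) t = q t * deriv y t - P t * y t"
    and init: "y t0 = 0" "deriv y t0 = 0"
  shows "(deriv ^^ n) y t0 = 0"
proof (induction n rule: less_induct)
  case (less n)
  consider "n = 0" | "n = 1" | m where "n = Suc (Suc m)" by (metis One_nat_def not0_implies_Suc)
  then show ?case
  proof cases
    case 3
    have dy: "deriv y holomorphic_on T" using y T by (intro holomorphic_deriv)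
    have "(deriv ^^ n) y t0 = (deriv ^^ m) (deriv (deriv y)) t0"
      by (simp add: 3 funpow_swap1)
    also have "\<dots> = (deriv ^^ m) (\<lambda>t. q t * deriv y t - P t * y t) t0"
      by (rule higher_deriv_transform_within_open[OF _ _ T])
         (use y q P dy T ode in \<open>auto intro!: holomorphic_intros holomorphic_deriv\<close>)
    also have "\<dots> = (deriv ^^ m) (\<lambda>t. q t * deriv y t) t0 - (deriv ^^ m) (\<lambda>t. P t * y t) t0"
      by (rule higher_deriv_diff[OF _ _ T]) (use y q P dy in \<open>auto intro!: holomorphic_intros\<close>)
    also have "(deriv ^^ m) (\<lambda>t. q t * deriv y t) t0 = 0"
    proof (subst higher_deriv_mult[OF q dy T], intro sum.neutral ballI)
      fix i assume "i \<in> {0..m}"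
      have "(deriv ^^ (m - i)) (deriv y) t0 = (deriv ^^ Suc (m - i)) y t0" by (simp add: funpow_swap1)
      also have "\<dots> = 0" by (rule less) (use 3 in simp)
      finally show "of_nat (m choose i) * (deriv ^^ i) q t0 * (deriv ^^ (m - i)) (deriv y) t0 = 0" by simp
    qed
    also have "(deriv ^^ m) (\<lambda>t. P t * y t) t0 = 0"
    proof (subst higher_deriv_mult[OF P y T], intro sum.neutral ballI)
      fix i assume "i \<in> {0..m}"
      have "(deriv ^^ (m - i)) y t0 = 0" by (rule less) (use 3 in simp)
      then show "of_nat (m choose i) * (deriv ^^ i) P t0 * (deriv ^^ (m - i)) y t0 = 0" by simp
    qed
    finally show ?thesis by simp
  qed (use init in auto)
qed

text \<open>The components of the covariant derivative of c' along c.\<close>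

definition acc :: "(complex^2 \<Rightarrow> complex^2^2^2) \<Rightarrow> (complex \<Rightarrow> complex^2) \<Rightarrow> complex \<Rightarrow> 2 \<Rightarrow> complex" where
  "acc \<gamma> c t k = cderiv (cderiv c) t $ k + (\<Sum>i\<in>UNIV. \<Sum>j\<in>UNIV. \<gamma> (c t) $ k $ i $ j * cderiv c t $ i * cderiv c t $ j)"

lemma cderiv_has_derivative:
  assumes "open T" "t \<in> T" "(\<lambda>s. c s $ i) holomorphic_on T"
  shows "((\<lambda>s. c s $ i) has_field_derivative cderiv c t $ i) (at t)"
  using holomorphic_derivI[OF assms(3,1,2)] by (simp add: cderiv_def)

lemma cderiv_holomorphic:
  assumes "open T" "(\<lambda>s. c s $ i) holomorphic_on T"
  shows "(\<lambda>s. cderiv c s $ i) holomorphic_on T"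
  using holomorphic_deriv[OF assms(2,1)] by (simp add: cderiv_def)

text \<open>Differentiating twice produces the Hessian of h on (c', c') and dh(c''). The Hessian
  equation turns the former into a Christoffel term, which completes c'' to the covariant
  acceleration, and a multiple of h.\<close>

lemma
  assumes T: "open T" and c: "\<And>i. (\<lambda>s. c s $ i) holomorphic_on T" and cU: "c ` T \<subseteq> U" and U: "open U"
    and h: "hess_solution \<gamma> p U h"
  shows hess_curve_holomorphic: "(\<lambda>s. h (c s)) holomorphic_on T"
    and hess_curve_deriv: "t \<in> T \<Longrightarrow> deriv (\<lambda>s. h (c s)) t = (\<Sum>i\<in>UNIV. cpartial i h (c t) * cderiv c t $ i)"
    and hess_curve_deriv2: "t \<in> T \<Longrightarrow> deriv (deriv (\<lambda>s. h (c s))) t =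
       (\<Sum>k\<in>UNIV. cpartial k h (c t) * acc \<gamma> c t k)
       - (\<Sum>i\<in>UNIV. \<Sum>j\<in>UNIV. p i j (c t) * cderiv c t $ i * cderiv c t $ j) * h (c t)"
proof -
  have hh: "holo_fun h U" using h by (simp add: hess_solution_def)
  have D: "((\<lambda>s. f (c s)) has_field_derivative (\<Sum>i\<in>UNIV. cpartial i f (c t) * cderiv c t $ i)) (at t)"
    if "holo_fun f U" "t \<in> T" for f t
    by (rule cdiff_curve[OF holo_funD[OF that(1)] cderiv_has_derivative[OF T that(2) c]]) (use cU that in auto)
  show "(\<lambda>s. h (c s)) holomorphic_on T"
    unfolding holomorphic_on_open[OF T] using D[OF hh] by blast
  show d1: "deriv (\<lambda>s. h (c s)) t = (\<Sum>i\<in>UNIV. cpartial i h (c t) * cderiv c t $ i)" if "t \<in> T" for t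
    by (rule DERIV_imp_deriv[OF D[OF hh that]])
  assume t: "t \<in> T"
  have ct: "c t \<in> U" using cU t by auto
  have "((\<lambda>s. \<Sum>i\<in>UNIV. cpartial i h (c s) * cderiv c s $ i) has_field_derivative
      (\<Sum>i\<in>UNIV. (\<Sum>j\<in>UNIV. cpartial j (cpartial i h) (c t) * cderiv c t $ j) * cderiv c t $ i
        + cderiv (cderiv c) t $ i * cpartial i h (c t))) (at t)"
    by (intro DERIV_sum DERIV_mult D[OF holo_fun_cpartial[OF U hh] t]
        cderiv_has_derivative[OF T t cderiv_holomorphic[OF T c]])
  then have "((deriv (\<lambda>s. h (c s))) has_field_derivative
      (\<Sum>i\<in>UNIV. (\<Sum>j\<in>UNIV. cpartial j (cpartial i h) (c t) * cderiv c t $ j) * cderiv c t $ i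
        + cderiv (cderiv c) t $ i * cpartial i h (c t))) (at t)"
    by (rule has_field_derivative_transform_within_open[OF _ T t]) (simp add: d1)
  then have "deriv (deriv (\<lambda>s. h (c s))) t = (\<Sum>i\<in>UNIV. (\<Sum>j\<in>UNIV. cpartial j (cpartial i h) (c t) * cderiv c t $ j) * cderiv c t $ i
        + cderiv (cderiv c) t $ i * cpartial i h (c t))"
    by (rule DERIV_imp_deriv)
  moreover have "cpartial j (cpartial i h) (c t) = (\<Sum>k\<in>UNIV. \<gamma> (c t) $ k $ j $ i * cpartial k h (c t)) - p j i (c t) * h (c t)" for i j
    using h ct by (simp add: hess_solution_def)
  ultimately show "deriv (deriv (\<lambda>s. h (c s))) t =
       (\<Sum>k\<in>UNIV. cpartial k h (c t) * acc \<gamma> c t k)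
       - (\<Sum>i\<in>UNIV. \<Sum>j\<in>UNIV. p i j (c t) * cderiv c t $ i * cderiv c t $ j) * h (c t)"
    by (simp add: acc_def sum_2 algebra_simps)
qed

lemma hess_solution_combination:
  fixes \<sigma> :: "3 \<Rightarrow> complex^2 \<Rightarrow> complex"
  assumes U: "open U" and \<sigma>: "\<And>a. hess_solution \<gamma> p U (\<sigma> a)"
  shows "hess_solution \<gamma> p U (\<lambda>z. \<Sum>a\<in>UNIV. k $ a * \<sigma> a z)"
    and "z \<in> U \<Longrightarrow> cpartial i (\<lambda>z. \<Sum>a\<in>UNIV. k $ a * \<sigma> a z) z = (\<Sum>a\<in>UNIV. k $ a * cpartial i (\<sigma> a) z)"
proof -
  have h: "holo_fun (\<sigma> a) U" for a using \<sigma> by (simp add: hess_solution_def)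
  have h1: "holo_fun (cpartial j (\<sigma> a)) U" for a j by (rule holo_fun_cpartial[OF U h])
  have d: "cpartial i (\<lambda>z. \<Sum>a\<in>UNIV. k $ a * f a z) z = (\<Sum>a\<in>UNIV. k $ a * cpartial i (f a) z)"
    if "z \<in> U" "\<And>a. holo_fun (f a) U" for i z and f :: "3 \<Rightarrow> complex^2 \<Rightarrow> complex"
    using holo_funD[OF that(2,1)] by (simp add: cpartial_sum cdiff_mult cpartial_mult)
  show "z \<in> U \<Longrightarrow> cpartial i (\<lambda>z. \<Sum>a\<in>UNIV. k $ a * \<sigma> a z) z = (\<Sum>a\<in>UNIV. k $ a * cpartial i (\<sigma> a) z)"
    by (rule d[OF _ h])
  show "hess_solution \<gamma> p U (\<lambda>z. \<Sum>a\<in>UNIV. k $ a * \<sigma> a z)"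
    unfolding hess_solution_def
  proof (intro conjI ballI allI)
    show "holo_fun (\<lambda>z. \<Sum>a\<in>UNIV. k $ a * \<sigma> a z) U"
      using h unfolding holo_fun_iff by (intro ballI cdiff_intros) blast
    fix z i j assume z: "z \<in> U"
    have "cpartial i (cpartial j (\<lambda>z. \<Sum>a\<in>UNIV. k $ a * \<sigma> a z)) z
        = cpartial i (\<lambda>z. \<Sum>a\<in>UNIV. k $ a * cpartial j (\<sigma> a) z) z"
      by (rule cpartial_cong[OF U z]) (rule d[OF _ h])
    also have "\<dots> = (\<Sum>a\<in>UNIV. k $ a * cpartial i (cpartial j (\<sigma> a)) z)" by (rule d[OF z h1])
    also have "\<dots> = (\<Sum>a\<in>UNIV. k $ a * ((\<Sum>l\<in>UNIV. \<gamma> z $ l $ i $ j * cpartial l (\<sigma> a) z) - p i j z * \<sigma> a z))"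
      using \<sigma> z by (simp add: hess_solution_def)
    finally show "cpartial i (cpartial j (\<lambda>z. \<Sum>a\<in>UNIV. k $ a * \<sigma> a z)) z =
        (\<Sum>l\<in>UNIV. \<gamma> z $ l $ i $ j * cpartial l (\<lambda>z. \<Sum>a\<in>UNIV. k $ a * \<sigma> a z) z)
        - p i j z * (\<Sum>a\<in>UNIV. k $ a * \<sigma> a z)"
      unfolding d[OF z h] by (simp add: sum_2 sum_3 algebra_simps)
  qed
qed

text \<open>A nonzero linear form on \<complex>^2 has a one-dimensional kernel, here spanned by c;
  the determinant of a and c must vanish.\<close>

lemma kernel_2:
  fixes d c a :: "complex^2"
  assumes "d \<noteq> 0" "c \<noteq> 0" "(\<Sum>i\<in>UNIV. d $ i * c $ i) = 0" "(\<Sum>i\<in>UNIV. d $ i * a $ i) = 0"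
  shows "\<exists>q. \<forall>k. a $ k = q * c $ k"
proof -
  have c1: "d $ 1 * c $ 1 = - (d $ 2 * c $ 2)" and a1: "d $ 1 * a $ 1 = - (d $ 2 * a $ 2)"
    using assms(3,4) by (simp_all add: sum_2 eq_neg_iff_add_eq_0)
  have "d $ 1 * (a $ 1 * c $ 2 - a $ 2 * c $ 1) = (d $ 1 * a $ 1) * c $ 2 - a $ 2 * (d $ 1 * c $ 1)"
    by (simp add: algebra_simps)
  also have "\<dots> = 0" unfolding a1 c1 by (simp add: algebra_simps)
  finally have 1: "d $ 1 * (a $ 1 * c $ 2 - a $ 2 * c $ 1) = 0" .
  have "d $ 2 * (a $ 1 * c $ 2 - a $ 2 * c $ 1) = - (d $ 1 * c $ 1) * a $ 1 + (d $ 1 * a $ 1) * c $ 1"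
    unfolding a1 c1 by (simp add: algebra_simps)
  then have 2: "d $ 2 * (a $ 1 * c $ 2 - a $ 2 * c $ 1) = 0" by (simp add: algebra_simps)
  have "d $ 1 \<noteq> 0 \<or> d $ 2 \<noteq> 0" using assms(1) by (auto simp: vec_eq_iff forall_2)
  with 1 2 have ac: "a $ 1 * c $ 2 = a $ 2 * c $ 1" by auto
  have "c $ 1 \<noteq> 0 \<or> c $ 2 \<noteq> 0" using assms(2) by (auto simp: vec_eq_iff forall_2)
  then show ?thesis
  proof
    assume "c $ 1 \<noteq> 0"
    with ac show ?thesis by (intro exI[of _ "a $ 1 / c $ 1"]) (auto simp: forall_2 field_simps)
  next
    assume "c $ 2 \<noteq> 0"
    with ac show ?thesis by (intro exI[of _ "a $ 2 / c $ 2"]) (auto simp: forall_2 field_simps)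
  qed
qed

lemma singular_kernel:
  fixes M :: "complex^'n^'n::finite"
  assumes "det M = 0"
  obtains k where "k \<noteq> 0" "M *v k = 0"
  using assms matrix_left_invertible_ker[of M] invertible_left_inverse[of M] invertible_det_nz[of M] by blast

text \<open>A zero row completes the two equations to a singular square system.\<close>

lemma two_equations:
  fixes u v :: "complex^3"
  obtains k where "k \<noteq> 0" "(\<Sum>a\<in>UNIV. k $ a * u $ a) = 0" "(\<Sum>a\<in>UNIV. k $ a * v $ a) = 0"
proof -
  let ?M = "vector [u, v, 0] :: complex^3^3"
  have "row 3 ?M = 0" by (simp add: row_def vector_3 vec_eq_iff)
  then have "det ?M = 0" by (rule det_zero_row)
  then obtain k where k: "k \<noteq> 0" "?M *v k = 0" by (rule singular_kernel)
  have "(?M *v k) $ 1 = 0" "(?M *v k) $ 2 = 0" using k(2) by simp_all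
  with k(1) show ?thesis by (intro that[of k]) (simp_all add: matrix_vector_mult_def vector_3 mult.commute)
qed

text \<open>Along a geodesic all solutions satisfy the same second order equation \<open>y'' = q y' - P y\<close>,
  so the combination vanishing to first order at one point vanishes along the whole curve.\<close>

theorem geodesic_iff_line:
  fixes \<sigma> :: "3 \<Rightarrow> complex^2 \<Rightarrow> complex"
  assumes U: "open U" and \<sigma>: "\<And>a. hess_solution \<gamma> p U (\<sigma> a)"
    and indep: "\<And>z k. z \<in> U \<Longrightarrow> (\<Sum>a\<in>UNIV. k $ a * \<sigma> a z) = 0 \<Longrightarrow>
      (\<And>i. (\<Sum>a\<in>UNIV. k $ a * cpartial i (\<sigma> a) z) = 0) \<Longrightarrow> k = 0"
    and \<gamma>: "\<And>k i j. holo_fun (\<lambda>z. \<gamma> z $ k $ i $ j) U" and p: "\<And>i j. holo_fun (p i j) U"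
    and T: "open T" "connected T" and c: "\<And>i. (\<lambda>s. c s $ i) holomorphic_on T" and cU: "c ` T \<subseteq> U"
    and c': "\<And>t. t \<in> T \<Longrightarrow> cderiv c t \<noteq> 0"
  shows "(\<forall>t\<in>T. \<exists>q. \<forall>k. acc \<gamma> c t k = q * cderiv c t $ k) \<longleftrightarrow>
     (\<exists>k. k \<noteq> 0 \<and> (\<forall>t\<in>T. (\<Sum>a\<in>UNIV. k $ a * \<sigma> a (c t)) = 0))"
proof
  assume geo: "\<forall>t\<in>T. \<exists>q. \<forall>k. acc \<gamma> c t k = q * cderiv c t $ k"
  show "\<exists>k. k \<noteq> 0 \<and> (\<forall>t\<in>T. (\<Sum>a\<in>UNIV. k $ a * \<sigma> a (c t)) = 0)"
  proof (cases "T = {}")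
    case True
    then show ?thesis by (intro exI[of _ "axis 1 1"]) simp
  next
    case False
    then obtain t0 where t0: "t0 \<in> T" by blast
    \<comment> \<open>The combination whose value and whose derivative along the curve both vanish
      at \<open>t0\<close>.\<close>
    obtain k where k: "k \<noteq> 0" "(\<Sum>a\<in>UNIV. k $ a * (\<chi> a. \<sigma> a (c t0)) $ a) = 0"
      "(\<Sum>a\<in>UNIV. k $ a * (\<chi> a. \<Sum>i\<in>UNIV. cpartial i (\<sigma> a) (c t0) * cderiv c t0 $ i) $ a) = 0"
      by (rule two_equations)
    define h where "h = (\<lambda>z. \<Sum>a\<in>UNIV. k $ a * \<sigma> a z)"
    have h: "hess_solution \<gamma> p U h" unfolding h_def by (rule hess_solution_combination(1)[OF U \<sigma>])
    have hp: "cpartial i h z = (\<Sum>a\<in>UNIV. k $ a * cpartial i (\<sigma> a) z)" if "z \<in> U" for i z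
      unfolding h_def by (rule hess_solution_combination(2)[OF U \<sigma> that])
    define y where "y = (\<lambda>s. h (c s))"
    note curve = hess_curve_holomorphic[OF T(1) c cU U h, folded y_def] hess_curve_deriv[OF T(1) c cU U h, folded y_def]
      hess_curve_deriv2[OF T(1) c cU U h, folded y_def]
    obtain j where j: "cderiv c t0 $ j \<noteq> 0" using c'[OF t0] by (auto simp: vec_eq_iff)
    \<comment> \<open>The factor q is read off from a component of c' that is nonzero at
      \<open>t0\<close>, so its holomorphy is known only where that component does not vanish. This
      suffices: the equation is needed only to kill all derivatives at \<open>t0\<close>, and the
      identity theorem covers the connected set T.\<close>
    define T1 where "T1 = {t \<in> T. cderiv c t $ j \<noteq> 0}"
    have ch: "(\<lambda>s. cderiv c s $ i) holomorphic_on T" for i by (rule cderiv_holomorphic[OF T(1) c])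
    have T1: "open T1"
    proof -
      have "continuous_on T (\<lambda>s. cderiv c s $ j)" by (rule holomorphic_on_imp_continuous_on[OF ch])
      from continuous_open_preimage[OF this T(1), of "- {0}"]
      have "open (T \<inter> (\<lambda>s. cderiv c s $ j) -` (- {0}))" by auto
      moreover have "T1 = T \<inter> (\<lambda>s. cderiv c s $ j) -` (- {0})" by (auto simp: T1_def)
      ultimately show ?thesis by simp
    qed
    have T1T: "T1 \<subseteq> T" "t0 \<in> T1" using t0 j by (auto simp: T1_def)
    have comp: "(\<lambda>t. f (c t)) holomorphic_on T" if "holo_fun f U" for f
      unfolding holomorphic_on_open[OF T(1)]
      using cdiff_curve[OF holo_funD[OF that] cderiv_has_derivative[OF T(1) _ c]] cU by blast
    define q where "q = (\<lambda>t. acc \<gamma> c t j / cderiv c t $ j)"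
    define P where "P = (\<lambda>t. \<Sum>i\<in>UNIV. \<Sum>j\<in>UNIV. p i j (c t) * cderiv c t $ i * cderiv c t $ j)"
    have "(\<lambda>t. acc \<gamma> c t j) holomorphic_on T"
      unfolding acc_def by (intro holomorphic_intros cderiv_holomorphic[OF T(1) ch] comp \<gamma> ch)
    then have q: "q holomorphic_on T1"
      unfolding q_def by (intro holomorphic_on_divide holomorphic_on_subset[OF _ T1T(1)] ch) (auto simp: T1_def)
    have P: "P holomorphic_on T1"
      unfolding P_def by (intro holomorphic_on_subset[OF _ T1T(1)] holomorphic_intros comp p ch)
    have ode: "deriv (deriv y) t = q t * deriv y t - P t * y t" if t: "t \<in> T1" for t
    proof -
      have tT: "t \<in> T" using t T1T by auto
      obtain q0 where q0: "\<And>k. acc \<gamma> c t k = q0 * cderiv c t $ k" using geo tT by blast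
      then have "q t = q0" using t by (simp add: q_def T1_def)
      then show ?thesis
        using curve(2)[OF tT] curve(3)[OF tT] by (simp add: q0 P_def y_def sum_distrib_left mult_ac)
    qed
    have init: "y t0 = 0" "deriv y t0 = 0"
    proof -
      show "y t0 = 0" using k(2) by (simp add: y_def h_def)
      have "c t0 \<in> U" using cU t0 by auto
      then show "deriv y t0 = 0" using k(3) unfolding curve(2)[OF t0]
        by (simp add: hp sum_2 sum_3 algebra_simps)
    qed
    have zero: "(deriv ^^ n) y t0 = 0" for n
      by (rule ode2_derivs_zero[OF T1 T1T(2) holomorphic_on_subset[OF curve(1) T1T(1)] q P ode init])
    have "y t = 0" if "t \<in> T" for t
      by (rule holomorphic_fun_eq_0_on_connected[OF curve(1) T zero t0 that])
    with k(1) show ?thesis by (auto simp: y_def h_def)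
  qed
next
  assume "\<exists>k. k \<noteq> 0 \<and> (\<forall>t\<in>T. (\<Sum>a\<in>UNIV. k $ a * \<sigma> a (c t)) = 0)"
  then obtain k where k: "k \<noteq> 0" "\<And>t. t \<in> T \<Longrightarrow> (\<Sum>a\<in>UNIV. k $ a * \<sigma> a (c t)) = 0" by blast
  define h where "h = (\<lambda>z. \<Sum>a\<in>UNIV. k $ a * \<sigma> a z)"
  have h: "hess_solution \<gamma> p U h" unfolding h_def by (rule hess_solution_combination(1)[OF U \<sigma>])
  have hp: "cpartial i h z = (\<Sum>a\<in>UNIV. k $ a * cpartial i (\<sigma> a) z)" if "z \<in> U" for i z
    unfolding h_def by (rule hess_solution_combination(2)[OF U \<sigma> that])
  show "\<forall>t\<in>T. \<exists>q. \<forall>k. acc \<gamma> c t k = q * cderiv c t $ k"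
  proof
    fix t assume t: "t \<in> T"
    then have ct: "c t \<in> U" using cU by auto
    have hc: "h (c s) = 0" if "s \<in> T" for s using k(2)[OF that] by (simp add: h_def)
    have d0: "deriv (\<lambda>s. h (c s)) s = 0" if "s \<in> T" for s
    proof -
      have "\<forall>\<^sub>F u in nhds s. h (c u) = 0"
        using eventually_nhds_in_open[OF T(1) that] by (auto elim: eventually_mono simp: hc)
      then have "deriv (\<lambda>s. h (c s)) s = deriv (\<lambda>s. 0) s" by (intro deriv_cong_ev) auto
      then show ?thesis by simp
    qed
    have "\<forall>\<^sub>F u in nhds t. deriv (\<lambda>s. h (c s)) u = 0"
      using eventually_nhds_in_open[OF T(1) t] by (auto elim: eventually_mono simp: d0)
    then have "deriv (deriv (\<lambda>s. h (c s))) t = deriv (\<lambda>s. 0) t" by (intro deriv_cong_ev) auto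
    then have d1: "deriv (deriv (\<lambda>s. h (c s))) t = 0" by simp
    \<comment> \<open>Two derivatives of h(c) = 0 give dh(c') = 0 and dh(acceleration) = 0. As dh is
      nonzero on a plane, the acceleration is proportional to c'.\<close>
    have "\<exists>q. \<forall>k. (\<chi> k. acc \<gamma> c t k) $ k = q * cderiv c t $ k"
    proof (rule kernel_2[of "\<chi> i. cpartial i h (c t)"])
      show "(\<chi> i. cpartial i h (c t)) \<noteq> 0"
      proof
        assume "(\<chi> i. cpartial i h (c t)) = 0"
        then have "(\<Sum>a\<in>UNIV. k $ a * cpartial i (\<sigma> a) (c t)) = 0" for i
          using hp[OF ct, of i] by (simp add: vec_eq_iff)
        from indep[OF ct k(2)[OF t] this] k(1) show False by simp
      qed
      show "(\<Sum>i\<in>UNIV. (\<chi> i. cpartial i h (c t)) $ i * cderiv c t $ i) = 0"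
        using hess_curve_deriv[OF T(1) c cU U h t] d0[OF t] by simp
      show "(\<Sum>i\<in>UNIV. (\<chi> i. cpartial i h (c t)) $ i * (\<chi> k. acc \<gamma> c t k) $ i) = 0"
        using hess_curve_deriv2[OF T(1) c cU U h t] d1 hc[OF t] by simp
    qed (rule c'[OF t])
    then show "\<exists>q. \<forall>k. acc \<gamma> c t k = q * cderiv c t $ k" by simp
  qed
qed

text \<open>The real inverse function theorem applies because the partial derivatives are
  continuous. The inverse of a complex linear bijection is complex linear, so the local inverse is
  holomorphic.\<close>

lemma holo_inverse_function:
  fixes \<phi> :: "complex^'n::finite \<Rightarrow> complex^'n"
  assumes U: "open U" "z0 \<in> U" and \<phi>: "holo_map \<phi> U"
    and inj: "\<And>v. (\<And>k. (\<Sum>i\<in>UNIV. cpartial i (\<lambda>w. \<phi> w $ k) z0 * v $ i) = 0) \<Longrightarrow> v = 0"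
  obtains U' V \<psi> where "open U'" "z0 \<in> U'" "U' \<subseteq> U" "open V" "homeomorphism U' V \<phi> \<psi>" "holo_map \<psi> V"
proof -
  define L where "L = (\<lambda>z (v::complex^'n). \<chi> k. \<Sum>i\<in>UNIV. cpartial i (\<lambda>w. \<phi> w $ k) z * v $ i)"
  have hk: "holo_fun (\<lambda>w. \<phi> w $ k) U" for k using \<phi> by (simp add: holo_map_def)
  have Ladd: "L z (u + v) = L z u + L z v" and Lsc: "L z (c *s v) = c *s L z v" for z u v c
    by (simp_all add: L_def vec_eq_iff algebra_simps sum.distrib sum_distrib_left)
  have Lr: "L z (r *\<^sub>R v) = r *\<^sub>R L z v" for z r v
    using Lsc[of z "of_real r" v] by (simp add: of_real_smult)
  have Lbl: "bounded_linear (L z)" for z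
    by (rule linear_conv_bounded_linear[THEN iffD1], rule linearI) (auto simp: Ladd Lr)
  have der: "(\<phi> has_derivative L z) (at z)" if z: "z \<in> U" for z
  proof -
    have "((\<lambda>w. \<Sum>k\<in>UNIV. (\<phi> w $ k) *s axis k 1) has_derivative
        (\<lambda>v. \<Sum>k\<in>UNIV. (\<Sum>i\<in>UNIV. cpartial i (\<lambda>w. \<phi> w $ k) z * v $ i) *s axis k (1::complex))) (at z)"
      by (intro has_derivative_sum bounded_linear.has_derivative[OF bounded_linear_smult_vec]
          cdiff_has_derivative holo_funD[OF hk z])
    moreover have "(\<lambda>v. \<Sum>k\<in>UNIV. (\<Sum>i\<in>UNIV. cpartial i (\<lambda>w. \<phi> w $ k) z * v $ i) *s axis k (1::complex)) = L z"
      using basis_expansion[of "L z v" for v] by (simp add: L_def fun_eq_iff)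
    ultimately show ?thesis by (simp add: basis_expansion)
  qed
  define B where "B = (\<lambda>z. Blinfun (L z))"
  have B: "blinfun_apply (B z) = L z" for z unfolding B_def by (rule bounded_linear_Blinfun_apply[OF Lbl])
  have injL: "inj (L z0)"
  proof (rule injI)
    fix u v assume "L z0 u = L z0 v"
    then have "L z0 (u - v) = 0" using Ladd[of z0 "u - v" v] by simp
    then have "u - v = 0" by (intro inj) (simp add: L_def vec_eq_iff)
    then show "u = v" by simp
  qed
  have linL: "linear (L z0)" by (rule bounded_linear.linear[OF Lbl])
  obtain g0 where g0: "linear g0" "g0 \<circ> L z0 = id" using linear_injective_left_inverse[OF linL injL] by blast
  have g0b: "bounded_linear g0" using g0(1) linear_conv_bounded_linear by blast
  have inv: "Blinfun g0 o\<^sub>L B z0 = id_blinfun"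
    by (rule blinfun_eqI) (use g0(2) in \<open>simp add: B bounded_linear_Blinfun_apply[OF g0b] fun_eq_iff\<close>)
  have Bc: "continuous_on U B"
  proof (rule continuous_on_blinfun_componentwise)
    fix b :: "complex^'n"
    have "continuous_on U (cpartial i (\<lambda>w. \<phi> w $ k))" for i k
      by (rule holo_fun_continuous_on[OF holo_fun_cpartial[OF U(1) hk]])
    then show "continuous_on U (\<lambda>z. blinfun_apply (B z) b)"
      unfolding B L_def by (intro continuous_on_vec_lambda continuous_intros) auto
  qed
  obtain U' V g g' where g: "open U'" "U' \<subseteq> U" "z0 \<in> U'" "open V" "\<phi> z0 \<in> V" "homeomorphism U' V \<phi> g"
    "\<And>y. y \<in> V \<Longrightarrow> (g has_derivative (g' y)) (at y)"
    "\<And>y. y \<in> V \<Longrightarrow> g' y = inv (blinfun_apply (B (g y)))"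
    "\<And>y. y \<in> V \<Longrightarrow> bij (blinfun_apply (B (g y)))"
    by (rule inverse_function_theorem[OF U(1) der[folded B] Bc U(2) inv]; (assumption | (rule that; assumption)))
  have "holo_map g V"
    unfolding holo_map_def holo_fun_iff
  proof (intro allI ballI)
    fix k y assume y: "y \<in> V"
    have bij: "bij (L (g y))" and g'y: "g' y = inv (L (g y))" using g(8,9)[OF y] by (simp_all add: B)
    have Li: "L (g y) (g' y v) = v" "g' y (L (g y) v) = v" for v
      unfolding g'y using bij by (simp_all add: bij_is_surj surj_f_inv_f bij_is_inj inv_f_f)
    \<comment> \<open>Additivity and complex homogeneity of the inverse derivative, obtained by
      applying the complex linear derivative and cancelling.\<close>
    have 1: "g' y (u + v) = g' y u + g' y v" for u v
      using Li(2)[of "g' y u + g' y v"] by (simp add: Ladd Li(1))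
    have 2: "g' y (c *s v) = c *s g' y v" for c v
      using Li(2)[of "c *s g' y v"] by (simp add: Lsc Li(1))
    have sa: "(\<Sum>j\<in>UNIV. axis i 1 $ j * b j) = b i" for b :: "'n \<Rightarrow> complex" and i
      using sum_axis[of b i] by (simp add: mult.commute)
    have h1: "g' y v $ k = (\<Sum>i\<in>UNIV. g' y (axis i 1) $ k * v $ i)" for v
      by (rule linear_ext[where f="\<lambda>v. g' y v $ k" and x=v and g="\<lambda>v. \<Sum>i\<in>UNIV. g' y (axis i 1) $ k * v $ i"])
         (simp_all add: 1 2 sa algebra_simps sum.distrib sum_distrib_left)
    have h2: "((\<lambda>w. g w $ k) has_derivative (\<lambda>v. g' y v $ k)) (at y)"
      by (rule bounded_linear.has_derivative[OF bounded_linear_vec_nth g(7)[OF y]])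
    show "cdiff_at (\<lambda>w. g w $ k) y"
      by (rule cdiffI[where a="\<lambda>i. g' y (axis i 1) $ k"]) (use h2 in \<open>simp only: h1[symmetric]\<close>)
  qed
  with g show ?thesis by (intro that[of U' V g]) auto
qed

section \<open>Self-duality along a beta-surface\<close>

lemma sum_wedge: "(\<Sum>k\<in>UNIV. \<Sum>l\<in>UNIV. B k l * wedge u v $ k $ l) = bil B u v - bil B v u"
  by (simp add: wedge_def bil_def right_diff_distrib sum_subtractf mult_ac)

lemma bivector_wedge: "bivector (wedge u v)"
  by (simp add: bivector_def transpose_def wedge_def vec_eq_iff)

context metric4
begin

lemma Wl_skew2: "z \<in> S \<Longrightarrow> Wl z a b d c = - Wl z a b c d"
  using Wl_pair[of z a b d c] Wl_pair[of z a b c d] Wl_skew[of z d c a b] by simp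

lemma Wl_bil2: "z \<in> S \<Longrightarrow> Wl z a b c d = bil (\<lambda>k l. Wl z a b (axis k 1) (axis l 1)) c d"
  unfolding Wl_pair[of z a b] by (rule Wl_bil)

text \<open>Multiplication by the metric on both sides undoes the raising of indices in
  \<open>weyl_op\<close>; the result is then extended from basis vectors to all a and b.\<close>

lemma weyl_op_zero:
  assumes z: "z \<in> S" and 0: "weyl_op G z \<Phi> = 0"
  shows "(\<Sum>k\<in>UNIV. \<Sum>l\<in>UNIV. Wl z a b (axis k 1) (axis l 1) * \<Phi> $ k $ l) = 0"
proof -
  let ?I = "matrix_inv (G z)"
  let ?M = "\<chi> i j. (\<Sum>k\<in>UNIV. \<Sum>l\<in>UNIV. weyl_low G z i j k l * \<Phi> $ k $ l) / 2"
  have "G z ** (?I ** ?M ** ?I) ** G z = (G z ** ?I) ** ?M ** (?I ** G z)" by (simp only: matrix_mul_assoc)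
  also have "\<dots> = ?M" by (simp add: G_inv[OF z])
  finally have "?M = G z ** weyl_op G z \<Phi> ** G z" by (simp add: weyl_op_def)
  also have "\<dots> = 0" by (simp add: 0 matrix_matrix_mult_def vec_eq_iff)
  finally have "?M $ i $ j = 0" for i j by simp
  then have 1: "(\<Sum>k\<in>UNIV. \<Sum>l\<in>UNIV. Wl z (axis i 1) (axis j 1) (axis k 1) (axis l 1) * \<Phi> $ k $ l) = 0" for i j
    by (simp add: Wl_axis)
  have 2: "(\<Sum>k\<in>UNIV. \<Sum>l\<in>UNIV. Wl z (axis i 1) b (axis k 1) (axis l 1) * \<Phi> $ k $ l) = 0" for i
    by (rule linear_ext[where f="\<lambda>b. \<Sum>k\<in>UNIV. \<Sum>l\<in>UNIV. Wl z (axis i 1) b (axis k 1) (axis l 1) * \<Phi> $ k $ l"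
          and g="\<lambda>b. 0" and x=b])
       (simp_all only: 1 Wl_linear distrib_right sum.distrib sum_distrib_left mult.assoc, simp_all)
  show ?thesis
    by (rule linear_ext[where f="\<lambda>a. \<Sum>k\<in>UNIV. \<Sum>l\<in>UNIV. Wl z a b (axis k 1) (axis l 1) * \<Phi> $ k $ l"
          and g="\<lambda>a. 0" and x=a])
       (simp_all only: 2 Wl_linear distrib_right sum.distrib sum_distrib_left mult.assoc, simp_all)
qed

lemma weyl_op_wedge_zero:
  assumes z: "z \<in> S" and 0: "weyl_op G z (wedge u v) = 0"
  shows "Wl z a b u v = 0"
  using weyl_op_zero[OF z 0, of a b] Wl_skew2[OF z, of a b v u]
  by (simp add: sum_wedge flip: Wl_bil2[OF z])

text \<open>Only the differentiability of the anti-self-dual bivector field \<open>\<Phi>\<close> is needed, not that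
  its covariant derivative is anti-self-dual: the terms in which \<open>\<Phi>\<close> is differentiated vanish
  because the Weyl tensor is symmetric in its two pairs of arguments.\<close>

lemma dd_Wl_zero:
  assumes z: "z \<in> S" and 0: "\<And>y. y \<in> S \<Longrightarrow> weyl_op G y (\<Phi> y) = 0"
    and \<Phi>: "\<And>k l. cdiff_at (\<lambda>y. \<Phi> y $ k $ l) z" "\<Phi> z = wedge u v"
  shows "dd (\<lambda>w. Wl w u v u v) z t = 0"
proof -
  have W0: "Wl z a b u v = 0" for a b
    using weyl_op_wedge_zero[OF z] 0[OF z] \<Phi>(2) by simp
  have "dd (\<lambda>y. \<Sum>k\<in>UNIV. \<Sum>l\<in>UNIV. Wl y u v (axis k 1) (axis l 1) * \<Phi> y $ k $ l) z t = dd (\<lambda>y. 0) z t"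
    by (rule dd_cong[OF open_S z]) (rule weyl_op_zero[OF _ 0])
  then have "0 = (\<Sum>k\<in>UNIV. \<Sum>l\<in>UNIV. dd (\<lambda>y. Wl y u v (axis k 1) (axis l 1)) z t * wedge u v $ k $ l)"
    by (simp add: dd_sum cdiff_sum cdiff_mult dd_mult Wl_cdiff[OF z] \<Phi> Wl_pair[OF z, of u v] W0)
  also have "\<dots> = dd (\<lambda>w. Wl w u v u v) z t - dd (\<lambda>w. Wl w u v v u) z t"
  proof -
    have E: "dd (\<lambda>w. Wl w u v c d) z t = bil (\<lambda>k l. dd (\<lambda>y. Wl y u v (axis k 1) (axis l 1)) z t) c d" for c d
    proof -
      have "dd (\<lambda>w. Wl w u v c d) z t = dd (\<lambda>w. bil (\<lambda>k l. Wl w u v (axis k 1) (axis l 1)) c d) z t"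
        by (rule dd_cong[OF open_S z]) (rule Wl_bil2)
      then show ?thesis by (simp add: dd_bil_const Wl_cdiff[OF z])
    qed
    show ?thesis by (simp only: sum_wedge E[symmetric])
  qed
  \<comment> \<open>The two orders of u and v in the contraction with the wedge contribute equally,
    so twice the derivative vanishes.\<close>
  also have "dd (\<lambda>w. Wl w u v v u) z t = dd (\<lambda>w. (- 1) * Wl w u v u v) z t"
    by (rule dd_cong[OF open_S z]) (simp add: Wl_skew2[of _ u v v u])
  also have "\<dots> = - dd (\<lambda>w. Wl w u v u v) z t"
    by (subst dd_mult) (auto simp: Wl_cdiff[OF z])
  finally show ?thesis by simp
qed

end

lemma hodge_cdiff:
  assumes "\<And>i j. cdiff_at (\<lambda>y. G y $ i $ j) z" "cdiff_at s z" "s z \<noteq> 0"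
  shows "cdiff_at (\<lambda>y. hodge (G y) (s y) F $ k $ l) z"
  unfolding hodge_def matrix_matrix_mult_def vec_lambda_beta
  by (intro cdiff_divide cdiff_sum cdiff_mult cdiff_const assms) (use assms in auto)

section \<open>Geodesics of immersed surfaces and of conformally related metrics\<close>

definition hs :: "(complex^'n::finite \<Rightarrow> complex^'k::finite) \<Rightarrow> complex^'n \<Rightarrow> complex^'n \<Rightarrow> complex^'n \<Rightarrow> complex^'k" where
  "hs \<phi> z s v = (\<chi> k. bil (\<lambda>i j. cpartial i (cpartial j (\<lambda>w. \<phi> w $ k)) z) s v)"

lemma vd_linear:
  "vd \<phi> z (s + t) = vd \<phi> z s + vd \<phi> z t" "vd \<phi> z (c *s t) = c *s vd \<phi> z t" "vd \<phi> z (s - t) = vd \<phi> z s - vd \<phi> z t"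
  by (simp_all add: vec_eq_iff dd_linear)

lemma hs_commute:
  assumes "open U" "holo_map \<phi> U" "z \<in> U"
  shows "hs \<phi> z s v = hs \<phi> z v s"
proof -
  have "cpartial i (cpartial j (\<lambda>w. \<phi> w $ k)) z = cpartial j (cpartial i (\<lambda>w. \<phi> w $ k)) z" for i j k
    using assms by (intro cpartial_commute[of U]) (auto simp: holo_map_def)
  then show ?thesis unfolding hs_def by (simp add: vec_eq_iff bil_commute)
qed

lemma vd_vd:
  assumes "open U" "holo_map \<phi> U" "z \<in> U"
  shows "vd (\<lambda>w. vd \<phi> w v) z s = hs \<phi> z s v" and vd_cdiff: "cdiff_at (\<lambda>w. vd \<phi> w v $ k) z"
proof -
  have c: "cdiff_at (cpartial i (\<lambda>w. \<phi> w $ k)) z" for i k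
    using assms by (intro holo_funD[OF holo_fun_cpartial]) (auto simp: holo_map_def)
  show "cdiff_at (\<lambda>w. vd \<phi> w v $ k) z"
    unfolding vd_nth dd_def by (intro cdiff_intros c)
  have "dd (\<lambda>w. dd (\<lambda>w. \<phi> w $ k) w v) z s = bil (\<lambda>i j. cpartial i (cpartial j (\<lambda>w. \<phi> w $ k)) z) s v" for k
  proof -
    have "dd (\<lambda>w. dd (\<lambda>w. \<phi> w $ k) w v) z s
        = (\<Sum>j\<in>UNIV. dd (cpartial j (\<lambda>w. \<phi> w $ k)) z s * v $ j)"
      by (simp add: dd_def[of _ _ v] dd_sum dd_mult cdiff_mult c)
    also have "\<dots> = (\<Sum>j\<in>UNIV. \<Sum>i\<in>UNIV. cpartial i (cpartial j (\<lambda>w. \<phi> w $ k)) z * s $ i * v $ j)"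
      by (simp add: dd_def sum_distrib_right)
    also have "\<dots> = bil (\<lambda>i j. cpartial i (cpartial j (\<lambda>w. \<phi> w $ k)) z) s v"
      unfolding bil_def by (rule sum.swap)
    finally show ?thesis .
  qed
  then show "vd (\<lambda>w. vd \<phi> w v) z s = hs \<phi> z s v"
    by (simp add: vec_eq_iff hs_def)
qed

lemma
  fixes \<phi> :: "complex^'n::finite \<Rightarrow> complex^'k::finite"
  assumes U: "open U" and \<phi>: "holo_map \<phi> U" and T: "open T" and C: "\<And>i. (\<lambda>s. C s $ i) holomorphic_on T"
    and CU: "C ` T \<subseteq> U" and t: "t \<in> T"
  shows cderiv_compose: "cderiv (\<lambda>s. \<phi> (C s)) t = vd \<phi> (C t) (cderiv C t)"
    and cderiv2_compose: "cderiv (cderiv (\<lambda>s. \<phi> (C s))) t =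
      vd \<phi> (C t) (cderiv (cderiv C) t) + hs \<phi> (C t) (cderiv C t) (cderiv C t)"
    and holomorphic_compose: "(\<lambda>s. \<phi> (C s) $ k) holomorphic_on T"
proof -
  have hk: "holo_fun (\<lambda>w. \<phi> w $ k) U" for k using \<phi> by (simp add: holo_map_def)
  have D: "((\<lambda>s. h (C s)) has_field_derivative (\<Sum>i\<in>UNIV. cpartial i h (C t) * cderiv C t $ i)) (at t)"
    if "holo_fun h U" "t \<in> T" for h t
    by (rule cdiff_curve[OF holo_funD[OF that(1)] cderiv_has_derivative[OF T that(2) C]]) (use CU that in auto)
  have 1: "cderiv (\<lambda>s. \<phi> (C s)) t = vd \<phi> (C t) (cderiv C t)" if "t \<in> T" for t
    using D[OF hk that] by (simp add: vec_eq_iff cderiv_def[of "\<lambda>s. \<phi> (C s)"] dd_def DERIV_imp_deriv)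
  show "cderiv (\<lambda>s. \<phi> (C s)) t = vd \<phi> (C t) (cderiv C t)" by (rule 1[OF t])
  show "(\<lambda>s. \<phi> (C s) $ k) holomorphic_on T"
    unfolding holomorphic_on_open[OF T] using D[OF hk] by blast
  have "deriv (\<lambda>s. cderiv (\<lambda>s. \<phi> (C s)) s $ k) t = (vd \<phi> (C t) (cderiv (cderiv C) t) + hs \<phi> (C t) (cderiv C t) (cderiv C t)) $ k" for k
  proof (rule DERIV_imp_deriv)
    have "((\<lambda>s. \<Sum>i\<in>UNIV. cpartial i (\<lambda>w. \<phi> w $ k) (C s) * cderiv C s $ i) has_field_derivative
      (\<Sum>i\<in>UNIV. (\<Sum>j\<in>UNIV. cpartial j (cpartial i (\<lambda>w. \<phi> w $ k)) (C t) * cderiv C t $ j) * cderiv C t $ i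
        + cderiv (cderiv C) t $ i * cpartial i (\<lambda>w. \<phi> w $ k) (C t))) (at t)"
      by (intro DERIV_sum DERIV_mult D[OF holo_fun_cpartial[OF U hk] t]
          cderiv_has_derivative[OF T t cderiv_holomorphic[OF T C]])
    moreover have "(\<Sum>i\<in>UNIV. (\<Sum>j\<in>UNIV. cpartial j (cpartial i (\<lambda>w. \<phi> w $ k)) (C t) * cderiv C t $ j) * cderiv C t $ i)
        = hs \<phi> (C t) (cderiv C t) (cderiv C t) $ k"
      unfolding hs_def vec_lambda_beta bil_def sum_distrib_right by (rule sum.swap)
    ultimately have "((\<lambda>s. \<Sum>i\<in>UNIV. cpartial i (\<lambda>w. \<phi> w $ k) (C s) * cderiv C s $ i) has_field_derivative
        (vd \<phi> (C t) (cderiv (cderiv C) t) + hs \<phi> (C t) (cderiv C t) (cderiv C t)) $ k) (at t)"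
      by (simp add: sum.distrib dd_def mult.commute add.commute)
    then show "((\<lambda>s. cderiv (\<lambda>s. \<phi> (C s)) s $ k) has_field_derivative
        (vd \<phi> (C t) (cderiv (cderiv C) t) + hs \<phi> (C t) (cderiv C t) (cderiv C t)) $ k) (at t)"
      by (rule has_field_derivative_transform_within_open[OF _ T t]) (simp add: 1 dd_def)
  qed
  then show "cderiv (cderiv (\<lambda>s. \<phi> (C s))) t =
      vd \<phi> (C t) (cderiv (cderiv C) t) + hs \<phi> (C t) (cderiv C t) (cderiv C t)"
    by (simp only: vec_eq_iff cderiv_def[of "cderiv (\<lambda>s. \<phi> (C s))"] vec_lambda_beta) simp
qed

lemma axis_expansion_2: "(v :: complex^2) = v $ 1 *s axis 1 1 + v $ 2 *s axis 2 1"
  by (simp add: vec_eq_iff forall_2 axis_nth)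

text \<open>The analogue of \<open>geodesic_at\<close> for a coordinate curve in the
  four-dimensional space: acceleration proportional to velocity, so the parametrization is
  free.\<close>

definition pregeo :: "(complex^4 \<Rightarrow> complex^4^4) \<Rightarrow> (complex \<Rightarrow> complex^4) \<Rightarrow> complex \<Rightarrow> bool" where
  "pregeo G C t \<longleftrightarrow> (\<exists>q. \<forall>k. cderiv (cderiv C) t $ k
     + (\<Sum>i\<in>UNIV. \<Sum>j\<in>UNIV. christoffel G (C t) $ k $ i $ j * cderiv C t $ i * cderiv C t $ j) = q * cderiv C t $ k)"

context metric4
begin

lemma pregeo_iff: "pregeo G C t \<longleftrightarrow> (\<exists>q. cderiv (cderiv C) t + Ga (C t) (cderiv C t) (cderiv C t) = q *s cderiv C t)"
  by (simp add: pregeo_def vec_eq_iff Ga_def bil_def)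

lemma cov_coord_eq:
  "cov_coord G F z i j = hs F z (axis i 1) (axis j 1) + Ga (F z) (vd F z (axis i 1)) (vd F z (axis j 1))"
  by (simp add: vec_eq_iff cov_coord_def hs_def Ga_def bil_def[of _ "vd F z (axis i 1)"] jac_def)

text \<open>Since \<gamma> represents the tangential derivative, the differential of F carries the
  intrinsic acceleration to the ambient one. The differential is injective, so proportionality to
  the velocity is reflected as well.\<close>

lemma induced_geodesic_iff:
  assumes D: "open D" and F: "holo_map F D" and T: "open T" and c: "\<And>i. (\<lambda>s. c s $ i) holomorphic_on T"
    and cD: "c ` T \<subseteq> D" and t: "t \<in> T"
    and geod: "\<And>i j. cov_coord G F (c t) i j = (\<Sum>k\<in>UNIV. \<gamma> (c t) $ k $ i $ j *s vd F (c t) (axis k 1))"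
    and indep: "\<And>v. vd F (c t) v = 0 \<Longrightarrow> v = 0"
  shows "(\<exists>q. \<forall>k. acc \<gamma> c t k = q * cderiv c t $ k) \<longleftrightarrow> pregeo G (\<lambda>s. F (c s)) t"
proof -
  let ?z = "c t" and ?v = "cderiv c t" and ?a = "cderiv (cderiv c) t"
  have v: "?v = ?v $ 1 *s axis 1 1 + ?v $ 2 *s axis 2 1" by (rule axis_expansion_2)
  have H: "hs F ?z ?v ?v + Ga (F ?z) (vd F ?z ?v) (vd F ?z ?v)
     = (\<Sum>i\<in>UNIV. \<Sum>j\<in>UNIV. (?v $ i * ?v $ j) *s cov_coord G F ?z i j)"
  proof -
    have h: "hs F ?z ?v ?v = (\<Sum>i\<in>UNIV. \<Sum>j\<in>UNIV. (?v $ i * ?v $ j) *s hs F ?z (axis i 1) (axis j 1))"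
      by (simp add: vec_eq_iff hs_def bil_def[of _ ?v] mult_ac)
    have "Ga (F ?z) (vd F ?z ?v) (vd F ?z ?v)
      = (\<Sum>i\<in>UNIV. \<Sum>j\<in>UNIV. (?v $ i * ?v $ j) *s Ga (F ?z) (vd F ?z (axis i 1)) (vd F ?z (axis j 1)))"
      by (subst (1 2) v) (simp add: vd_linear Ga_linear sum_2 vec_eq_iff algebra_simps)
    with h show ?thesis
      by (simp add: cov_coord_eq sum.distrib vector_add_ldistrib)
  qed
  have E: "cderiv (cderiv (\<lambda>s. F (c s))) t + Ga (F ?z) (cderiv (\<lambda>s. F (c s)) t) (cderiv (\<lambda>s. F (c s)) t)
      = vd F ?z (\<chi> k. acc \<gamma> c t k)"
  proof -
    have "cderiv (cderiv (\<lambda>s. F (c s))) t + Ga (F ?z) (cderiv (\<lambda>s. F (c s)) t) (cderiv (\<lambda>s. F (c s)) t)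
      = vd F ?z ?a + (hs F ?z ?v ?v + Ga (F ?z) (vd F ?z ?v) (vd F ?z ?v))"
      by (simp add: cderiv_compose[OF D F T c cD t] cderiv2_compose[OF D F T c cD t])
    also have "\<dots> = vd F ?z ?a + (\<Sum>i\<in>UNIV. \<Sum>j\<in>UNIV. (?v $ i * ?v $ j) *s
        (\<Sum>k\<in>UNIV. \<gamma> ?z $ k $ i $ j *s vd F ?z (axis k 1)))"
      unfolding H geod ..
    also have "\<dots> = vd F ?z (\<chi> k. acc \<gamma> c t k)"
      by (subst axis_expansion_2[of ?a], subst axis_expansion_2[of "\<chi> k. acc \<gamma> c t k"])
         (simp add: vd_linear acc_def sum_2 vec_eq_iff algebra_simps)
    finally show ?thesis .
  qed
  show ?thesis
  proof
    assume "\<exists>q. \<forall>k. acc \<gamma> c t k = q * ?v $ k"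
    then obtain q where "(\<chi> k. acc \<gamma> c t k) = q *s ?v" by (auto simp: vec_eq_iff)
    then show "pregeo G (\<lambda>s. F (c s)) t"
      unfolding pregeo_iff E by (intro exI[of _ q]) (simp add: vd_linear cderiv_compose[OF D F T c cD t])
  next
    assume "pregeo G (\<lambda>s. F (c s)) t"
    then obtain q where "vd F ?z (\<chi> k. acc \<gamma> c t k) = q *s vd F ?z ?v"
      unfolding pregeo_iff E by (auto simp: cderiv_compose[OF D F T c cD t])
    then have "vd F ?z ((\<chi> k. acc \<gamma> c t k) - q *s ?v) = 0" by (simp add: vd_linear)
    from indep[OF this] show "\<exists>q. \<forall>k. acc \<gamma> c t k = q * ?v $ k"
      by (intro exI[of _ q]) (simp add: vec_eq_iff)
  qed
qed

end

text \<open>Lowering the index of the geodesic equation gives the Euler-Lagrange expression of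
  \<open>G(C', C')/2\<close>, which is natural under coordinate changes. A conformal factor adds a multiple of
  \<open>G(C', C')\<close>, zero for null curves, and a multiple of \<open>G C'\<close>.\<close>

lemma pregeo_transform:
  assumes M: "metric4 G O1" and M': "metric4 G' O2" and \<phi>: "holo_map \<phi> O1" and \<phi>O: "\<phi> ` O1 \<subseteq> O2"
    and \<rho>: "holo_fun \<rho> O1"
    and rel: "\<And>z i j. z \<in> O1 \<Longrightarrow> G z $ i $ j = \<rho> z * bil (\<lambda>a b. G' (\<phi> z) $ a $ b) (vd \<phi> z (axis i 1)) (vd \<phi> z (axis j 1))"
    and T: "open T" and C: "\<And>i. (\<lambda>s. C s $ i) holomorphic_on T" and CO: "C ` T \<subseteq> O1" and t: "t \<in> T"
    and null: "bil (\<lambda>a b. G' (\<phi> (C t)) $ a $ b) (cderiv (\<lambda>s. \<phi> (C s)) t) (cderiv (\<lambda>s. \<phi> (C s)) t) = 0"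
    and geo: "pregeo G' (\<lambda>s. \<phi> (C s)) t"
  shows "pregeo G C t"
proof -
  interpret M: metric4 G O1 by (rule M)
  interpret M': metric4 G' O2 by (rule M')
  let ?x = "C t" and ?v = "cderiv C t" and ?a = "cderiv (cderiv C) t"
  let ?J = "vd \<phi> ?x" and ?H = "hs \<phi> ?x"
  have x: "?x \<in> O1" using CO t by auto
  then have y: "\<phi> ?x \<in> O2" using \<phi>O by auto
  have \<phi>c: "cdiff_at (\<lambda>w. \<phi> w $ k) z" if "z \<in> O1" for k z
    using \<phi> that by (auto simp: holo_map_def dest: holo_funD)
  have gm: "M.gm z v w = \<rho> z * M'.gm (\<phi> z) (vd \<phi> z v) (vd \<phi> z w)" if "z \<in> O1" for z v w
  proof -
    have 1: "M.gm z (axis i 1) (axis j 1) = \<rho> z * M'.gm (\<phi> z) (vd \<phi> z (axis i 1)) (vd \<phi> z (axis j 1))" for i j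
      using rel[OF that] by (simp add: M.gm_def M'.gm_def)
    have 2: "M.gm z (axis i 1) w = \<rho> z * M'.gm (\<phi> z) (vd \<phi> z (axis i 1)) (vd \<phi> z w)" for i
      by (rule linear_ext[where f="\<lambda>w. M.gm z (axis i 1) w" and x=w and
            g="\<lambda>w. \<rho> z * M'.gm (\<phi> z) (vd \<phi> z (axis i 1)) (vd \<phi> z w)"])
         (simp_all add: 1 M.gm_linear M'.gm_linear vd_linear algebra_simps)
    show ?thesis
      by (rule linear_ext[where f="\<lambda>v. M.gm z v w" and x=v and g="\<lambda>v. \<rho> z * M'.gm (\<phi> z) (vd \<phi> z v) (vd \<phi> z w)"])
         (simp_all add: 2 M.gm_linear M'.gm_linear vd_linear algebra_simps)
  qed
  \<comment> \<open>The product rule applied to the rescaled pullback metric; the second derivatives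
    of \<phi> enter through its differential.\<close>
  have g1: "M.g1 ?x s v w = dd \<rho> ?x s * M'.gm (\<phi> ?x) (?J v) (?J w)
      + \<rho> ?x * (M'.g1 (\<phi> ?x) (?J s) (?J v) (?J w) + M'.gm (\<phi> ?x) (?H s v) (?J w) + M'.gm (\<phi> ?x) (?J v) (?H s w))" for s v w
  proof -
    note vc = vd_cdiff[OF M.open_S \<phi> x]
    note Gc = cdiff_compose[OF \<phi>c[OF x] M'.G_cdiff[OF y]]
    have c: "cdiff_at (\<lambda>z. M'.gm (\<phi> z) (vd \<phi> z v) (vd \<phi> z w)) ?x"
      unfolding M'.gm_def by (rule cdiff_bil[OF Gc vc vc])
    have "M.g1 ?x s v w = dd (\<lambda>z. M.gm z v w) ?x s"
      using M.dd_gm[OF x, of "\<lambda>z. v" "\<lambda>z. w" s] by (simp add: M.gm_linear)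
    also have "\<dots> = dd (\<lambda>z. \<rho> z * M'.gm (\<phi> z) (vd \<phi> z v) (vd \<phi> z w)) ?x s"
      by (rule dd_cong[OF M.open_S x gm])
    also have "\<dots> = \<rho> ?x * dd (\<lambda>z. M'.gm (\<phi> z) (vd \<phi> z v) (vd \<phi> z w)) ?x s + dd \<rho> ?x s * M'.gm (\<phi> ?x) (?J v) (?J w)"
      by (rule dd_mult[OF holo_funD[OF \<rho> x] c])
    also have "dd (\<lambda>z. M'.gm (\<phi> z) (vd \<phi> z v) (vd \<phi> z w)) ?x s
       = M'.g1 (\<phi> ?x) (?J s) (?J v) (?J w) + M'.gm (\<phi> ?x) (?H s v) (?J w) + M'.gm (\<phi> ?x) (?J v) (?H s w)"
      using dd_bil[where B="\<lambda>z a b. G' (\<phi> z) $ a $ b" and V="\<lambda>z. vd \<phi> z v" and W="\<lambda>z. vd \<phi> z w" and t=s, OF Gc vc vc]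
        dd_compose[OF \<phi>c[OF x] M'.G_cdiff[OF y]]
      by (simp add: M'.gm_def M'.g1_def vd_vd[OF M.open_S \<phi> x])
    finally show ?thesis by simp
  qed
  have d1: "cderiv (\<lambda>s. \<phi> (C s)) t = ?J ?v" by (rule cderiv_compose[OF M.open_S \<phi> T C CO t])
  have d2: "cderiv (cderiv (\<lambda>s. \<phi> (C s))) t = ?J ?a + ?H ?v ?v" by (rule cderiv2_compose[OF M.open_S \<phi> T C CO t])
  have n: "M'.gm (\<phi> ?x) (?J ?v) (?J ?v) = 0" using null by (simp add: M'.gm_def d1)
  obtain q where q: "?J ?a + ?H ?v ?v + M'.Ga (\<phi> ?x) (?J ?v) (?J ?v) = q *s ?J ?v"
    using geo unfolding M'.pregeo_iff d1 d2 by blast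
  have Hc: "?H w ?v = ?H ?v w" for w by (rule hs_commute[OF M.open_S \<phi> x])
  \<comment> \<open>Koszul's formula on both sides. The conformal factor contributes d\<rho>(v)
    g'(Jw, Jv) and a multiple of d\<rho>(w) g'(Jv, Jv), of which the latter is zero for a null
    curve.\<close>
  have "M.gm ?x w (?a + M.Ga ?x ?v ?v) = \<rho> ?x * M'.gm (\<phi> ?x) (?J w) (?J ?a + ?H ?v ?v + M'.Ga (\<phi> ?x) (?J ?v) (?J ?v))
      + dd \<rho> ?x ?v * M'.gm (\<phi> ?x) (?J w) (?J ?v)" for w
    unfolding M.gm_linear M'.gm_linear M.koszul[OF x] M'.koszul[OF y]
    unfolding g1 gm[OF x] n Hc[of w]
    using M'.g1_commute[OF y, of "?J ?v" "?J w" "?J ?v"] M'.gm_commute[OF y, of "?H ?v w" "?J ?v"]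
      M'.gm_commute[OF y, of "?H ?v ?v" "?J w"] M'.gm_commute[OF y, of "?J ?v" "?J w"]
    by (simp add: field_simps)
  also have "\<dots> w = (\<rho> ?x * q + dd \<rho> ?x ?v) * M'.gm (\<phi> ?x) (?J w) (?J ?v)" for w
    unfolding q by (simp add: M'.gm_linear algebra_simps)
  finally have e: "M.gm ?x w (?a + M.Ga ?x ?v ?v) = (\<rho> ?x * q + dd \<rho> ?x ?v) * M'.gm (\<phi> ?x) (?J w) (?J ?v)" for w .
  show ?thesis
  \<comment> \<open>A zero of \<rho> would make the metric G degenerate at that point.\<close>
  proof (cases "\<rho> ?x = 0")
    case True
    then have "M.gm ?x v w = 0" for v w by (simp add: gm[OF x])
    then have "axis 1 1 = (0 :: complex^4)" by (intro M.gm_nondegenerate[OF x])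
    then show ?thesis by (metis axis_nth zero_index zero_neq_one)
  next
    case False
    have "M.gm ?x (?a + M.Ga ?x ?v ?v - (q + dd \<rho> ?x ?v / \<rho> ?x) *s ?v) w = 0" for w
      using e[of w] False unfolding M.gm_commute[OF x, of _ w] M.gm_linear gm[OF x, of w ?v]
      by (simp add: field_simps)
    then have "?a + M.Ga ?x ?v ?v - (q + dd \<rho> ?x ?v / \<rho> ?x) *s ?v = 0" by (rule M.gm_nondegenerate[OF x])
    then show ?thesis unfolding M.pregeo_iff by (intro exI[of _ "q + dd \<rho> ?x ?v / \<rho> ?x"]) simp
  qed
qed

section \<open>The induced connection\<close>

text \<open>If u has nonzero entry r and all minors involving row r vanish, then v is a multiple of
  u.\<close>

lemma minor_nonzero:
  fixes u v :: "complex^'n::finite"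
  assumes "\<And>a b. a *s u + b *s v = 0 \<Longrightarrow> a = 0 \<and> b = 0"
  obtains r s where "u $ r * v $ s - u $ s * v $ r \<noteq> 0"
proof -
  have "u \<noteq> 0" using assms[of 1 0] by auto
  then obtain r where r: "u $ r \<noteq> 0" by (auto simp: vec_eq_iff)
  show ?thesis
  proof (rule ccontr)
    assume "\<not> thesis"
    then have "u $ r * v $ s - u $ s * v $ r = 0" for s using that by blast
    then have "(- v $ r) *s u + u $ r *s v = 0" by (simp add: vec_eq_iff algebra_simps)
    with assms r show False by blast
  qed
qed

text \<open>The coefficients of a tangent vector with respect to X1 and X2 are found by Cramer's
  rule from two rows with a nonvanishing minor. This makes them holomorphic wherever the minor stays
  nonzero, which determines \<open>D'\<close>.\<close>

lemma (in metric4) induced_connection_local: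
  assumes D: "open D" and F: "holo_map F D" and FD: "F ` D \<subseteq> S" and z0: "z0 \<in> D"
    and indep: "\<And>z v. z \<in> D \<Longrightarrow> vd F z v = 0 \<Longrightarrow> v = 0"
    and geod: "\<And>z i j. z \<in> D \<Longrightarrow> \<exists>v. cov_coord G F z i j = vd F z v"
  obtains D' and \<gamma> :: "complex^2 \<Rightarrow> complex^2^2^2" where "open D'" "z0 \<in> D'" "D' \<subseteq> D"
    "\<And>k i j. holo_fun (\<lambda>z. \<gamma> z $ k $ i $ j) D'" "\<And>z k i j. z \<in> D' \<Longrightarrow> \<gamma> z $ k $ i $ j = \<gamma> z $ k $ j $ i"
    "\<And>z i j. z \<in> D' \<Longrightarrow> cov_coord G F z i j = (\<Sum>k\<in>UNIV. \<gamma> z $ k $ i $ j *s vd F z (axis k 1))"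
proof -
  define X where "X = (\<lambda>i z. vd F z (axis i 1))"
  have vX: "vd F z v = v $ 1 *s X 1 z + v $ 2 *s X 2 z" for z v
    by (subst axis_expansion_2[of v]) (simp add: X_def vd_linear)
  have Fk: "holo_fun (\<lambda>w. F w $ k) D" for k using F by (simp add: holo_map_def)
  have Xh: "cdiff_at (\<lambda>w. X i w $ k) z" if "z \<in> D" for i k z
    unfolding X_def by (rule vd_cdiff[OF D F that])
  have ind: "a = 0 \<and> b = 0" if "a *s X 1 z0 + b *s X 2 z0 = 0" for a b
    using indep[OF z0, of "vector [a, b]"] that by (simp add: vX vector_2) (simp add: vec_eq_iff forall_2 vector_2)
  obtain r s where rs: "X 1 z0 $ r * X 2 z0 $ s - X 1 z0 $ s * X 2 z0 $ r \<noteq> 0"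
    using minor_nonzero[OF ind] by blast
  define m where "m = (\<lambda>z. X 1 z $ r * X 2 z $ s - X 1 z $ s * X 2 z $ r)"
  have mh: "cdiff_at m z" if "z \<in> D" for z unfolding m_def by (intro cdiff_intros Xh that)
  define D' where "D' = {z \<in> D. m z \<noteq> 0}"
  have D'D: "D' \<subseteq> D" and z0': "z0 \<in> D'" using z0 rs by (auto simp: D'_def m_def)
  have D': "open D'"
  proof -
    have "continuous_on D m" using mh by (simp add: cdiff_isCont continuous_at_imp_continuous_on)
    from continuous_open_preimage[OF this D, of "- {0}"] have "open (D \<inter> m -` (- {0}))" by auto
    moreover have "D' = D \<inter> m -` (- {0})" by (auto simp: D'_def)
    ultimately show ?thesis by simp
  qed
  define N where "N = cov_coord G F"
  have Nh: "cdiff_at (\<lambda>z. N z i j $ k) z" if z: "z \<in> D" for i j k z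
  proof -
    have zS: "F z \<in> S" using FD z by auto
    have "cdiff_at (\<lambda>z. cpartial i (cpartial j (\<lambda>w. F w $ k)) z) z"
      by (rule holo_funD[OF holo_fun_cpartial[OF D holo_fun_cpartial[OF D Fk]] z])
    moreover have "cdiff_at (\<lambda>z. Ga (F z) (X i z) (X j z) $ k) z"
      unfolding Ga_def vec_lambda_beta
      by (rule cdiff_bil) (auto intro: cdiff_compose[OF holo_funD[OF Fk z] christoffel_cdiff[OF zS]] Xh[OF z])
    ultimately show ?thesis
      unfolding N_def cov_coord_eq X_def by (simp add: hs_def cdiff_add)
  qed
  have Nsym: "N z i j = N z j i" if z: "z \<in> D" for z i j
    unfolding N_def cov_coord_eq using hs_commute[OF D F z] Ga_commute[of "F z"] FD z by auto
  define \<gamma> :: "complex^2 \<Rightarrow> complex^2^2^2" where "\<gamma> = (\<lambda>z. \<chi> k i j. if k = 1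
     then (N z i j $ r * X 2 z $ s - N z i j $ s * X 2 z $ r) / m z
     else (X 1 z $ r * N z i j $ s - X 1 z $ s * N z i j $ r) / m z)"
  have \<gamma>1: "\<gamma> z $ 1 $ i $ j = (N z i j $ r * X 2 z $ s - N z i j $ s * X 2 z $ r) / m z" for z i j
    by (simp add: \<gamma>_def)
  have \<gamma>2: "\<gamma> z $ 2 $ i $ j = (X 1 z $ r * N z i j $ s - X 1 z $ s * N z i j $ r) / m z" for z i j
    by (simp add: \<gamma>_def)
  show ?thesis
  proof (rule that[OF D' z0' D'D, of \<gamma>])
    show "holo_fun (\<lambda>z. \<gamma> z $ k $ i $ j) D'" for k i j
      using exhaust_2[of k] unfolding holo_fun_iff
      by (elim disjE; simp only: \<gamma>1 \<gamma>2)
         (auto simp: D'_def intro!: cdiff_divide cdiff_diff cdiff_mult Nh Xh mh)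
    show "\<gamma> z $ k $ i $ j = \<gamma> z $ k $ j $ i" if "z \<in> D'" for z k i j
      using Nsym[of z i j] that D'D by (auto simp: \<gamma>_def)
    fix z i j assume z: "z \<in> D'"
    then have zD: "z \<in> D" and m: "m z \<noteq> 0" by (auto simp: D'_def)
    obtain v where "N z i j = vd F z v" using geod[OF zD] by (auto simp: N_def)
    then have v: "N z i j $ k = v $ 1 * X 1 z $ k + v $ 2 * X 2 z $ k" for k by (simp add: vX)
    have "\<gamma> z $ 1 $ i $ j = v $ 1" "\<gamma> z $ 2 $ i $ j = v $ 2"
      unfolding \<gamma>1 \<gamma>2 v divide_eq_eq using m by (simp_all add: m_def algebra_simps)
    then show "cov_coord G F z i j = (\<Sum>k\<in>UNIV. \<gamma> z $ k $ i $ j *s vd F z (axis k 1))"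
      using v by (simp add: sum_2 vec_eq_iff X_def flip: N_def)
  qed
qed

section \<open>Charts\<close>

text \<open>The chart axioms on their own: they hold for the given manifolds and are established for
  the projective plane below, so the transfer lemmas serve all of them.\<close>

definition charted :: "'a topology \<Rightarrow> ('a, 'n::finite) chart set \<Rightarrow> bool" where
  "charted X A \<longleftrightarrow>
     (\<forall>a\<in>A. openin X (cdom a) \<and> open (cimg a) \<and>
        homeomorphic_map (subtopology X (cdom a)) (top_of_set (cimg a)) (coord a)) \<and>
     (\<forall>a\<in>A. \<forall>b\<in>A. holo_map (coord b \<circ> cinv a) (coord a ` (cdom a \<inter> cdom b)))"

lemma complex_manifold_charted: "complex_manifold X A \<Longrightarrow> charted X A"
  by (simp add: complex_manifold_def charted_def)

lemma chart_open:
  assumes "charted X A" "a \<in> A"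
  shows "openin X (cdom a)" "open (cimg a)" "cdom a \<subseteq> topspace X"
    and chart_homeo: "homeomorphic_map (subtopology X (cdom a)) (top_of_set (cimg a)) (coord a)"
  using assms openin_subset by (auto simp: charted_def)

lemma topspace_chart: "charted X A \<Longrightarrow> a \<in> A \<Longrightarrow> topspace (subtopology X (cdom a)) = cdom a"
  using chart_open(3) by fastforce

lemma chart_inj: "charted X A \<Longrightarrow> a \<in> A \<Longrightarrow> inj_on (coord a) (cdom a)"
  using homeomorphic_imp_injective_map[OF chart_homeo] topspace_chart by fastforce

lemma cinv_coord: "charted X A \<Longrightarrow> a \<in> A \<Longrightarrow> x \<in> cdom a \<Longrightarrow> cinv a (coord a x) = x"
  unfolding cinv_def by (rule inv_into_f_f[OF chart_inj])

lemma coord_cinv: "z \<in> cimg a \<Longrightarrow> coord a (cinv a z) = z" and cinv_cdom: "z \<in> cimg a \<Longrightarrow> cinv a z \<in> cdom a"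
  unfolding cinv_def by (auto intro: f_inv_into_f inv_into_into)

lemma chart_image_open:
  assumes "charted X A" "a \<in> A" "openin X Q"
  shows "open (coord a ` (cdom a \<inter> Q))"
proof -
  have "openin (subtopology X (cdom a)) (cdom a \<inter> Q)"
    using assms(3) by (rule openin_subtopology_Int2)
  then have "openin (top_of_set (cimg a)) (coord a ` (cdom a \<inter> Q))"
    using homeomorphic_imp_open_map[OF chart_homeo[OF assms(1,2)]] by (simp add: open_map_def)
  then show ?thesis using chart_open(2)[OF assms(1,2)] openin_open_eq by blast
qed

lemma chart_preimage_open:
  assumes "charted X A" "a \<in> A" "open V"
  shows "openin X {x \<in> cdom a. coord a x \<in> V}"
proof -
  have "openin (top_of_set (cimg a)) (cimg a \<inter> V)" using assms(3) by (rule openin_open_Int)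
  then have "openin (subtopology X (cdom a)) {x \<in> topspace (subtopology X (cdom a)). coord a x \<in> cimg a \<inter> V}"
    by (rule openin_continuous_map_preimage[OF homeomorphic_imp_continuous_map[OF chart_homeo[OF assms(1,2)]]])
  moreover have "{x \<in> topspace (subtopology X (cdom a)). coord a x \<in> cimg a \<inter> V} = {x \<in> cdom a. coord a x \<in> V}"
    unfolding topspace_chart[OF assms(1,2)] by auto
  ultimately show ?thesis using openin_trans_full chart_open(1)[OF assms(1,2)] by metis
qed

lemma transition_holo:
  "charted X A \<Longrightarrow> a \<in> A \<Longrightarrow> b \<in> A \<Longrightarrow> holo_map (coord b \<circ> cinv a) (coord a ` (cdom a \<inter> cdom b))"
  by (simp add: charted_def)

lemma holo_map_cdiff: "holo_map F U \<Longrightarrow> z \<in> U \<Longrightarrow> cdiff_at (\<lambda>w. F w $ k) z"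
  by (auto simp: holo_map_def dest: holo_funD)

lemma holo_map_continuous_on: "holo_map F U \<Longrightarrow> continuous_on U F"
proof -
  assume "holo_map F U"
  then have "continuous_on U (\<lambda>w. \<chi> k. F w $ k)"
    by (intro continuous_on_vec_lambda holo_fun_continuous_on) (simp add: holo_map_def)
  then show ?thesis by simp
qed

text \<open>\<open>holo_between\<close> quantifies over all pairs of charts. One holomorphic local
  expression is enough, since any other is its composition with transition maps on both
  sides.\<close>

lemma local_chart_map:
  assumes X: "charted X A" and Y: "charted Y B" and a: "a \<in> A" and b: "b \<in> B"
    and U: "open U" "U \<subseteq> cimg a" and \<phi>: "holo_map \<phi> U" "\<phi> ` U \<subseteq> cimg b"
    and F: "\<And>x. x \<in> cdom a \<Longrightarrow> coord a x \<in> U \<Longrightarrow> F x = cinv b (\<phi> (coord a x))"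
  shows "holo_between X A {x \<in> cdom a. coord a x \<in> U} Y B F"
proof -
  define N where "N = {x \<in> cdom a. coord a x \<in> U}"
  have N: "openin X N" unfolding N_def by (rule chart_preimage_open[OF X a U(1)])
  have Fb: "F x \<in> cdom b" "coord b (F x) = \<phi> (coord a x)" if "x \<in> N" for x
    using that \<phi>(2) by (auto simp: N_def F image_subset_iff intro: cinv_cdom coord_cinv)
  have pre: "openin X {x \<in> N. F x \<in> Q}" if Q: "openin Y Q" for Q
  proof -
    have "open (coord b ` (cdom b \<inter> Q))" by (rule chart_image_open[OF Y b Q])
    from continuous_open_preimage[OF holo_map_continuous_on[OF \<phi>(1)] U(1) this]
    have "openin X {x \<in> cdom a. coord a x \<in> U \<inter> \<phi> -` (coord b ` (cdom b \<inter> Q))}"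
      by (rule chart_preimage_open[OF X a])
    moreover have "{x \<in> cdom a. coord a x \<in> U \<inter> \<phi> -` (coord b ` (cdom b \<inter> Q))} = {x \<in> N. F x \<in> Q}"
    proof (intro equalityI subsetI)
      fix x assume "x \<in> {x \<in> cdom a. coord a x \<in> U \<inter> \<phi> -` (coord b ` (cdom b \<inter> Q))}"
      then obtain y where x: "x \<in> N" and y: "y \<in> cdom b" "y \<in> Q" "\<phi> (coord a x) = coord b y" by (auto simp: N_def)
      then have "F x = y" using F[of x] cinv_coord[OF Y b y(1)] by (simp add: N_def)
      with x y show "x \<in> {x \<in> N. F x \<in> Q}" by simp
    next
      fix x assume "x \<in> {x \<in> N. F x \<in> Q}"
      then show "x \<in> {x \<in> cdom a. coord a x \<in> U \<inter> \<phi> -` (coord b ` (cdom b \<inter> Q))}"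
        using Fb[of x] by (auto simp: N_def intro!: image_eqI[of _ _ "F x"])
    qed
    ultimately show ?thesis by simp
  qed
  have tN: "topspace (subtopology X N) = N" using N openin_subset by fastforce
  have cont: "continuous_map (subtopology X N) Y F"
    unfolding continuous_map_def tN
  proof (intro conjI allI impI)
    show "F \<in> N \<rightarrow> topspace Y" using Fb(1) chart_open(3)[OF Y b] by auto
    show "openin (subtopology X N) {x \<in> N. F x \<in> Q}" if "openin Y Q" for Q
      using pre[OF that] by (auto simp: openin_open_subtopology[OF N])
  qed
  have "holo_map (coord b' \<circ> F \<circ> cinv a') (coord a' ` (cdom a' \<inter> N \<inter> F -` cdom b'))"
    if a': "a' \<in> A" and b': "b' \<in> B" for a' b'
  proof -
    define E where "E = coord a' ` (cdom a' \<inter> {x \<in> N. F x \<in> cdom b'})"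
    have E: "open E" unfolding E_def by (rule chart_image_open[OF X a' pre[OF chart_open(1)[OF Y b']]])
    have E': "coord a' ` (cdom a' \<inter> N \<inter> F -` cdom b') = E" unfolding E_def by (rule arg_cong) auto
    have ca: "cinv a' z \<in> N" "F (cinv a' z) \<in> cdom b'" "z \<in> coord a' ` (cdom a' \<inter> cdom a)" if "z \<in> E" for z
      using that cinv_coord[OF X a'] by (auto simp: E_def N_def)
    have "holo_fun (\<lambda>z. (coord b' \<circ> F \<circ> cinv a') z $ k) E" for k
    proof (rule holo_fun_cong[OF E])
      show "(coord b' \<circ> cinv b) (\<phi> ((coord a \<circ> cinv a') z)) $ k = (coord b' \<circ> F \<circ> cinv a') z $ k" if "z \<in> E" for z
        using ca(1)[OF that] F[of "cinv a' z"] by (simp add: N_def)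
      show "holo_fun (\<lambda>z. (coord b' \<circ> cinv b) (\<phi> ((coord a \<circ> cinv a') z)) $ k) E"
        unfolding holo_fun_iff
      proof
        fix z assume z: "z \<in> E"
        have 1: "cdiff_at (\<lambda>z. (coord a \<circ> cinv a') z $ i) z" for i
          by (rule holo_map_cdiff[OF transition_holo[OF X a' a] ca(3)[OF z]])
        have zU: "(coord a \<circ> cinv a') z \<in> U" using ca(1)[OF z] by (simp add: N_def)
        have 2: "cdiff_at (\<lambda>z. \<phi> ((coord a \<circ> cinv a') z) $ i) z" for i
          by (rule cdiff_compose[OF 1 holo_map_cdiff[OF \<phi>(1) zU]])
        have 3: "\<phi> ((coord a \<circ> cinv a') z) \<in> coord b ` (cdom b \<inter> cdom b')"
          using Fb[OF ca(1)[OF z]] ca(2)[OF z] by (auto intro!: image_eqI[of _ _ "F (cinv a' z)"])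
        show "cdiff_at (\<lambda>z. (coord b' \<circ> cinv b) (\<phi> ((coord a \<circ> cinv a') z)) $ k) z"
          by (rule cdiff_compose[where F="\<lambda>z. \<phi> ((coord a \<circ> cinv a') z)" and f="\<lambda>y. (coord b' \<circ> cinv b) y $ k",
                OF 2 holo_map_cdiff[OF transition_holo[OF Y b b'] 3]])
      qed
    qed
    then show ?thesis unfolding E' holo_map_def by blast
  qed
  with N cont show ?thesis unfolding holo_between_def N_def by blast
qed

lemma local_chart_biholo:
  assumes X: "charted X A" and Y: "charted Y B" and a: "a \<in> A" and b: "b \<in> B"
    and U: "open U" "U \<subseteq> cimg a" and V: "open V" "V \<subseteq> cimg b"
    and \<phi>: "holo_map \<phi> U" and \<psi>: "holo_map \<psi> V" and hom: "homeomorphism U V \<phi> \<psi>"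
    and F: "\<And>x. x \<in> cdom a \<Longrightarrow> coord a x \<in> U \<Longrightarrow> F x = cinv b (\<phi> (coord a x))"
  shows "biholo_between X A {x \<in> cdom a. coord a x \<in> U} Y B {y \<in> cdom b. coord b y \<in> V} F"
proof -
  let ?N = "{x \<in> cdom a. coord a x \<in> U}" and ?M = "{y \<in> cdom b. coord b y \<in> V}"
  have h: "\<phi> ` U = V" "\<psi> ` V = U" "\<And>z. z \<in> U \<Longrightarrow> \<psi> (\<phi> z) = z" "\<And>z. z \<in> V \<Longrightarrow> \<phi> (\<psi> z) = z"
    using hom by (auto simp: homeomorphism_def)
  define F' where "F' = (\<lambda>y. cinv a (\<psi> (coord b y)))"
  have F1: "F x \<in> ?M" "F' (F x) = x" if "x \<in> ?N" for x
  proof -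
    have "\<phi> (coord a x) \<in> V" using that h(1) by auto
    then have c: "F x \<in> cdom b" "coord b (F x) = \<phi> (coord a x)"
      using that F[of x] V(2) by (auto intro: cinv_cdom coord_cinv)
    then show "F x \<in> ?M" using \<open>\<phi> (coord a x) \<in> V\<close> by simp
    show "F' (F x) = x" using that c h(3) cinv_coord[OF X a] by (simp add: F'_def)
  qed
  have F2: "F' y \<in> ?N" "F (F' y) = y" if "y \<in> ?M" for y
  proof -
    have u: "\<psi> (coord b y) \<in> U" using that h(2) by auto
    then have c: "F' y \<in> cdom a" "coord a (F' y) = \<psi> (coord b y)"
      using U(2) by (auto simp: F'_def intro: cinv_cdom coord_cinv)
    then show "F' y \<in> ?N" using u by simp
    then show "F (F' y) = y" using that c h(4) F[of "F' y"] cinv_coord[OF Y b] u by simp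
  qed
  have bij: "bij_betw F ?N ?M" by (rule bij_betw_byWitness[where f'=F']) (use F1 F2 in auto)
  have inv: "inv_into ?N F y = F' y" if "y \<in> ?M" for y
    by (rule inv_into_f_eq[OF bij_betw_imp_inj_on[OF bij] F2[OF that]])
  show ?thesis
    unfolding biholo_between_def
  proof (intro conjI bij)
    show "holo_between X A ?N Y B F"
      by (rule local_chart_map[OF X Y a b U \<phi> _ F]) (use h V in auto)
    show "holo_between Y B ?M X A (inv_into ?N F)"
      by (rule local_chart_map[OF Y X b a V \<psi>]) (use h U inv in \<open>auto simp: F'_def\<close>)
  qed
qed

section \<open>The projective plane\<close>

abbreviation line :: "complex^3 \<Rightarrow> (complex^3) set" where "line v \<equiv> vec.span {v}"

lemma mem_line: "x \<in> line v \<longleftrightarrow> (\<exists>k. x = k *s v)"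
  by (auto simp: vec.span_breakdown_eq)

lemma line_CP2: "v \<noteq> 0 \<Longrightarrow> line v \<in> CP2"
  by (simp add: CP2_def)

lemma CP2_line:
  assumes "l \<in> CP2"
  obtains v where "v \<noteq> 0" "l = line v"
proof -
  have l: "vec.subspace l" "vec.dim l = 1" using assms by (auto simp: CP2_def)
  obtain B where B: "B \<subseteq> l" "vec.independent B" "l \<subseteq> vec.span B" "card B = vec.dim l"
    by (rule vec.basis_exists)
  then obtain v where v: "B = {v}" using l(2) by (auto simp: card_1_singleton_iff)
  have "v \<noteq> 0" using B(2) v vec.dependent_zero by blast
  moreover have "line v \<subseteq> l" using vec.span_minimal[OF B(1) l(1)] v by simp
  ultimately show ?thesis using that B(3) v by blast
qed

lemma line_scale:
  assumes "c \<noteq> 0"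
  shows "line (c *s v) = line v"
proof -
  have "k *s v = (k / c) *s (c *s v)" for k using assms by (simp add: vec_eq_iff)
  then show ?thesis unfolding set_eq_iff mem_line by (metis vector_smult_assoc)
qed

lemma openin_CP2: "openin CP2_top Q \<longleftrightarrow> Q \<subseteq> CP2 \<and> open {v::complex^3. v \<noteq> 0 \<and> line v \<in> Q}"
  unfolding CP2_top_def using istopology_CP2 by (simp add: topology_inverse')

lemma nonzero_nth: "v $ i \<noteq> 0 \<Longrightarrow> v \<noteq> (0 :: complex^3)"
  by auto

text \<open>The section of the tautological line bundle over the affine chart: the representative
  with entry 1 at index \<open>i\<close>, under the cyclic numbering of
  \<open>CP2_chart\<close>.\<close>

definition lift3 :: "3 \<Rightarrow> complex^2 \<Rightarrow> complex^3" where
  "lift3 i y = (\<chi> j. if j = i then 1 else if j = i + 1 then y $ 1 else y $ 2)"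

definition aff3 :: "3 \<Rightarrow> complex^3 \<Rightarrow> complex^2" where
  "aff3 i v = vector [v $ (i + 1) / v $ i, v $ (i + 2) / v $ i]"

lemma three_index: "(1::3) + 1 = 2" "(1::3) + 2 = 3"
  by simp_all

lemma index3: "(i::3) + 1 \<noteq> i" "(i::3) + 2 \<noteq> i" "(i::3) + 2 \<noteq> i + 1" "(j::3) = i \<or> j = i + 1 \<or> j = i + 2"
proof -
  have "(2::3) \<noteq> 0" "(2::3) \<noteq> 1" by simp_all
  then show d: "(i::3) + 1 \<noteq> i" "(i::3) + 2 \<noteq> i" "(i::3) + 2 \<noteq> i + 1" by auto
  have "{i, i + 1, i + 2} = UNIV"
  proof (rule card_subset_eq)
    show "card {i, i + 1, i + 2} = card (UNIV :: 3 set)" using d by auto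
  qed auto
  then show "j = i \<or> j = i + 1 \<or> j = i + 2" by blast
qed

lemma lift3_nth: "lift3 i y $ i = 1" "lift3 i y $ (i + 1) = y $ 1" "lift3 i y $ (i + 2) = y $ 2"
  using index3[of i] by (auto simp: lift3_def)

lemma aff3_lift3: "aff3 i (lift3 i y) = y"
  by (simp add: aff3_def lift3_nth vec_eq_iff forall_2 vector_2)

lemma lift3_nonzero: "lift3 i y \<noteq> 0"
  using lift3_nth(1)[of i y] by auto

lemma lift3_aff3:
  assumes "v $ i \<noteq> 0"
  shows "v = v $ i *s lift3 i (aff3 i v)"
  unfolding vec_eq_iff
proof
  fix j
  show "v $ j = (v $ i *s lift3 i (aff3 i v)) $ j"
    using index3(4)[of j i] assms by (auto simp: lift3_nth aff3_def vector_2)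
qed

lemma line_lift3: "v $ i \<noteq> 0 \<Longrightarrow> line (lift3 i (aff3 i v)) = line v"
  using line_scale[of "v $ i" "lift3 i (aff3 i v)"] lift3_aff3[of v i] by simp

lemma cdom_CP2_chart: "v \<noteq> 0 \<Longrightarrow> line v \<in> cdom (CP2_chart i) \<longleftrightarrow> v $ i \<noteq> 0"
proof
  assume "line v \<in> cdom (CP2_chart i)"
  then obtain w where "w \<in> line v" "w $ i \<noteq> 0" by (auto simp: CP2_chart_def)
  then show "v $ i \<noteq> 0" by (auto simp: mem_line)
next
  assume "v \<noteq> 0" "v $ i \<noteq> 0"
  then show "line v \<in> cdom (CP2_chart i)"
    using vec.span_base[of v "{v}"] line_CP2[of v] by (auto simp: CP2_chart_def simp del: vec.span_base)
qed

lemma coord_CP2_chart: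
  assumes "v $ i \<noteq> 0"
  shows "coord (CP2_chart i) (line v) = aff3 i v"
proof -
  have "(THE w. w \<in> line v \<and> w $ i = 1) = (1 / v $ i) *s v"
  proof (rule the_equality)
    show "(1 / v $ i) *s v \<in> line v \<and> ((1 / v $ i) *s v) $ i = 1" using assms by (auto simp: mem_line)
    fix w assume "w \<in> line v \<and> w $ i = 1"
    then obtain k where k: "w = k *s v" "w $ i = 1" using mem_line by blast
    then have "k = 1 / v $ i" using assms by (simp add: field_simps)
    with k show "w = (1 / v $ i) *s v" by simp
  qed
  then show ?thesis by (simp add: CP2_chart_def aff3_def)
qed

lemma mem_cdom_CP2_chart:
  assumes "l \<in> cdom (CP2_chart i)"
  shows "l = line (lift3 i (coord (CP2_chart i) l))"
proof -
  have "l \<in> CP2" using assms by (simp add: CP2_chart_def)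
  then obtain v where v: "v \<noteq> 0" "l = line v" by (rule CP2_line)
  then have "v $ i \<noteq> 0" using assms cdom_CP2_chart by simp
  then show ?thesis using v coord_CP2_chart line_lift3 by simp
qed

lemma lift3_chart: "line (lift3 i y) \<in> cdom (CP2_chart i)" "coord (CP2_chart i) (line (lift3 i y)) = y"
  by (simp_all add: cdom_CP2_chart lift3_nonzero coord_CP2_chart lift3_nth aff3_lift3)

lemma cimg_CP2_chart: "cimg (CP2_chart i) = UNIV"
  using lift3_chart[of i] by (metis UNIV_eq_I image_eqI)

lemma cinv_CP2_chart: "cinv (CP2_chart i) y = line (lift3 i y)"
proof -
  have "y \<in> cimg (CP2_chart i)" by (simp add: cimg_CP2_chart)
  from mem_cdom_CP2_chart[OF cinv_cdom[OF this]] coord_cinv[OF this] show ?thesis by simp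
qed

lemma continuous_on_lift3: "continuous_on UNIV (lift3 i)"
proof -
  have "continuous_on UNIV (\<lambda>y. if j = i then 1 else if j = i + 1 then y $ 1 else y $ (2::2) :: complex)" for j
    by (cases "j = i"; cases "j = i + 1"; auto intro!: continuous_intros)
  then show ?thesis unfolding lift3_def[abs_def] by (intro continuous_on_vec_lambda)
qed

lemma cdiff_lift3: "cdiff_at (\<lambda>y. lift3 i y $ j) y"
  by (cases "j = i"; cases "j = i + 1"; simp add: lift3_def)

lemma cdiff_aff3:
  assumes "v $ i \<noteq> 0"
  shows "cdiff_at (\<lambda>v. aff3 i v $ k) v"
  using exhaust_2[of k] assms by (auto simp: aff3_def vector_2 intro!: cdiff_divide)

lemma open_nth_nonzero: "open {v::complex^3. v $ i \<noteq> 0}"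
proof -
  have "open ((\<lambda>v::complex^3. v $ i) -` (- {0}))" by (intro open_vimage continuous_intros)
  moreover have "(\<lambda>v::complex^3. v $ i) -` (- {0}) = {v. v $ i \<noteq> 0}" by auto
  ultimately show ?thesis by simp
qed

lemma aff3_preimage_open: "open O1 \<Longrightarrow> open {v. v $ i \<noteq> 0 \<and> aff3 i v \<in> O1}"
proof -
  assume O1: "open O1"
  have "holo_map (aff3 i) {v. v $ i \<noteq> 0}" by (simp add: holo_map_def holo_fun_iff cdiff_aff3)
  from continuous_open_preimage[OF holo_map_continuous_on[OF this] open_nth_nonzero O1]
  have "open ({v. v $ i \<noteq> 0} \<inter> aff3 i -` O1)" .
  moreover have "{v. v $ i \<noteq> 0} \<inter> aff3 i -` O1 = {v. v $ i \<noteq> 0 \<and> aff3 i v \<in> O1}" by auto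
  ultimately show ?thesis by simp
qed

lemma openin_CP2_chart_preimage:
  assumes "open O1"
  shows "openin CP2_top {l \<in> cdom (CP2_chart i). coord (CP2_chart i) l \<in> O1}"
  unfolding openin_CP2
proof
  show "{l \<in> cdom (CP2_chart i). coord (CP2_chart i) l \<in> O1} \<subseteq> CP2" by (auto simp: CP2_chart_def)
  have "{v. v \<noteq> 0 \<and> line v \<in> {l \<in> cdom (CP2_chart i). coord (CP2_chart i) l \<in> O1}} = {v. v $ i \<noteq> 0 \<and> aff3 i v \<in> O1}"
    using cdom_CP2_chart[of _ i] coord_CP2_chart[of _ i] by (auto dest: nonzero_nth)
  then show "open {v. v \<noteq> 0 \<and> line v \<in> {l \<in> cdom (CP2_chart i). coord (CP2_chart i) l \<in> O1}}"
    using aff3_preimage_open[OF assms] by simp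
qed

text \<open>The chart inverse sends y to the line through \<open>lift3 i y\<close>, and the
  transition maps are \<open>aff3 j\<close> after \<open>lift3 i\<close>. Continuity for the
  quotient topology is checked on representatives.\<close>

lemma charted_CP2: "charted CP2_top CP2_atlas"
  unfolding charted_def CP2_atlas_def
proof (intro conjI ballI)
  fix a assume "a \<in> range CP2_chart"
  then obtain i where a: "a = CP2_chart i" by blast
  show op: "openin CP2_top (cdom a)" using openin_CP2_chart_preimage[OF open_UNIV, of i] by (simp add: a)
  show "open (cimg a)" by (simp only: a cimg_CP2_chart open_UNIV)
  have ts: "topspace (subtopology CP2_top (cdom a)) = cdom a" using op openin_subset by fastforce
  have "homeomorphic_maps (subtopology CP2_top (cdom a)) (top_of_set (cimg a)) (coord a) (\<lambda>y. line (lift3 i y))"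
    unfolding homeomorphic_maps_def ts[unfolded a] a cimg_CP2_chart subtopology_UNIV
  proof (intro conjI ballI)
    show "continuous_map (subtopology CP2_top (cdom (CP2_chart i))) euclidean (coord (CP2_chart i))"
      unfolding continuous_map_def ts[unfolded a]
      using openin_CP2_chart_preimage by (auto simp: openin_open_subtopology[OF op[unfolded a]])
    show "continuous_map euclidean (subtopology CP2_top (cdom (CP2_chart i))) (\<lambda>y. line (lift3 i y))"
      unfolding continuous_map_in_subtopology
    proof
      show "continuous_map euclidean CP2_top (\<lambda>y. line (lift3 i y))"
        unfolding continuous_map_def
      proof (intro conjI allI impI)
        show "(\<lambda>y. line (lift3 i y)) \<in> topspace euclidean \<rightarrow> topspace CP2_top"
          using lift3_chart(1) op openin_subset a by blast
        fix Q assume "openin CP2_top Q"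
        then have "open {v. v \<noteq> 0 \<and> line v \<in> Q}" by (simp add: openin_CP2)
        from continuous_open_preimage[OF continuous_on_lift3 open_UNIV this, of i]
        show "openin euclidean {y \<in> topspace euclidean. line (lift3 i y) \<in> Q}"
          by (simp add: vimage_def lift3_nonzero)
      qed
    qed (use lift3_chart(1) in auto)
    show "line (lift3 i (coord (CP2_chart i) l)) = l" if "l \<in> cdom (CP2_chart i)" for l
      using mem_cdom_CP2_chart[OF that] by simp
    show "coord (CP2_chart i) (line (lift3 i y)) = y" for y by (rule lift3_chart)
  qed
  then show "homeomorphic_map (subtopology CP2_top (cdom a)) (top_of_set (cimg a)) (coord a)"
    by (rule homeomorphic_maps_imp_map)
next
  fix a b assume "a \<in> range CP2_chart" "b \<in> range CP2_chart"
  then obtain i j where ab: "a = CP2_chart i" "b = CP2_chart j" by blast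
  \<comment> \<open>The domain of the transition map: the points of chart \<open>i\<close> whose
    representative has nonzero entry \<open>j\<close>.\<close>
  define E where "E = {y. lift3 i y $ j \<noteq> 0}"
  have E: "open E"
    unfolding E_def using continuous_open_preimage[OF continuous_on_lift3 open_UNIV open_nth_nonzero, of i j]
    by (simp add: vimage_def)
  have img: "coord a ` (cdom a \<inter> cdom b) = E"
  proof (intro equalityI subsetI)
    fix y assume "y \<in> coord a ` (cdom a \<inter> cdom b)"
    then obtain l where l: "l \<in> cdom a" "l \<in> cdom b" "y = coord a l" by blast
    then have "l = line (lift3 i y)" using mem_cdom_CP2_chart ab by blast
    then show "y \<in> E" using l(2) by (simp add: E_def ab cdom_CP2_chart lift3_nonzero)
  next
    fix y assume "y \<in> E"
    then have "line (lift3 i y) \<in> cdom a \<inter> cdom b" by (simp add: E_def ab cdom_CP2_chart lift3_nonzero lift3_nth)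
    then show "y \<in> coord a ` (cdom a \<inter> cdom b)" using lift3_chart(2)[of i y] ab by (metis image_eqI)
  qed
  show "holo_map (coord b \<circ> cinv a) (coord a ` (cdom a \<inter> cdom b))"
    unfolding img holo_map_def
  proof
    fix k
    show "holo_fun (\<lambda>z. (coord b \<circ> cinv a) z $ k) E"
    proof (rule holo_fun_cong[OF E])
      show "aff3 j (lift3 i y) $ k = (coord b \<circ> cinv a) y $ k" if "y \<in> E" for y
        using that by (simp add: ab cinv_CP2_chart coord_CP2_chart E_def)
      show "holo_fun (\<lambda>y. aff3 j (lift3 i y) $ k) E"
        unfolding holo_fun_iff
        by (intro ballI cdiff_compose[where F="lift3 i" and f="\<lambda>v. aff3 j v $ k"] cdiff_lift3 cdiff_aff3) (simp add: E_def)
    qed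
  qed
qed

definition dot3 :: "complex^3 \<Rightarrow> complex^3 \<Rightarrow> complex" where
  "dot3 k v = (\<Sum>a\<in>UNIV. k $ a * v $ a)"

lemma dot3_linear: "dot3 k (u + v) = dot3 k u + dot3 k v" "dot3 k (c *s v) = c * dot3 k v" "dot3 k 0 = 0"
  by (simp_all add: dot3_def algebra_simps sum.distrib sum_distrib_left)

lemma dot3_kernel_subspace: "vec.subspace {v. dot3 k v = 0}"
  by (simp add: vec.subspace_def dot3_linear)

text \<open>One further vector outside the kernel completes it to a spanning set of the
  three-dimensional space.\<close>

lemma dot3_kernel_dim:
  assumes "k \<noteq> 0"
  shows "vec.dim {v. dot3 k v = 0} = 2"
proof -
  let ?K = "{v. dot3 k v = 0}"
  obtain j where j: "k $ j \<noteq> 0" using assms by (auto simp: vec_eq_iff)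
  define w where "w = axis j (1::complex)"
  have w: "dot3 k w = k $ j" by (simp add: dot3_def w_def sum_axis)
  have sp: "vec.span ?K = ?K" by (rule vec.span_eq_iff[THEN iffD2, OF dot3_kernel_subspace])
  have "vec.span (insert w ?K) = UNIV"
  proof (intro equalityI subsetI UNIV_I)
    fix x :: "complex^3"
    have "dot3 k (x - (dot3 k x / k $ j) *s w) = 0"
      using dot3_linear(1)[of k "x - (dot3 k x / k $ j) *s w" "(dot3 k x / k $ j) *s w"] j
      by (simp add: dot3_linear w)
    then show "x \<in> vec.span (insert w ?K)" unfolding vec.span_breakdown_eq sp by blast
  qed
  then have "vec.dim (insert w ?K) = vec.dim (UNIV :: (complex^3) set)" by (metis vec.dim_span)
  then have "vec.dim (insert w ?K) = 3" unfolding vec_dim_card by simp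
  moreover have "w \<notin> vec.span ?K" unfolding sp using w j by simp
  ultimately show ?thesis by (simp add: vec.dim_insert)
qed

text \<open>Every plane in \<complex>^3 is the kernel of a nonzero linear form, found from a basis
  by \<open>two_equations\<close>. This replaces lines by the linear relations between solutions
  that \<open>geodesic_iff_line\<close> provides.\<close>

lemma in_proj_line_iff: "in_proj_line (line ` V) \<longleftrightarrow> (\<exists>k. k \<noteq> 0 \<and> (\<forall>v\<in>V. dot3 k v = 0))"
proof
  assume "\<exists>k. k \<noteq> 0 \<and> (\<forall>v\<in>V. dot3 k v = 0)"
  then obtain k where k: "k \<noteq> 0" "\<And>v. v \<in> V \<Longrightarrow> dot3 k v = 0" by blast
  have "line v \<subseteq> {v. dot3 k v = 0}" if "v \<in> V" for v
    using vec.span_minimal[OF _ dot3_kernel_subspace, of "{v}" k] k(2)[OF that] by simp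
  then show "in_proj_line (line ` V)"
    unfolding in_proj_line_def using dot3_kernel_subspace dot3_kernel_dim[OF k(1)] by blast
next
  assume "in_proj_line (line ` V)"
  then obtain K where K: "vec.subspace K" "vec.dim K = 2" "\<And>v. v \<in> V \<Longrightarrow> line v \<subseteq> K"
    by (auto simp: in_proj_line_def)
  obtain B where B: "B \<subseteq> K" "vec.independent B" "K \<subseteq> vec.span B" "card B = vec.dim K"
    by (rule vec.basis_exists)
  then obtain x y where xy: "B = {x, y}" using K(2) by (auto simp: card_2_iff)
  obtain k where k: "k \<noteq> 0" "(\<Sum>a\<in>UNIV. k $ a * x $ a) = 0" "(\<Sum>a\<in>UNIV. k $ a * y $ a) = 0"
    by (rule two_equations)
  have "vec.span B \<subseteq> {v. dot3 k v = 0}"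
    by (rule vec.span_minimal[OF _ dot3_kernel_subspace]) (use k xy in \<open>auto simp: dot3_def\<close>)
  moreover have "v \<in> K" if "v \<in> V" for v using K(3)[OF that] vec.span_base[of v "{v}"] by blast
  ultimately show "\<exists>k. k \<noteq> 0 \<and> (\<forall>v\<in>V. dot3 k v = 0)" using k(1) B(3) by blast
qed

section \<open>Flatness\<close>

lemma cderiv_cong:
  assumes "open T" "t \<in> T" "\<And>s. s \<in> T \<Longrightarrow> C s = C' s"
  shows "cderiv C t = cderiv C' t"
proof -
  have "\<forall>\<^sub>F s in nhds t. C s $ i = C' s $ i" for i
    using eventually_nhds_in_open[OF assms(1,2)] by (auto elim: eventually_mono simp: assms(3))
  then show ?thesis unfolding cderiv_def by (simp add: vec_eq_iff deriv_cong_ev)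
qed

lemma pregeo_cong:
  assumes "open T" "t \<in> T" "\<And>s. s \<in> T \<Longrightarrow> C s = C' s"
  shows "pregeo G C t \<longleftrightarrow> pregeo G C' t"
  unfolding pregeo_def
  by (simp add: cderiv_cong[OF assms] assms(3)[OF assms(2)] cderiv_cong[OF assms(1,2) cderiv_cong[OF assms(1) _ assms(3)]])

lemma jac_mult: "jac F z *v v = vd F z v"
  by (simp add: vec_eq_iff jac_def matrix_vector_mult_def dd_def)

lemma column_jac: "column k (jac F z) = vd F z (axis k 1)"
  by (simp add: vec_eq_iff jac_def column_def)

lemma transpose_mult_bil: "(transpose J ** M ** J) $ i $ j = bil (\<lambda>a b. M $ a $ b) (column i J) (column j J)"
proof -
  have "(transpose J ** M ** J) $ i $ j = (\<Sum>k\<in>UNIV. \<Sum>l\<in>UNIV. M $ l $ k * J $ l $ i * J $ k $ j)"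
    by (simp add: matrix_matrix_mult_def transpose_def sum_distrib_left sum_distrib_right mult_ac)
  also have "\<dots> = bil (\<lambda>a b. M $ a $ b) (column i J) (column j J)"
    unfolding bil_def by (subst sum.swap) (simp add: column_def)
  finally show ?thesis .
qed

lemma metric4_subset: "metric4 G W \<Longrightarrow> open V \<Longrightarrow> V \<subseteq> W \<Longrightarrow> metric4 G V"
  unfolding metric4_def metric_on_def holo_metric_def holo_fun_iff by blast

lemma immersed_curve_open:
  assumes "immersed_curve S B T \<gamma>" "openin S Q"
  shows "open {s \<in> T. \<gamma> s \<in> Q}"
proof -
  have T: "open T" "continuous_map (top_of_set T) S \<gamma>" using assms(1) by (auto simp: immersed_curve_def)
  have "openin (top_of_set T) {s \<in> topspace (top_of_set T). \<gamma> s \<in> Q}"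
    by (rule openin_continuous_map_preimage[OF T(2) assms(2)])
  then show ?thesis using T(1) by (simp add: openin_open_eq)
qed

lemma det_nonzero_kernel:
  fixes Q :: "complex^'n^'n::finite"
  assumes "det Q \<noteq> 0" "Q *v k = 0"
  shows "k = 0"
  using assms matrix_left_invertible_ker[of Q] invertible_left_inverse[of Q] invertible_det_nz[of Q] by blast

section \<open>From a global beta-surface to local coordinate data\<close>

locale selfdual_beta_surface =
  fixes X :: "'m topology" and A :: "('m, 4) chart set" and g :: "'m conf" and st :: "'m star"
    and S :: "'b topology" and B :: "('b, 2) chart set" and f :: "'b \<Rightarrow> 'm"
  assumes manifold: "complex_manifold X A" and conf: "conformal_structure A g"
    and ori: "orientation A g st" and sd: "self_dual A g st"
    and beta: "totally_geodesic_beta X A g st S B f"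
begin

lemma cX: "charted X A" by (rule complex_manifold_charted[OF manifold])

lemma mS: "complex_manifold S B" using beta by (simp add: totally_geodesic_beta_def)

lemma cS: "charted S B" by (rule complex_manifold_charted[OF mS])

lemma f_holo: "holo_between S B (topspace S) X A f"
  using beta by (simp add: totally_geodesic_beta_def)

lemma f_cont: "continuous_map S X f"
  using f_holo by (simp add: holo_between_def)

lemma f_preimage_open: "openin X Q \<Longrightarrow> openin S {x \<in> topspace S. f x \<in> Q}"
  by (rule openin_continuous_map_preimage[OF f_cont])

lemma lrep_dom_open:
  assumes "b \<in> B" "a \<in> A"
  shows "open (lrep_dom b a f)"
proof -
  have "open (coord b ` (cdom b \<inter> {x \<in> topspace S. f x \<in> cdom a}))"
    by (rule chart_image_open[OF cS assms(1) f_preimage_open[OF chart_open(1)[OF cX assms(2)]]])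
  moreover have "cdom b \<inter> {x \<in> topspace S. f x \<in> cdom a} = cdom b \<inter> f -` cdom a"
    using chart_open(3)[OF cS assms(1)] by auto
  ultimately show ?thesis by (simp add: lrep_dom_def)
qed

lemma lrep_coord: "b \<in> B \<Longrightarrow> x \<in> cdom b \<Longrightarrow> lrep b a f (coord b x) = coord a (f x)"
  by (simp add: lrep_def cinv_coord[OF cS])

lemma lrep_holo:
  assumes "b \<in> B" "a \<in> A"
  shows "holo_map (lrep b a f) (lrep_dom b a f)"
proof -
  have "cdom b \<inter> topspace S \<inter> f -` cdom a = cdom b \<inter> f -` cdom a"
    using chart_open(3)[OF cS assms(1)] by auto
  then show ?thesis
    using f_holo assms unfolding holo_between_def lrep_def lrep_dom_def by metis
qed

lemma lrep_img: "b \<in> B \<Longrightarrow> lrep b a f ` lrep_dom b a f \<subseteq> cimg a"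
  by (auto simp: lrep_dom_def lrep_coord)

lemma lrep_inj:
  assumes "b \<in> B" "a \<in> A" "z \<in> lrep_dom b a f" "vd (lrep b a f) z v = 0"
  shows "v = 0"
proof -
  have "inj ((*v) (jac (lrep b a f) z))"
    using beta assms(1-3) unfolding totally_geodesic_beta_def by blast
  then show ?thesis by (rule injD) (simp add: jac_mult assms(4) matrix_vector_mult_0_right)
qed

lemma
  assumes "b \<in> B" "a \<in> A" "z \<in> lrep_dom b a f"
  shows lrep_null: "bil (\<lambda>i j. g a (lrep b a f z) $ i $ j) (vd (lrep b a f) z v) (vd (lrep b a f) z w) = 0"
    and lrep_asd: "st a (lrep b a f z) (wedge (vd (lrep b a f) z v) (vd (lrep b a f) z w))
      = - wedge (vd (lrep b a f) z v) (vd (lrep b a f) z w)"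
proof -
  have "beta_plane (g a (lrep b a f z)) (st a (lrep b a f z)) (range ((*v) (jac (lrep b a f) z)))"
    using beta assms unfolding totally_geodesic_beta_def by blast
  then show "bil (\<lambda>i j. g a (lrep b a f z) $ i $ j) (vd (lrep b a f) z v) (vd (lrep b a f) z w) = 0"
    "st a (lrep b a f z) (wedge (vd (lrep b a f) z v) (vd (lrep b a f) z w))
      = - wedge (vd (lrep b a f) z v) (vd (lrep b a f) z w)"
    unfolding beta_plane_def bil_def jac_mult[symmetric] by blast+
qed

lemma chart_metric:
  assumes a: "a \<in> A"
  shows "metric4 (g a) (cimg a)"
proof -
  have "\<forall>a\<in>A. holo_metric (g a) (cimg a)" using conf unfolding conformal_structure_def by (rule conjunct1)
  then show ?thesis using a chart_open(2)[OF cX a] by (simp add: metric4_def metric_on_def)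
qed

lemma local_metric_metric:
  assumes "local_metric A g a W G"
  shows "metric4 G W"
proof -
  obtain u where u: "holo_fun u W" "\<And>z. z \<in> W \<Longrightarrow> u z \<noteq> 0" "\<And>z. z \<in> W \<Longrightarrow> G z = (\<chi> i j. u z * g a z $ i $ j)"
    and W: "a \<in> A" "open W" "W \<subseteq> cimg a"
    using assms unfolding local_metric_def by blast
  interpret metric4 "g a" "cimg a" by (rule chart_metric[OF W(1)])
  have "holo_fun (\<lambda>z. G z $ i $ j) W" for i j
  proof (rule holo_fun_cong[OF W(2)])
    show "u z * g a z $ i $ j = G z $ i $ j" if "z \<in> W" for z using u(3)[OF that] by simp
    show "holo_fun (\<lambda>z. u z * g a z $ i $ j) W"
      unfolding holo_fun_iff by (intro ballI cdiff_mult holo_funD[OF u(1)] G_cdiff) (use W(3) in auto)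
  qed
  moreover have "transpose (G z) = G z \<and> det (G z) \<noteq> 0" if z: "z \<in> W" for z
  proof
    have zc: "z \<in> cimg a" using z W(3) by blast
    show "transpose (G z) = G z" using u(3)[OF z] G_sym[OF zc] by (simp add: transpose_def vec_eq_iff)
    have "G z = (\<chi> i. u z *s g a z $ i)" using u(3)[OF z] by (simp add: vec_eq_iff)
    then have "det (G z) = (\<Prod>i\<in>(UNIV::4 set). u z) * det (\<chi> i. g a z $ i)" by (simp only: det_rows_mul)
    then show "det (G z) \<noteq> 0" using u(2)[OF z] G_det[OF zc] by simp
  qed
  ultimately show ?thesis using W(2) by (simp add: metric4_def metric_on_def holo_metric_def)
qed

lemma geod:
  assumes "local_metric A g a W G" "b \<in> B" "z \<in> lrep_dom b a f" "lrep b a f z \<in> W"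
  shows "\<exists>v. cov_coord G (lrep b a f) z i j = vd (lrep b a f) z v"
proof -
  have "cov_coord G (lrep b a f) z i j \<in> range ((*v) (jac (lrep b a f) z))"
    using beta assms unfolding totally_geodesic_beta_def totally_geodesic_def by blast
  then show ?thesis by (auto simp: jac_mult)
qed

lemma self_local_metric: "a \<in> A \<Longrightarrow> local_metric A g a (cimg a) (g a)"
  unfolding local_metric_def using chart_open(2)[OF cX]
  by (intro conjI exI[of _ "\<lambda>_. 1"]) (auto simp: holo_fun_iff vec_eq_iff)

text \<open>Supplies the two curvature assumptions of \<open>beta_patch\<close> from
  self-duality.\<close>

lemma lrep_weyl:
  fixes v v' :: "complex^2"
  assumes b: "b \<in> B" and a: "a \<in> A" and z: "z \<in> lrep_dom b a f"
  defines "F \<equiv> lrep b a f" and "u \<equiv> vd (lrep b a f) z v" and "w \<equiv> vd (lrep b a f) z v'"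
  shows "metric4.Wl (g a) (F z) x y u w = 0"
    and "dd (\<lambda>y. metric4.Wl (g a) y u w u w) (F z) t = 0"
proof -
  interpret metric4 "g a" "cimg a" by (rule chart_metric[OF a])
  have Fz: "F z \<in> cimg a" using lrep_img[OF b, of a] z by (auto simp: F_def)
  obtain s where s: "holo_fun s (cimg a)" "\<And>y. y \<in> cimg a \<Longrightarrow> (s y)\<^sup>2 = det (g a y)"
    "\<And>y E. y \<in> cimg a \<Longrightarrow> bivector E \<Longrightarrow> st a y E = hodge (g a y) (s y) E"
    using ori a unfolding orientation_def by blast
  \<comment> \<open>The constant bivector is projected to its anti-self-dual part at every point y.
    This is a differentiable field killed by the Weyl operator on the whole chart, and it equals the
    given bivector at \<open>F z\<close>, where that one is already anti-self-dual.\<close>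
  define \<Phi> where "\<Phi> = (\<lambda>y. \<chi> i j. (wedge u w $ i $ j - hodge (g a y) (s y) (wedge u w) $ i $ j) / 2)"
  have 0: "weyl_op (g a) y (\<Phi> y) = 0" if "y \<in> cimg a" for y
  proof -
    have "weyl_minus g st a y (wedge u w) = 0"
      using sd a that bivector_wedge unfolding self_dual_def by blast
    then show ?thesis by (simp add: weyl_minus_def \<Phi>_def s(3)[OF that bivector_wedge])
  qed
  have "hodge (g a (F z)) (s (F z)) (wedge u w) = - wedge u w"
    using lrep_asd[OF b a z, of v v'] s(3)[OF Fz bivector_wedge, of u w] by (simp add: F_def u_def w_def)
  then have \<Phi>z: "\<Phi> (F z) = wedge u w" by (simp add: \<Phi>_def vec_eq_iff)
  have sz: "s (F z) \<noteq> 0" using s(2)[OF Fz] G_det[OF Fz] by auto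
  have \<Phi>c: "cdiff_at (\<lambda>y. \<Phi> y $ k $ l) (F z)" for k l
    unfolding \<Phi>_def vec_lambda_beta
    by (intro cdiff_divide cdiff_diff cdiff_const hodge_cdiff G_cdiff[OF Fz] holo_funD[OF s(1) Fz] sz) simp
  show "Wl (F z) x y u w = 0" using weyl_op_wedge_zero[OF Fz] 0[OF Fz] \<Phi>z by simp
  show "dd (\<lambda>y. Wl y u w u w) (F z) t = 0" by (rule dd_Wl_zero[OF Fz 0 \<Phi>c \<Phi>z])
qed

lemma geodesic_at_acc:
  "geodesic_at (b, D, \<Gamma>) \<gamma> t \<longleftrightarrow> (\<exists>q. \<forall>k. acc \<Gamma> (coord b \<circ> \<gamma>) t k = q * cderiv (coord b \<circ> \<gamma>) t $ k)"
  by (simp add: geodesic_at_def acc_def Let_def)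

lemma immersed_holomorphic:
  assumes "immersed_curve S B T \<gamma>" "b \<in> B" "T0 \<subseteq> T" "\<And>s. s \<in> T0 \<Longrightarrow> \<gamma> s \<in> cdom b"
  shows "(\<lambda>s. (coord b \<circ> \<gamma>) s $ i) holomorphic_on T0"
proof -
  have "(\<lambda>s. coord b (\<gamma> s) $ i) holomorphic_on (T \<inter> \<gamma> -` cdom b)"
    using assms(1,2) by (simp add: immersed_curve_def)
  then show ?thesis unfolding o_def by (rule holomorphic_on_subset) (use assms in auto)
qed

text \<open>Expresses the geodesics of an induced connection through a curve in the ambient space
  alone, where different charts and local metrics can be compared.\<close>

lemma induced_pregeo:
  assumes \<kappa>: "local_connection B (b, D, \<Gamma>)" and G: "local_metric A g a W G"
    and D: "D \<subseteq> lrep_dom b a f \<inter> lrep b a f -` W"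
    and ind: "\<And>z i j. z \<in> D \<Longrightarrow> cov_coord G (lrep b a f) z i j =
          (\<Sum>k\<in>UNIV. \<Gamma> z $ k $ i $ j *s column k (jac (lrep b a f) z))"
    and im: "immersed_curve S B T \<gamma>" and t: "t \<in> T" "\<gamma> t \<in> cdom b" "coord b (\<gamma> t) \<in> D"
  shows "geodesic_at (b, D, \<Gamma>) \<gamma> t \<longleftrightarrow> pregeo G (coord a \<circ> f \<circ> \<gamma>) t"
proof -
  have b: "b \<in> B" and oD: "open D" using \<kappa> by (auto simp: local_connection_def)
  have a: "a \<in> A" using G by (simp add: local_metric_def)
  interpret metric4 G W by (rule local_metric_metric[OF G])
  define T0 where "T0 = {s \<in> T. \<gamma> s \<in> {x \<in> cdom b. coord b x \<in> D}}"
  have T0: "open T0" "t \<in> T0" "T0 \<subseteq> T"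
    unfolding T0_def using immersed_curve_open[OF im chart_preimage_open[OF cS b oD]] t by auto
  have F: "holo_map (lrep b a f) D" using lrep_holo[OF b a] D by (auto simp: holo_map_def holo_fun_iff)
  have c: "(\<lambda>s. (coord b \<circ> \<gamma>) s $ i) holomorphic_on T0" for i
    by (rule immersed_holomorphic[OF im b T0(3)]) (simp add: T0_def)
  have "geodesic_at (b, D, \<Gamma>) \<gamma> t \<longleftrightarrow> pregeo G (\<lambda>s. lrep b a f ((coord b \<circ> \<gamma>) s)) t"
    unfolding geodesic_at_acc
  proof (rule induced_geodesic_iff[OF oD F T0(1) c _ T0(2)])
    show "(coord b \<circ> \<gamma>) ` T0 \<subseteq> D" by (auto simp: T0_def)
    show "cov_coord G (lrep b a f) ((coord b \<circ> \<gamma>) t) i j =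
        (\<Sum>k\<in>UNIV. \<Gamma> ((coord b \<circ> \<gamma>) t) $ k $ i $ j *s vd (lrep b a f) ((coord b \<circ> \<gamma>) t) (axis k 1))" for i j
      using ind[of "coord b (\<gamma> t)"] t(3) by (simp add: column_jac)
    show "v = 0" if "vd (lrep b a f) ((coord b \<circ> \<gamma>) t) v = 0" for v
      using lrep_inj[OF b a _ that] t(3) D by auto
  qed
  also have "\<dots> \<longleftrightarrow> pregeo G (coord a \<circ> f \<circ> \<gamma>) t"
    by (rule pregeo_cong[OF T0(1,2)]) (simp add: T0_def lrep_coord[OF b])
  finally show ?thesis .
qed

text \<open>Transition maps are conformal and curves in the surface are null, so
  \<open>pregeo_transform\<close> applies on the overlap of the two chart domains.\<close>

lemma pregeo_change:
  assumes G: "local_metric A g a W G" and G': "local_metric A g a' W' G'"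
    and im: "immersed_curve S B T \<gamma>" and t: "t \<in> T"
    and y: "f (\<gamma> t) \<in> cdom a" "coord a (f (\<gamma> t)) \<in> W" "f (\<gamma> t) \<in> cdom a'" "coord a' (f (\<gamma> t)) \<in> W'"
    and geo: "pregeo G' (coord a' \<circ> f \<circ> \<gamma>) t"
  shows "pregeo G (coord a \<circ> f \<circ> \<gamma>) t"
proof -
  obtain u where u: "holo_fun u W" "\<And>z. z \<in> W \<Longrightarrow> u z \<noteq> 0" "\<And>z. z \<in> W \<Longrightarrow> G z = (\<chi> i j. u z * g a z $ i $ j)"
    and a: "a \<in> A" and W: "open W" "W \<subseteq> cimg a"
    using G unfolding local_metric_def by blast
  obtain u' where u': "holo_fun u' W'" "\<And>z. z \<in> W' \<Longrightarrow> u' z \<noteq> 0" "\<And>z. z \<in> W' \<Longrightarrow> G' z = (\<chi> i j. u' z * g a' z $ i $ j)"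
    and a': "a' \<in> A" and W': "open W'" "W' \<subseteq> cimg a'"
    using G' unfolding local_metric_def by blast
  have "\<exists>h. (\<forall>a\<in>A. \<forall>b\<in>A. holo_fun (h a b \<circ> cinv a) (coord a ` (cdom a \<inter> cdom b))) \<and>
        (\<forall>a\<in>A. \<forall>b\<in>A. \<forall>x\<in>cdom a \<inter> cdom b. h a b x \<noteq> 0) \<and>
        (\<forall>a\<in>A. \<forall>b\<in>A. \<forall>x\<in>cdom a \<inter> cdom b.
           transpose (jac (coord b \<circ> cinv a) (coord a x)) ** g b (coord b x) ** jac (coord b \<circ> cinv a) (coord a x)
             = (\<chi> i j. (h a b x)\<^sup>2 * g a (coord a x) $ i $ j))"
    using conf unfolding conformal_structure_def Let_def ball_conj_distrib
    apply (elim conjE exE)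
    subgoal for h v by (rule exI[of _ h]) (intro conjI; assumption)
    done
  then obtain h :: "('m, 4) chart \<Rightarrow> ('m, 4) chart \<Rightarrow> 'm \<Rightarrow> complex" where
    h1: "\<forall>a\<in>A. \<forall>b\<in>A. holo_fun (h a b \<circ> cinv a) (coord a ` (cdom a \<inter> cdom b))" and
    h2: "\<forall>a\<in>A. \<forall>b\<in>A. \<forall>x\<in>cdom a \<inter> cdom b. h a b x \<noteq> 0" and
    h3: "\<forall>a\<in>A. \<forall>b\<in>A. \<forall>x\<in>cdom a \<inter> cdom b.
           transpose (jac (coord b \<circ> cinv a) (coord a x)) ** g b (coord b x) ** jac (coord b \<circ> cinv a) (coord a x)
             = (\<chi> i j. (h a b x)\<^sup>2 * g a (coord a x) $ i $ j)"
    by blast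
  define \<phi> where "\<phi> = coord a' \<circ> cinv a"
  define R where "R = {y \<in> cdom a. coord a y \<in> W} \<inter> {y \<in> cdom a'. coord a' y \<in> W'}"
  have R: "openin X R"
    unfolding R_def by (intro openin_Int chart_preimage_open[OF cX a W(1)] chart_preimage_open[OF cX a' W'(1)])
  define O1 where "O1 = coord a ` (cdom a \<inter> R)"
  have O1: "open O1" unfolding O1_def by (rule chart_image_open[OF cX a R])
  have O1m: "cinv a z \<in> cdom a \<inter> cdom a'" "z = coord a (cinv a z)" "z \<in> W" "\<phi> z = coord a' (cinv a z)" "\<phi> z \<in> W'"
    "z \<in> coord a ` (cdom a \<inter> cdom a')"
    if "z \<in> O1" for z
    using that cinv_coord[OF cX a] by (auto simp: O1_def R_def \<phi>_def)
  have \<phi>: "holo_map \<phi> O1"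
    using transition_holo[OF cX a a'] O1m(6) unfolding \<phi>_def holo_map_def holo_fun_iff by blast
  \<comment> \<open>With G = u g, G' = u' g' and the pullback of g' equal to h^2 g, this is the
    ratio of G to the pullback of G'.\<close>
  define \<rho> where "\<rho> = (\<lambda>z. u z / (((h a a' \<circ> cinv a) z)\<^sup>2 * u' (\<phi> z)))"
  have hz: "(h a a' \<circ> cinv a) z \<noteq> 0" if "z \<in> O1" for z using h2 a a' O1m(1)[OF that] by auto
  have \<rho>: "holo_fun \<rho> O1"
    unfolding holo_fun_iff
  proof
    fix z assume z: "z \<in> O1"
    have "cdiff_at (h a a' \<circ> cinv a) z" using h1 a a' O1m(6)[OF z] holo_funD by blast
    then show "cdiff_at \<rho> z"
      unfolding \<rho>_def using hz[OF z] u'(2)[OF O1m(5)[OF z]]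
      by (intro cdiff_divide cdiff_mult cdiff_power holo_funD[OF u(1) O1m(3)[OF z]]
          cdiff_compose[OF holo_map_cdiff[OF \<phi> z] holo_funD[OF u'(1) O1m(5)[OF z]]]) (auto simp: o_def)
  qed
  have rel: "G z $ i $ j = \<rho> z * bil (\<lambda>a b. G' (\<phi> z) $ a $ b) (vd \<phi> z (axis i 1)) (vd \<phi> z (axis j 1))"
    if z: "z \<in> O1" for z i j
  proof -
    note m = O1m[OF z]
    have "transpose (jac \<phi> z) ** g a' (\<phi> z) ** jac \<phi> z = (\<chi> i j. ((h a a' \<circ> cinv a) z)\<^sup>2 * g a z $ i $ j)"
      using h3[rule_format, OF a a' m(1)] m(2,4) by (simp add: \<phi>_def)
    then have "bil (\<lambda>k l. g a' (\<phi> z) $ k $ l) (vd \<phi> z (axis i 1)) (vd \<phi> z (axis j 1)) = ((h a a' \<circ> cinv a) z)\<^sup>2 * g a z $ i $ j"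
      unfolding column_jac[symmetric] transpose_mult_bil[symmetric] by simp
    then have "bil (\<lambda>a b. G' (\<phi> z) $ a $ b) (vd \<phi> z (axis i 1)) (vd \<phi> z (axis j 1))
        = u' (\<phi> z) * (((h a a' \<circ> cinv a) z)\<^sup>2 * g a z $ i $ j)"
      by (simp add: u'(3)[OF m(5)] bil_form_linear)
    then show ?thesis
      using u(3)[OF m(3)] hz[OF z] u'(2)[OF m(5)] by (simp add: \<rho>_def)
  qed
  obtain b where b: "b \<in> B" "\<gamma> t \<in> cdom b"
  proof -
    have "\<gamma> t \<in> topspace S" using im t unfolding immersed_curve_def continuous_map_def by auto
    then show ?thesis using mS that unfolding complex_manifold_def by blast
  qed
  define T0 where "T0 = {s \<in> T. \<gamma> s \<in> cdom b \<inter> {x \<in> topspace S. f x \<in> R}}"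
  have T0: "open T0" "T0 \<subseteq> T"
    unfolding T0_def using immersed_curve_open[OF im openin_Int[OF chart_open(1)[OF cS b(1)] f_preimage_open[OF R]]] by auto
  have tT0: "t \<in> T0" using t b y chart_open(3)[OF cS b(1)] by (auto simp: T0_def R_def)
  have T0m: "\<gamma> s \<in> cdom b" "f (\<gamma> s) \<in> R" "f (\<gamma> s) \<in> cdom a" "f (\<gamma> s) \<in> cdom a'" if "s \<in> T0" for s
    using that by (auto simp: T0_def R_def)
  have c: "(\<lambda>s. (coord b \<circ> \<gamma>) s $ i) holomorphic_on T0" for i
    by (rule immersed_holomorphic[OF im b(1) T0(2) T0m(1)])
  define C where "C = coord a \<circ> f \<circ> \<gamma>"
  have cD: "(coord b \<circ> \<gamma>) ` T0 \<subseteq> lrep_dom b k f" if "k = a \<or> k = a'" for k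
    using T0m that by (auto simp: lrep_dom_def)
  have CF: "C s = lrep b a f ((coord b \<circ> \<gamma>) s)" if "s \<in> T0" for s
    using lrep_coord[OF b(1) T0m(1)[OF that], of a] by (simp add: C_def)
  have C: "(\<lambda>s. C s $ i) holomorphic_on T0" for i
    using holomorphic_compose[OF lrep_dom_open[OF b(1) a] lrep_holo[OF b(1) a] T0(1) c cD tT0, of i]
    by (rule holomorphic_transform) (auto simp: CF)
  have CO: "C ` T0 \<subseteq> O1" using T0m by (auto simp: C_def O1_def)
  have \<phi>C: "\<phi> (C s) = (coord a' \<circ> f \<circ> \<gamma>) s" if "s \<in> T0" for s
    using cinv_coord[OF cX a T0m(3)[OF that]] by (simp add: \<phi>_def C_def)
  have "pregeo G C t"
  proof (rule pregeo_transform[OF metric4_subset[OF local_metric_metric[OF G] O1] local_metric_metric[OF G'] \<phi> _ \<rho> rel T0(1) C CO tT0])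
    show "O1 \<subseteq> W" "\<phi> ` O1 \<subseteq> W'" using O1m by auto
    have "cderiv (\<lambda>s. \<phi> (C s)) t = cderiv (\<lambda>s. lrep b a' f ((coord b \<circ> \<gamma>) s)) t"
      by (rule cderiv_cong[OF T0(1) tT0]) (simp add: \<phi>C lrep_coord[OF b(1) T0m(1)])
    also have "\<dots> = vd (lrep b a' f) (coord b (\<gamma> t)) (cderiv (coord b \<circ> \<gamma>) t)"
      using cderiv_compose[OF lrep_dom_open[OF b(1) a'] lrep_holo[OF b(1) a'] T0(1) c cD tT0] by simp
    finally have d: "cderiv (\<lambda>s. \<phi> (C s)) t = vd (lrep b a' f) (coord b (\<gamma> t)) (cderiv (coord b \<circ> \<gamma>) t)" .
    have e: "\<phi> (C t) = lrep b a' f (coord b (\<gamma> t))"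
      using \<phi>C[OF tT0] lrep_coord[OF b, of a'] by simp
    have m: "\<phi> (C t) \<in> W'" using CO tT0 O1m(5) by auto
    have "coord b (\<gamma> t) \<in> lrep_dom b a' f" using cD[of a'] tT0 by auto
    \<comment> \<open>The velocity lies in a beta-plane, hence is null for g' and for its multiple
      G'.\<close>
    from lrep_null[OF b(1) a' this]
    have "bil (\<lambda>i j. g a' (\<phi> (C t)) $ i $ j) (cderiv (\<lambda>s. \<phi> (C s)) t) (cderiv (\<lambda>s. \<phi> (C s)) t) = 0"
      unfolding d e .
    then show "bil (\<lambda>a b. G' (\<phi> (C t)) $ a $ b) (cderiv (\<lambda>s. \<phi> (C s)) t) (cderiv (\<lambda>s. \<phi> (C s)) t) = 0"
      by (simp add: u'(3)[OF m] bil_form_linear)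
    show "pregeo G' (\<lambda>s. \<phi> (C s)) t"
      by (rule pregeo_cong[OF T0(1) tT0 \<phi>C, THEN iffD2, OF _ geo])
  qed
  then show ?thesis by (simp add: C_def)
qed

text \<open>Both conditions say that the image curve in the ambient space is an unparametrized
  geodesic, a property of null curves shared by all local metrics of the conformal
  structure.\<close>

lemma induced_equivalent:
  assumes "induced_connection A g B f \<kappa>" "induced_connection A g B f \<kappa>'"
  shows "proj_equivalent S B \<kappa> \<kappa>'"
proof -
  obtain b D \<Gamma> where \<kappa>: "\<kappa> = (b, D, \<Gamma>)" by (cases \<kappa>)
  obtain b' D' \<Gamma>' where \<kappa>': "\<kappa>' = (b', D', \<Gamma>')" by (cases \<kappa>')
  obtain a W G where 1: "local_connection B (b, D, \<Gamma>)" "local_metric A g a W G" "D \<subseteq> lrep_dom b a f \<inter> lrep b a f -` W"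
    "\<And>z i j. z \<in> D \<Longrightarrow> cov_coord G (lrep b a f) z i j = (\<Sum>k\<in>UNIV. \<Gamma> z $ k $ i $ j *s column k (jac (lrep b a f) z))"
    using assms(1) unfolding induced_connection_def \<kappa> prod.case by blast
  obtain a' W' G' where 2: "local_connection B (b', D', \<Gamma>')" "local_metric A g a' W' G'" "D' \<subseteq> lrep_dom b' a' f \<inter> lrep b' a' f -` W'"
    "\<And>z i j. z \<in> D' \<Longrightarrow> cov_coord G' (lrep b' a' f) z i j = (\<Sum>k\<in>UNIV. \<Gamma>' z $ k $ i $ j *s column k (jac (lrep b' a' f) z))"
    using assms(2) unfolding induced_connection_def \<kappa>' prod.case by blast
  have bB: "b \<in> B" "b' \<in> B" using 1(1) 2(1) by (auto simp: local_connection_def)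
  have "geodesic_at \<kappa> \<gamma> t \<longleftrightarrow> geodesic_at \<kappa>' \<gamma> t"
    if im: "immersed_curve S B T \<gamma>" and sub: "\<gamma> ` T \<subseteq> lconn_dom \<kappa> \<inter> lconn_dom \<kappa>'" and t: "t \<in> T" for T \<gamma> t
  proof -
    have m: "\<gamma> t \<in> cdom b" "coord b (\<gamma> t) \<in> D" "\<gamma> t \<in> cdom b'" "coord b' (\<gamma> t) \<in> D'"
      using sub t by (auto simp: \<kappa> \<kappa>' lconn_dom_def)
    have y: "f (\<gamma> t) \<in> cdom a" "coord a (f (\<gamma> t)) \<in> W"
    proof -
      have "coord b (\<gamma> t) \<in> lrep_dom b a f" "lrep b a f (coord b (\<gamma> t)) \<in> W" using 1(3) m(2) by auto
      then show "f (\<gamma> t) \<in> cdom a" "coord a (f (\<gamma> t)) \<in> W"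
        using inj_onD[OF chart_inj[OF cS bB(1)], of "\<gamma> t"] m(1) by (auto simp: lrep_dom_def lrep_coord[OF bB(1)])
    qed
    have y': "f (\<gamma> t) \<in> cdom a'" "coord a' (f (\<gamma> t)) \<in> W'"
    proof -
      have "coord b' (\<gamma> t) \<in> lrep_dom b' a' f" "lrep b' a' f (coord b' (\<gamma> t)) \<in> W'" using 2(3) m(4) by auto
      then show "f (\<gamma> t) \<in> cdom a'" "coord a' (f (\<gamma> t)) \<in> W'"
        using inj_onD[OF chart_inj[OF cS bB(2)], of "\<gamma> t"] m(3) by (auto simp: lrep_dom_def lrep_coord[OF bB(2)])
    qed
    have "geodesic_at \<kappa> \<gamma> t \<longleftrightarrow> pregeo G (coord a \<circ> f \<circ> \<gamma>) t"
      unfolding \<kappa> by (rule induced_pregeo[OF 1 im t m(1,2)])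
    moreover have "geodesic_at \<kappa>' \<gamma> t \<longleftrightarrow> pregeo G' (coord a' \<circ> f \<circ> \<gamma>) t"
      unfolding \<kappa>' by (rule induced_pregeo[OF 2 im t m(3,4)])
    ultimately show ?thesis
      using pregeo_change[OF 1(2) 2(2) im t y y'] pregeo_change[OF 2(2) 1(2) im t y' y] by blast
  qed
  then show ?thesis unfolding proj_equivalent_def by blast
qed

text \<open>\<open>proj_geodesic\<close> may use a different connection near each parameter value.
  Each of them is projectively equivalent to the induced one, so a single connection
  decides.\<close>

lemma proj_geodesic_iff:
  assumes \<kappa>: "induced_connection A g B f \<kappa>" and im: "immersed_curve S B T \<gamma>" and sub: "\<gamma> ` T \<subseteq> lconn_dom \<kappa>"
  shows "proj_geodesic (beta_proj_structure A g S B f) T \<gamma> \<longleftrightarrow> (\<forall>t\<in>T. geodesic_at \<kappa> \<gamma> t)"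
proof
  assume "\<forall>t\<in>T. geodesic_at \<kappa> \<gamma> t"
  moreover have "\<kappa> \<in> beta_proj_structure A g S B f"
    using \<kappa> induced_equivalent by (auto simp: beta_proj_structure_def induced_connection_def)
  moreover have "open T" using im by (simp add: immersed_curve_def)
  ultimately show "proj_geodesic (beta_proj_structure A g S B f) T \<gamma>"
    unfolding proj_geodesic_def using sub by blast
next
  assume L: "proj_geodesic (beta_proj_structure A g S B f) T \<gamma>"
  show "\<forall>t\<in>T. geodesic_at \<kappa> \<gamma> t"
  proof
    fix t assume t: "t \<in> T"
    obtain \<kappa>' T' where \<kappa>': "\<kappa>' \<in> beta_proj_structure A g S B f" and T': "open T'" "t \<in> T'" "T' \<subseteq> T"
      "\<gamma> ` T' \<subseteq> lconn_dom \<kappa>'" "\<forall>s\<in>T'. geodesic_at \<kappa>' \<gamma> s"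
      using L[unfolded proj_geodesic_def, rule_format, OF t] by blast
    \<comment> \<open>\<open>immersed_curve\<close> demands a connected parameter domain, which T'
      need not be; hence a disc.\<close>
    obtain e where e: "e > 0" "ball t e \<subseteq> T'" using T'(1,2) open_contains_ball by blast
    have eT: "ball t e \<subseteq> T" using e(2) T'(3) by blast
    have im': "immersed_curve S B (ball t e) \<gamma>"
      unfolding immersed_curve_def
    proof (intro conjI ballI allI open_ball convex_connected[OF convex_ball])
      have "continuous_map (top_of_set T) S \<gamma>" using im by (simp add: immersed_curve_def)
      from continuous_map_from_subtopology[OF this, of "ball t e"]
      show "continuous_map (top_of_set (ball t e)) S \<gamma>"
        using eT by (simp add: subtopology_subtopology inf.absorb2)
      fix b assume b: "b \<in> B"
      show "(\<lambda>s. coord b (\<gamma> s) $ i) holomorphic_on ball t e \<inter> \<gamma> -` cdom b" for i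
      proof (rule holomorphic_on_subset)
        show "(\<lambda>s. coord b (\<gamma> s) $ i) holomorphic_on T \<inter> \<gamma> -` cdom b"
          using im b by (simp add: immersed_curve_def)
      qed (use eT in auto)
      show "cderiv (coord b \<circ> \<gamma>) s \<noteq> 0" if "s \<in> ball t e \<inter> \<gamma> -` cdom b" for s
        using im b eT that unfolding immersed_curve_def by blast
    qed
    have "proj_equivalent S B \<kappa>' \<kappa>" using \<kappa>' \<kappa> unfolding beta_proj_structure_def by blast
    moreover have "\<gamma> ` ball t e \<subseteq> lconn_dom \<kappa>' \<inter> lconn_dom \<kappa>" using e(2) eT T'(4) sub by blast
    ultimately have "\<forall>s\<in>ball t e. geodesic_at \<kappa> \<gamma> s"
      unfolding proj_equivalent_def using im' T'(5) e(2) by blast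
    then show "geodesic_at \<kappa> \<gamma> t" using e(1) by simp
  qed
qed

theorem flat: "flat_proj_structure S B (beta_proj_structure A g S B f)"
  unfolding flat_proj_structure_def
proof
  fix p assume p: "p \<in> topspace S"
  obtain b where b: "b \<in> B" "p \<in> cdom b" using p mS unfolding complex_manifold_def by blast
  have "f p \<in> topspace X" using p f_cont unfolding continuous_map_def by auto
  then obtain a where a: "a \<in> A" "f p \<in> cdom a" using manifold unfolding complex_manifold_def by blast
  define F where "F = lrep b a f"
  define z0 where "z0 = coord b p"
  have z0D: "z0 \<in> lrep_dom b a f" using a b by (auto simp: z0_def lrep_dom_def)
  interpret metric4 "g a" "cimg a" by (rule chart_metric[OF a(1)])
  note FD = lrep_dom_open[OF b(1) a(1)] lrep_holo[OF b(1) a(1)] lrep_img[OF b(1), of a]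
  have FS: "lrep b a f z \<in> cimg a" if "z \<in> lrep_dom b a f" for z using FD(3) that by blast
  have gd: "\<exists>v. cov_coord (g a) (lrep b a f) z i j = vd (lrep b a f) z v" if "z \<in> lrep_dom b a f" for z i j
    by (rule geod[OF self_local_metric[OF a(1)] b(1) that FS[OF that]])
  obtain D \<gamma> where D: "open D" "z0 \<in> D" "D \<subseteq> lrep_dom b a f"
    and \<gamma>: "\<And>k i j. holo_fun (\<lambda>z. \<gamma> z $ k $ i $ j) D" "\<And>z k i j. z \<in> D \<Longrightarrow> \<gamma> z $ k $ i $ j = \<gamma> z $ k $ j $ i"
    "\<And>z i j. z \<in> D \<Longrightarrow> cov_coord (g a) (lrep b a f) z i j = (\<Sum>k\<in>UNIV. \<gamma> z $ k $ i $ j *s vd (lrep b a f) z (axis k 1))"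
  proof (rule induced_connection_local[OF FD z0D lrep_inj[OF b(1) a(1)] gd])
    fix D' and \<gamma>' :: "complex^2 \<Rightarrow> complex^2^2^2"
    assume h: "open D'" "z0 \<in> D'" "D' \<subseteq> lrep_dom b a f" "\<And>k i j. holo_fun (\<lambda>z. \<gamma>' z $ k $ i $ j) D'"
      "\<And>z k i j. z \<in> D' \<Longrightarrow> \<gamma>' z $ k $ i $ j = \<gamma>' z $ k $ j $ i"
      "\<And>z i j. z \<in> D' \<Longrightarrow> cov_coord (g a) (lrep b a f) z i j = (\<Sum>k\<in>UNIV. \<gamma>' z $ k $ i $ j *s vd (lrep b a f) z (axis k 1))"
    show thesis by (rule that[OF h])
  qed
  note \<gamma> = \<gamma>[folded F_def]
  have Fh: "holo_map F D" using FD(2) D(3) by (auto simp: F_def holo_map_def holo_fun_iff)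
  interpret beta_patch "g a" "cimg a" F D \<gamma>
  proof unfold_locales
    have X: "surface_patch.X F i z = vd F z (axis i 1)" for i z
    proof -
      interpret surface_patch "g a" "cimg a" F D \<gamma>
        by unfold_locales (use D Fh FD(3) in \<open>auto simp: F_def\<close>)
      show ?thesis by (simp add: vec_eq_iff X_def)
    qed
    show "open D" by (rule D(1))
    show "holo_map F D" by (rule Fh)
    show "F ` D \<subseteq> cimg a" using D(3) FD(3) by (auto simp: F_def)
    fix z assume z: "z \<in> D"
    then have zD: "z \<in> lrep_dom b a f" using D(3) by blast
    show "gm (F z) (surface_patch.X F i z) (surface_patch.X F j z) = 0" for i j
      using lrep_null[OF b(1) a(1) zD, folded F_def] by (simp add: X gm_def)
    show "Wl (F z) x y (surface_patch.X F 1 z) (surface_patch.X F 2 z) = 0" for x y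
      using lrep_weyl(1)[OF b(1) a(1) zD, folded F_def] by (simp add: X)
    show "dd (\<lambda>w. Wl w (surface_patch.X F 1 z) (surface_patch.X F 2 z) (surface_patch.X F 1 z) (surface_patch.X F 2 z)) (F z) t = 0" for t
      using lrep_weyl(2)[OF b(1) a(1) zD, folded F_def] by (simp add: X)
    show "c = 0 \<and> d = 0" if "c *s surface_patch.X F 1 z + d *s surface_patch.X F 2 z = 0" for c d
    proof -
      have "vd F z (vector [c, d]) = c *s vd F z (axis 1 1) + d *s vd F z (axis 2 1)"
        by (subst axis_expansion_2[of "vector [c, d]"]) (simp add: vd_linear vector_2)
      then have "vector [c, d] = (0 :: complex^2)"
        using that lrep_inj[OF b(1) a(1) zD, folded F_def, of "vector [c, d]"] by (simp add: X)
      then show ?thesis by (simp add: vec_eq_iff forall_2 vector_2)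
    qed
    show "cov_coord (g a) F z i j = (\<Sum>k\<in>UNIV. \<gamma> z $ k $ i $ j *s surface_patch.X F k z)" for i j
      using \<gamma>(3)[OF z] by (simp add: X)
    show "\<gamma> z $ k $ i $ j = \<gamma> z $ k $ j $ i" for k i j by (rule \<gamma>(2)[OF z])
  qed (rule \<gamma>(1))
  obtain r \<sigma> where r: "0 < r" "ball z0 r \<subseteq> D" and \<sigma>: "\<And>k. hess_solution \<gamma> (beta_patch.p (g a) F) (ball z0 r) (\<sigma> k)"
    and \<sigma>0: "\<And>k. \<sigma> k z0 = (if k = (1::3) then 1 else 0)"
    "\<And>k. cpartial 1 (\<sigma> k) z0 = (if k = 2 then 1 else 0)" "\<And>k. cpartial 2 (\<sigma> k) z0 = (if k = 3 then 1 else 0)"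
    using hess_solutions_exist[OF D(1,2) \<gamma>(1,2) p_holo p_sym gauss cotton_p] by blast
  have \<sigma>h: "holo_fun (\<sigma> k) (ball z0 r)" for k using \<sigma> by (simp add: hess_solution_def)
  have \<sigma>1: "holo_fun (cpartial i (\<sigma> k)) (ball z0 r)" for i k by (rule holo_fun_cpartial[OF open_ball \<sigma>h])
  have z0r: "z0 \<in> ball z0 r" using r by simp
  \<comment> \<open>The matrix of 1-jets of the three solutions, the identity at \<open>z0\<close>
    by the choice of initial values.\<close>
  define M where "M = (\<lambda>z. (\<chi> i k. if i = 1 then \<sigma> k z else if i = 2 then cpartial 1 (\<sigma> k) z else cpartial 2 (\<sigma> k) z) :: complex^3^3)"
  have Mc: "cdiff_at (\<lambda>z. M z $ i $ k) z" if "z \<in> ball z0 r" for z i k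
    using holo_funD[OF \<sigma>h that] holo_funD[OF \<sigma>1 that] by (cases "i = 1"; cases "i = 2"; simp add: M_def)
  have M0: "M z0 = mat 1"
    using exhaust_3 by (auto simp: M_def mat_def vec_eq_iff \<sigma>0)
  \<comment> \<open>A single function controls two open conditions: linearly independent 1-jets, and
    a nonzero first homogeneous coordinate.\<close>
  define w where "w = (\<lambda>z. det (M z) * \<sigma> 1 z)"
  have wc: "continuous_on (ball z0 r) w"
    unfolding w_def
    by (intro continuous_at_imp_continuous_on ballI cdiff_isCont cdiff_mult cdiff_det Mc holo_funD[OF \<sigma>h])
  define U where "U = {z \<in> ball z0 r. w z \<noteq> 0}"
  have U: "open U" "z0 \<in> U" "U \<subseteq> ball z0 r"
  proof -
    from continuous_open_preimage[OF wc open_ball, of "- {0}"]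
    have "open (ball z0 r \<inter> w -` (- {0}))" by auto
    moreover have "U = ball z0 r \<inter> w -` (- {0})" by (auto simp: U_def)
    ultimately show "open U" by simp
    show "z0 \<in> U" using z0r by (simp add: U_def w_def M0 \<sigma>0)
    show "U \<subseteq> ball z0 r" by (auto simp: U_def)
  qed
  have s1: "\<sigma> 1 z \<noteq> 0" and dM: "det (M z) \<noteq> 0" if "z \<in> U" for z using that by (auto simp: U_def w_def)
  define s where "s = (\<lambda>z. (\<chi> k. \<sigma> k z) :: complex^3)"
  define \<phi> where "\<phi> = (\<lambda>z. aff3 1 (s z))"
  have \<phi>n: "\<phi> z $ 1 = \<sigma> 2 z / \<sigma> 1 z" "\<phi> z $ 2 = \<sigma> 3 z / \<sigma> 1 z" for z
    by (simp_all add: \<phi>_def aff3_def s_def vector_2 three_index)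
  have \<phi>h: "holo_map \<phi> U"
    unfolding holo_map_def holo_fun_iff
  proof (intro allI ballI)
    fix k z assume z: "z \<in> U"
    then have zr: "z \<in> ball z0 r" using U(3) by blast
    show "cdiff_at (\<lambda>z. \<phi> z $ k) z"
      using exhaust_2[of k] s1[OF z] holo_funD[OF \<sigma>h zr] by (auto simp: \<phi>n simp del: mem_ball intro!: cdiff_divide)
  qed
  \<comment> \<open>At \<open>z0\<close> the first coordinate is 1 and the other two are 0, so the
    quotient rule gives the identity as derivative of the affine coordinates.\<close>
  have \<phi>inj: "v = 0" if "\<And>k. (\<Sum>i\<in>UNIV. cpartial i (\<lambda>w. \<phi> w $ k) z0 * v $ i) = 0" for v
  proof -
    note c = holo_funD[OF \<sigma>h z0r]
    have d: "cpartial i (\<lambda>w. \<sigma> k w / \<sigma> 1 w) z0 = cpartial i (\<sigma> k) z0 - \<sigma> k z0 * cpartial i (\<sigma> 1) z0" for i k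
      by (subst cpartial_divide[OF c c]) (simp_all add: \<sigma>0)
    have "v $ 1 = 0" using that[of 1] by (simp add: sum_2 \<phi>n d \<sigma>0)
    moreover have "v $ 2 = 0" using that[of 2] by (simp add: sum_2 \<phi>n d \<sigma>0)
    ultimately show ?thesis by (simp add: vec_eq_iff forall_2)
  qed
  obtain U' V \<psi> where U': "open U'" "z0 \<in> U'" "U' \<subseteq> U" and V: "open V" and hom: "homeomorphism U' V \<phi> \<psi>" and \<psi>: "holo_map \<psi> V"
    by (rule holo_inverse_function[OF U(1,2) \<phi>h \<phi>inj])
  have U'r: "U' \<subseteq> ball z0 r" and U'D: "U' \<subseteq> D" using U'(3) U(3) r(2) by auto
  have U'b: "U' \<subseteq> cimg b" using U'D D(3) by (auto simp: lrep_dom_def)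
  define N where "N = {x \<in> cdom b. coord b x \<in> U'}"
  define \<Phi> where "\<Phi> = (\<lambda>x. line (s (coord b x)))"
  have bi: "biholo_between S B N CP2_top CP2_atlas {l \<in> cdom (CP2_chart 1). coord (CP2_chart 1) l \<in> V} \<Phi>"
    unfolding N_def
  proof (rule local_chart_biholo[OF cS charted_CP2 b(1) _ U'(1) U'b V _ _ \<psi> hom])
    show "CP2_chart 1 \<in> CP2_atlas" by (simp add: CP2_atlas_def)
    show "V \<subseteq> cimg (CP2_chart 1)" by (simp only: cimg_CP2_chart subset_UNIV)
    show "holo_map \<phi> U'" using \<phi>h U'(3) by (auto simp: holo_map_def holo_fun_iff)
    fix x assume "x \<in> cdom b" "coord b x \<in> U'"
    then have "s (coord b x) $ 1 \<noteq> 0" using s1 U'(3) by (auto simp: s_def)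
    then show "\<Phi> x = cinv (CP2_chart 1) (\<phi> (coord b x))"
      by (simp add: \<Phi>_def \<phi>_def cinv_CP2_chart line_lift3)
  qed
  have \<kappa>: "induced_connection A g B f (b, D, \<gamma>)"
  proof -
    have "local_connection B (b, D, \<gamma>)"
      using b(1) D \<gamma>(1,2) by (auto simp: local_connection_def lrep_dom_def)
    moreover have "D \<subseteq> lrep_dom b a f \<inter> lrep b a f -` cimg a" using D(3) FS by auto
    moreover have "\<forall>z\<in>D. \<forall>i j. cov_coord (g a) (lrep b a f) z i j =
        (\<Sum>k\<in>UNIV. \<gamma> z $ k $ i $ j *s column k (jac (lrep b a f) z))"
      using \<gamma>(3) unfolding F_def column_jac by blast
    ultimately show ?thesis
      unfolding induced_connection_def prod.case using self_local_metric[OF a(1)] by blast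
  qed
  have "proj_geodesic (beta_proj_structure A g S B f) T c \<longleftrightarrow> in_proj_line (\<Phi> ` c ` T)"
    if im: "immersed_curve S B T c" and cN: "c ` T \<subseteq> N" for T c
  proof -
    have T: "open T" "connected T" using im by (auto simp: immersed_curve_def)
    have cb: "c t \<in> cdom b" "coord b (c t) \<in> U'" if "t \<in> T" for t using cN that by (auto simp: N_def)
    have "proj_geodesic (beta_proj_structure A g S B f) T c \<longleftrightarrow> (\<forall>t\<in>T. geodesic_at (b, D, \<gamma>) c t)"
      by (rule proj_geodesic_iff[OF \<kappa> im]) (use cb U'D in \<open>auto simp: lconn_dom_def\<close>)
    also have "\<dots> \<longleftrightarrow> (\<exists>k. k \<noteq> 0 \<and> (\<forall>t\<in>T. (\<Sum>i\<in>UNIV. k $ i * \<sigma> i ((coord b \<circ> c) t)) = 0))"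
      unfolding geodesic_at_acc
    proof (rule geodesic_iff_line[OF U'(1)])
      show "hess_solution \<gamma> (beta_patch.p (g a) F) U' (\<sigma> i)" for i by (rule hess_solution_subset[OF \<sigma> U'r])
      show "holo_fun (\<lambda>z. \<gamma> z $ k $ i $ j) U'" for k i j using \<gamma>(1) U'D by (auto simp: holo_fun_iff)
      show "holo_fun (beta_patch.p (g a) F i j) U'" for i j using p_holo U'D by (auto simp: holo_fun_iff)
      show "open T" "connected T" by (rule T)+
      show "(\<lambda>t. (coord b \<circ> c) t $ i) holomorphic_on T" for i
        by (rule immersed_holomorphic[OF im b(1) subset_refl cb(1)])
      show "(coord b \<circ> c) ` T \<subseteq> U'" using cb by auto
      show "cderiv (coord b \<circ> c) t \<noteq> 0" if "t \<in> T" for t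
        using im b(1) that cb(1)[OF that] unfolding immersed_curve_def by blast
      fix z and k :: "complex^3"
      assume z: "z \<in> U'" and k0: "(\<Sum>i\<in>UNIV. k $ i * \<sigma> i z) = 0" and k1: "\<And>j. (\<Sum>i\<in>UNIV. k $ i * cpartial j (\<sigma> i) z) = 0"
      \<comment> \<open>The three components are the value and the two first derivatives of the
        combination at z.\<close>
      have "(M z *v k) $ i = 0" for i
        using exhaust_3[of i] k0 k1[of 1] k1[of 2] by (auto simp: M_def matrix_vector_mult_def mult.commute)
      then have "M z *v k = 0" by (simp add: vec_eq_iff)
      then show "k = 0" using det_nonzero_kernel dM z U'(3) by blast
    qed
    also have "\<dots> \<longleftrightarrow> (\<exists>k. k \<noteq> 0 \<and> (\<forall>v\<in>(\<lambda>t. s (coord b (c t))) ` T. dot3 k v = 0))"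
      by (simp add: dot3_def s_def)
    also have "\<dots> \<longleftrightarrow> in_proj_line (\<Phi> ` c ` T)"
      unfolding in_proj_line_iff[symmetric] by (simp add: \<Phi>_def image_image)
    finally show ?thesis .
  qed
  moreover have "p \<in> N" using b U'(2) by (simp add: N_def z0_def)
  ultimately show "\<exists>N M \<Phi>. p \<in> N \<and> biholo_between S B N CP2_top CP2_atlas M \<Phi> \<and>
      (\<forall>T \<gamma>. immersed_curve S B T \<gamma> \<and> \<gamma> ` T \<subseteq> N \<longrightarrow>
         (proj_geodesic (beta_proj_structure A g S B f) T \<gamma> \<longleftrightarrow> in_proj_line (\<Phi> ` \<gamma> ` T)))"
    using bi by blast
qed

end

theorem corollary3:
  fixes X :: "'m topology" and A :: "('m, 4) chart set"
    and g :: "'m conf" and st :: "'m star"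
    and S :: "'b topology" and B :: "('b, 2) chart set" and f :: "'b \<Rightarrow> 'm"
  assumes "complex_manifold X A"
    and "conformal_structure A g"
    and "orientation A g st"
    and "self_dual A g st"
    and "beta_surface X A g st S B f"
  shows "flat_proj_structure S B (beta_proj_structure A g S B f)"
proof -
  interpret selfdual_beta_surface X A g st S B f
    by unfold_locales (use assms in \<open>auto simp: beta_surface_def\<close>)
  show ?thesis by (rule flat)
qed

end
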